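(* Let $\hat f:M^n\to\mathbb{R}^{n+q}$ be a strongly genuine deformation of an isometric immersion $f:M^n\to\mathbb{R}^{n+p}$, and let $\tau:L^\ell\subset T_f^\perp M\to\hat L^\ell\subset T_{\hat f}^\perp M$ be a parallel vector bundle isometry that preserves second fundamental forms ($\ell\ge 0$; the case $\ell=0$, $\tau=0$ is allowed). Let $D\subset TM\oplus L^\ell$ be a subbundle such that $\phi_\tau(TM,D)$ is a null subset. Then $D\subset TM$ and, along each connected component of an open dense subset of $M^n$, $f$ and $\hat f$ are mutually $\bar D$-ruled.
   Context: Superscripts denote dimension or rank; manifolds, bundles and maps are smooth. Singular isometric extension: a pair of isometric immersions $f:M^n\to\mathbb{R}^{n+p}$ and $\hat f:M^n\to\mathbb{R}^{n+q}$ singularly extends isometrically if there are a manifold $N^{n+s}$ with $s>0$, an embedding $j:M^n\hookrightarrow N^{n+s}$, and isometric maps $F:N^{n+s}\to\mathbb{R}^{n+p}$ and $\hat F:N^{n+s}\to\mathbb{R}^{n+q}$ (i.e. smooth maps inducing the same, possibly degenerate, metric on $N^{n+s}$) such that $f=F\circ j$ and $\hat f=\hat F\circ j$, and the set of points where $F$ and $\hat F$ fail to be immersions (possibly empty) is contained in $j(M)$. The isometric immersion $\hat f$ is a strongly genuine deformation of $f$ if there is no (nonempty) open subset $U\subset M^n$ along which $f|_U$ and $\hat f|_U$ singularly extend isometrically. The isometry $\tau$: $T_f^\perp M$, $T_{\hat f}^\perp M$ are the normal bundles, with second fundamental forms $\alpha,\hat\alpha$ and normal connections $\nabla^\perp,\hat\nabla^\perp$;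 $L^\ell$, $\hat L^\ell$ are rank $\ell$ normal subbundles, and subscripts such as $(\cdot)_L$ denote orthogonal projection. That $\tau$ is parallel and preserves second fundamental forms means $\tau\circ\alpha_L=\hat\alpha_{\hat L}$ and $\tau((\nabla^\perp_X\xi)_L)=(\hat\nabla^\perp_X\tau\xi)_{\hat L}$ for all $X\in TM$, $\xi\in L$. Set $\bar\tau=\mathrm{Id}\oplus\tau:TM\oplus L\to TM\oplus\hat L$. The form $\phi_\tau$: $\phi_\tau:TM\times(TM\oplus L)\to L^\perp\times\hat L^\perp$ is $$\phi_\tau(X,v)=\big((\tilde\nabla_Xv)_{L^\perp},(\tilde\nabla_X\bar\tau v)_{\hat L^\perp}\big),$$ where $\tilde\nabla$ is the connection of the Euclidean ambient spaces, and $L^\perp\subset T^\perp_fM$, $\hat L^\perp\subset T^\perp_{\hat f}M$ are orthogonal complements in the normal bundles. $L^\perp\times\hat L^\perp$ carries the semi-Riemannian metric $\langle\,,\rangle=\langle\,,\rangle|_{L^\perp}-\langle\,,\rangle|_{\hat L^\perp}$. A subset $S$ is null if $\langle\eta,\xi\rangle=0$ for all $\eta,\xi\in S$. Ruled: for an arbitrary distribution $D^d\subset TM$, $f$ is $\bar D^d$-ruled if for each $x\in M^n$ there is a totally geodesic submanifold of $M^n$ tangent to $D(x)$ at $x$ which is mapped by $f$ to an open subset of a $d$-dimensional affine subspace. $f$ and $\hat f$ are mutually $\bar D$-ruled if both are $\bar D$-ruled with the same rulings. *)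

theory Defs
  imports "HOL-Analysis.Analysis"
begin

section \<open>Smooth manifolds of arbitrary finite dimension\<close>

text \<open>
  The dimension of the manifold in a singular extension is quantified inside a formula, so it
  cannot be a type. Charts of an \<open>m\<close>-manifold therefore take values in \<open>RR m\<close>, a copy of
  \<open>m\<close>-space inside the normed space of bounded real sequences. The ambient normed space is only
  a container for all the \<open>RR m\<close>; on each of them it induces the usual topology.
\<close>

type_synonym seqs = "nat \<Rightarrow>\<^sub>C real"

definition RR :: "nat \<Rightarrow> seqs set" where
  "RR m = {x. \<forall>i\<ge>m. apply_bcontfun x i = 0}"

definition dir_deriv :: "seqs \<Rightarrow> (seqs \<Rightarrow> 'b::real_normed_vector) \<Rightarrow> seqs \<Rightarrow> 'b" where
  "dir_deriv v g x = vector_derivative (\<lambda>t::real. g (x + t *\<^sub>R v)) (at 0)"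

text \<open>\<open>U\<close> is meant to be relatively open in \<open>RR m\<close>.\<close>

primrec C_k_on :: "nat \<Rightarrow> nat \<Rightarrow> seqs set \<Rightarrow> (seqs \<Rightarrow> 'b::real_normed_vector) \<Rightarrow> bool" where
  "C_k_on 0 m U g \<longleftrightarrow> continuous_on U g"
| "C_k_on (Suc k) m U g \<longleftrightarrow> continuous_on U g \<and>
     (\<forall>v\<in>RR m. (\<forall>x\<in>U. (\<lambda>t::real. g (x + t *\<^sub>R v)) differentiable (at 0)) \<and>
               C_k_on k m U (dir_deriv v g))"

definition smooth_on :: "nat \<Rightarrow> seqs set \<Rightarrow> (seqs \<Rightarrow> 'b::real_normed_vector) \<Rightarrow> bool" where
  "smooth_on m U g \<longleftrightarrow> (\<forall>k. C_k_on k m U g)"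

record 'a mfd =
  mtop :: "'a topology"
  mdim :: nat
  mcharts :: "('a set \<times> ('a \<Rightarrow> seqs)) set"

abbreviation points :: "'a mfd \<Rightarrow> 'a set" where
  "points M \<equiv> topspace (mtop M)"

text \<open>The atlas need not be maximal.\<close>

definition smooth_manifold :: "'a mfd \<Rightarrow> bool" where
  "smooth_manifold M \<longleftrightarrow>
     Hausdorff_space (mtop M) \<and> second_countable (mtop M) \<and>
     (\<Union>(V, c)\<in>mcharts M. V) = points M \<and>
     (\<forall>(V, c)\<in>mcharts M.
        openin (mtop M) V \<and> openin (top_of_set (RR (mdim M))) (c ` V) \<and>
        homeomorphic_map (subtopology (mtop M) V) (top_of_set (c ` V)) c) \<and>
     (\<forall>(V, c)\<in>mcharts M. \<forall>(W, d)\<in>mcharts M.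
        smooth_on (mdim M) (c ` (V \<inter> W)) (d \<circ> inv_into V c))"

definition open_submfd :: "'a mfd \<Rightarrow> 'a set \<Rightarrow> 'a mfd" where
  "open_submfd M U =
     \<lparr>mtop = subtopology (mtop M) U, mdim = mdim M,
      mcharts = (\<lambda>(V, c). (V \<inter> U, c)) ` mcharts M\<rparr>"

definition smooth_fun :: "'a mfd \<Rightarrow> 'a set \<Rightarrow> ('a \<Rightarrow> 'b::real_normed_vector) \<Rightarrow> bool" where
  "smooth_fun M U g \<longleftrightarrow> openin (mtop M) U \<and>
     (\<forall>(V, c)\<in>mcharts M. smooth_on (mdim M) (c ` (V \<inter> U)) (g \<circ> inv_into V c))"

definition smooth_at :: "'a mfd \<Rightarrow> 'a \<Rightarrow> ('a \<Rightarrow> real) \<Rightarrow> bool" where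
  "smooth_at M x g \<longleftrightarrow> (\<exists>U. x \<in> U \<and> smooth_fun M U g)"

definition smooth_map :: "'a mfd \<Rightarrow> 'b mfd \<Rightarrow> ('a \<Rightarrow> 'b) \<Rightarrow> bool" where
  "smooth_map M N j \<longleftrightarrow> continuous_map (mtop M) (mtop N) j \<and>
     (\<forall>(V, c)\<in>mcharts M. \<forall>(W, d)\<in>mcharts N.
        smooth_on (mdim M) (c ` {x \<in> V. j x \<in> W}) (d \<circ> j \<circ> inv_into V c))"


section \<open>Tangent vectors and vector fields\<close>

text \<open>
  A tangent vector at \<open>x\<close> is a derivation on functions smooth near \<open>x\<close>, of the form
  \<open>\<Sum>\<^sub>i a\<^sub>i \<partial>/\<partial>x\<^sub>i\<close> in a chart. It is set to \<open>0\<close> on functions not smooth near \<open>x\<close>, which makes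
  it independent of the chart as a function.
\<close>

type_synonym 'a tvec = "('a \<Rightarrow> real) \<Rightarrow> real"

definition chart_vector :: "'a mfd \<Rightarrow> 'a set \<times> ('a \<Rightarrow> seqs) \<Rightarrow> 'a \<Rightarrow> seqs \<Rightarrow> 'a tvec" where
  "chart_vector M = (\<lambda>(V, c) x a g.
     if smooth_at M x g then dir_deriv a (g \<circ> inv_into V c) (c x) else 0)"

definition tangent_space :: "'a mfd \<Rightarrow> 'a \<Rightarrow> 'a tvec set" where
  "tangent_space M x =
     {chart_vector M (V, c) x a | V c a. (V, c) \<in> mcharts M \<and> x \<in> V \<and> a \<in> RR (mdim M)}"

text \<open>\<open>vderiv X f\<close> is the derivative \<open>f\<^sub>*X\<close> (or, for a field \<open>v\<close> along a map into a Euclidean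
  space, the ambient covariant derivative of \<open>v\<close> in the direction \<open>X\<close>).\<close>

definition vderiv :: "'a tvec \<Rightarrow> ('a \<Rightarrow> 'v::euclidean_space) \<Rightarrow> 'v" where
  "vderiv X f = (\<Sum>b\<in>Basis. X (\<lambda>y. f y \<bullet> b) *\<^sub>R b)"

definition pushforward :: "'b mfd \<Rightarrow> ('a \<Rightarrow> 'b) \<Rightarrow> 'a \<Rightarrow> 'a tvec \<Rightarrow> 'b tvec" where
  "pushforward N j x X = (\<lambda>g. if smooth_at N (j x) g then X (g \<circ> j) else 0)"

definition smooth_embedding :: "'a mfd \<Rightarrow> 'b mfd \<Rightarrow> ('a \<Rightarrow> 'b) \<Rightarrow> bool" where
  "smooth_embedding M N j \<longleftrightarrow> smooth_map M N j \<and> embedding_map (mtop M) (mtop N) j \<and>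
     (\<forall>x\<in>points M. inj_on (pushforward N j x) (tangent_space M x))"

definition immersion_at :: "'a mfd \<Rightarrow> ('a \<Rightarrow> 'v::euclidean_space) \<Rightarrow> 'a \<Rightarrow> bool" where
  "immersion_at M f x \<longleftrightarrow> inj_on (\<lambda>X. vderiv X f) (tangent_space M x)"

definition vector_field :: "'a mfd \<Rightarrow> 'a set \<Rightarrow> ('a \<Rightarrow> 'a tvec) \<Rightarrow> bool" where
  "vector_field M U Y \<longleftrightarrow> openin (mtop M) U \<and> (\<forall>y\<in>U. Y y \<in> tangent_space M y) \<and>
     (\<forall>W g. W \<subseteq> U \<and> smooth_fun M W g \<longrightarrow> smooth_fun M W (\<lambda>y. Y y g))"

definition bracket :: "'a mfd \<Rightarrow> ('a \<Rightarrow> 'a tvec) \<Rightarrow> ('a \<Rightarrow> 'a tvec) \<Rightarrow> 'a \<Rightarrow> 'a tvec" where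
  "bracket M X Y x = (\<lambda>g. if smooth_at M x g
     then X x (\<lambda>y. Y y g) - Y x (\<lambda>y. X y g) else 0)"


section \<open>Riemannian metrics\<close>

type_synonym 'a metric = "'a \<Rightarrow> 'a tvec \<Rightarrow> 'a tvec \<Rightarrow> real"

definition riemannian_metric :: "'a mfd \<Rightarrow> 'a metric \<Rightarrow> bool" where
  "riemannian_metric M G \<longleftrightarrow>
     (\<forall>x\<in>points M. \<forall>X\<in>tangent_space M x. \<forall>Y\<in>tangent_space M x.
        G x X Y = G x Y X \<and> (X \<noteq> (\<lambda>_. 0) \<longrightarrow> G x X X > 0) \<and>
        (\<forall>Z\<in>tangent_space M x. \<forall>a b. G x (\<lambda>g. a * X g + b * Y g) Z = a * G x X Z + b * G x Y Z)) \<and>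
     (\<forall>U X Y. vector_field M U X \<and> vector_field M U Y \<longrightarrow> smooth_fun M U (\<lambda>x. G x (X x) (Y x)))"

text \<open>The Levi-Civita connection, through the Koszul formula.\<close>

definition levi_civita ::
  "'a mfd \<Rightarrow> 'a metric \<Rightarrow> ('a \<Rightarrow> 'a tvec) \<Rightarrow> ('a \<Rightarrow> 'a tvec) \<Rightarrow> 'a \<Rightarrow> 'a tvec" where
  "levi_civita M G X Y x = (THE V. V \<in> tangent_space M x \<and>
     (\<forall>U Z. x \<in> U \<and> vector_field M U Z \<longrightarrow>
        2 * G x V (Z x) =
          X x (\<lambda>y. G y (Y y) (Z y)) + Y x (\<lambda>y. G y (X y) (Z y)) - Z x (\<lambda>y. G y (X y) (Y y))
          + G x (bracket M X Y x) (Z x) - G x (bracket M X Z x) (Y x)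
          - G x (bracket M Y Z x) (X x)))"

text \<open>A submanifold is a manifold \<open>S\<close> on a set of points of \<open>M\<close> whose inclusion is an embedding.\<close>

definition submanifold :: "'a mfd \<Rightarrow> 'a mfd \<Rightarrow> bool" where
  "submanifold S M \<longleftrightarrow> smooth_manifold S \<and> smooth_embedding S M id"

definition sub_tangent :: "'a mfd \<Rightarrow> 'a mfd \<Rightarrow> 'a \<Rightarrow> 'a tvec set" where
  "sub_tangent S M x = pushforward M id x ` tangent_space S x"

definition totally_geodesic :: "'a mfd \<Rightarrow> 'a mfd \<Rightarrow> 'a metric \<Rightarrow> bool" where
  "totally_geodesic S M G \<longleftrightarrow>
     (\<forall>U X Y. vector_field M U X \<and> vector_field M U Y \<and>
        (\<forall>z\<in>U \<inter> points S. X z \<in> sub_tangent S M z \<and> Y z \<in> sub_tangent S M z) \<longrightarrow>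
        (\<forall>z\<in>U \<inter> points S. levi_civita M G X Y z \<in> sub_tangent S M z))"

definition isometric_immersion ::
  "'a mfd \<Rightarrow> 'a metric \<Rightarrow> ('a \<Rightarrow> 'v::euclidean_space) \<Rightarrow> bool" where
  "isometric_immersion M G f \<longleftrightarrow> smooth_fun M (points M) f \<and>
     (\<forall>x\<in>points M. immersion_at M f x \<and>
        (\<forall>X\<in>tangent_space M x. \<forall>Y\<in>tangent_space M x. vderiv X f \<bullet> vderiv Y f = G x X Y))"


section \<open>Singular isometric extensions\<close>

text \<open>
  The points of \<open>N\<close> are drawn from the type of bounded sequences. This is no restriction: a second
  countable Hausdorff manifold has at most continuum many points, so it can be transported to
  a subset of that type.
\<close>

definition singularly_extend ::
  "'a mfd \<Rightarrow> ('a \<Rightarrow> 'v::euclidean_space) \<Rightarrow> ('a \<Rightarrow> 'w::euclidean_space) \<Rightarrow> bool" where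
  "singularly_extend M f fh \<longleftrightarrow>
     (\<exists>s>0. \<exists>N :: seqs mfd. \<exists>j F Fh.
        smooth_manifold N \<and> mdim N = mdim M + s \<and> smooth_embedding M N j \<and>
        smooth_fun N (points N) F \<and> smooth_fun N (points N) Fh \<and>
        (\<forall>y\<in>points N. \<forall>X\<in>tangent_space N y. \<forall>Y\<in>tangent_space N y.
           vderiv X (F :: seqs \<Rightarrow> 'v) \<bullet> vderiv Y F = vderiv X (Fh :: seqs \<Rightarrow> 'w) \<bullet> vderiv Y Fh) \<and>
        (\<forall>x\<in>points M. f x = F (j x) \<and> fh x = Fh (j x)) \<and>
        {y \<in> points N. \<not> immersion_at N F y \<or> \<not> immersion_at N Fh y} \<subseteq> j ` points M)"

definition strongly_genuine ::
  "'a mfd \<Rightarrow> ('a \<Rightarrow> 'v::euclidean_space) \<Rightarrow> ('a \<Rightarrow> 'w::euclidean_space) \<Rightarrow> bool" where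
  "strongly_genuine M f fh \<longleftrightarrow>
     \<not> (\<exists>U. openin (mtop M) U \<and> U \<noteq> {} \<and> singularly_extend (open_submfd M U) f fh)"


section \<open>Normal bundles\<close>

definition orth_proj :: "'v::euclidean_space set \<Rightarrow> 'v \<Rightarrow> 'v" where
  "orth_proj E w = (THE u. u \<in> E \<and> (\<forall>z\<in>E. orthogonal (w - u) z))"

definition normal_space :: "'a mfd \<Rightarrow> ('a \<Rightarrow> 'v::euclidean_space) \<Rightarrow> 'a \<Rightarrow> 'v set" where
  "normal_space M f x = ((\<lambda>X. vderiv X f) ` tangent_space M x)\<^sup>\<bottom>"

text \<open>\<open>Y\<close> is a vector field near \<open>x\<close>, and \<open>X\<close> a tangent vector at \<open>x\<close>.\<close>

definition sff ::
  "'a mfd \<Rightarrow> ('a \<Rightarrow> 'v::euclidean_space) \<Rightarrow> 'a \<Rightarrow> 'a tvec \<Rightarrow> ('a \<Rightarrow> 'a tvec) \<Rightarrow> 'v" where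
  "sff M f x X Y = orth_proj (normal_space M f x) (vderiv X (\<lambda>y. vderiv (Y y) f))"

definition normal_connection ::
  "'a mfd \<Rightarrow> ('a \<Rightarrow> 'v::euclidean_space) \<Rightarrow> 'a \<Rightarrow> 'a tvec \<Rightarrow> ('a \<Rightarrow> 'v) \<Rightarrow> 'v" where
  "normal_connection M f x X \<xi> = orth_proj (normal_space M f x) (vderiv X \<xi>)"

definition normal_subbundle ::
  "'a mfd \<Rightarrow> ('a \<Rightarrow> 'v::euclidean_space) \<Rightarrow> nat \<Rightarrow> ('a \<Rightarrow> 'v set) \<Rightarrow> bool" where
  "normal_subbundle M f l L \<longleftrightarrow>
     (\<forall>x\<in>points M. L x \<subseteq> normal_space M f x \<and>
       (\<exists>U \<xi>. openin (mtop M) U \<and> x \<in> U \<and> (\<forall>i<l. smooth_fun M U (\<xi> i)) \<and>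
         (\<forall>y\<in>U. inj_on (\<lambda>i. \<xi> i y) {..<l} \<and> independent ((\<lambda>i. \<xi> i y) ` {..<l}) \<and>
                 L y = span ((\<lambda>i. \<xi> i y) ` {..<l}))))"

definition normal_section ::
  "'a mfd \<Rightarrow> ('a \<Rightarrow> 'v::euclidean_space set) \<Rightarrow> 'a set \<Rightarrow> ('a \<Rightarrow> 'v) \<Rightarrow> bool" where
  "normal_section M L U \<xi> \<longleftrightarrow> smooth_fun M U \<xi> \<and> (\<forall>y\<in>U. \<xi> y \<in> L y)"

definition bundle_isometry ::
  "'a mfd \<Rightarrow> ('a \<Rightarrow> 'v::euclidean_space set) \<Rightarrow> ('a \<Rightarrow> 'w::euclidean_space set) \<Rightarrow>
   ('a \<Rightarrow> 'v \<Rightarrow> 'w) \<Rightarrow> bool" where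
  "bundle_isometry M L Lh \<tau> \<longleftrightarrow>
     (\<forall>x\<in>points M. bij_betw (\<tau> x) (L x) (Lh x) \<and>
        (\<forall>u\<in>L x. \<forall>v\<in>L x. \<tau> x u \<bullet> \<tau> x v = u \<bullet> v \<and>
           (\<forall>a b. \<tau> x (a *\<^sub>R u + b *\<^sub>R v) = a *\<^sub>R \<tau> x u + b *\<^sub>R \<tau> x v))) \<and>
     (\<forall>U \<xi>. normal_section M L U \<xi> \<longrightarrow> smooth_fun M U (\<lambda>y. \<tau> y (\<xi> y)))"

definition preserves_sff ::
  "'a mfd \<Rightarrow> ('a \<Rightarrow> 'v::euclidean_space) \<Rightarrow> ('a \<Rightarrow> 'w::euclidean_space) \<Rightarrow>
   ('a \<Rightarrow> 'v set) \<Rightarrow> ('a \<Rightarrow> 'w set) \<Rightarrow> ('a \<Rightarrow> 'v \<Rightarrow> 'w) \<Rightarrow> bool" where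
  "preserves_sff M f fh L Lh \<tau> \<longleftrightarrow>
     (\<forall>U Y. vector_field M U Y \<longrightarrow> (\<forall>x\<in>U. \<forall>X\<in>tangent_space M x.
        \<tau> x (orth_proj (L x) (sff M f x X Y)) = orth_proj (Lh x) (sff M fh x X Y)))"

definition parallel_isometry ::
  "'a mfd \<Rightarrow> ('a \<Rightarrow> 'v::euclidean_space) \<Rightarrow> ('a \<Rightarrow> 'w::euclidean_space) \<Rightarrow>
   ('a \<Rightarrow> 'v set) \<Rightarrow> ('a \<Rightarrow> 'w set) \<Rightarrow> ('a \<Rightarrow> 'v \<Rightarrow> 'w) \<Rightarrow> bool" where
  "parallel_isometry M f fh L Lh \<tau> \<longleftrightarrow>
     (\<forall>U \<xi>. normal_section M L U \<xi> \<longrightarrow> (\<forall>x\<in>U. \<forall>X\<in>tangent_space M x.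
        \<tau> x (orth_proj (L x) (normal_connection M f x X \<xi>)) =
        orth_proj (Lh x) (normal_connection M fh x X (\<lambda>y. \<tau> y (\<xi> y)))))"


section \<open>The form \<open>\<phi>\<^sub>\<tau>\<close>\<close>

text \<open>
  Elements of \<open>TM \<oplus> L\<close> are pairs \<open>(Y, \<xi>)\<close>, standing for the ambient vector \<open>f\<^sub>*Y + \<xi>\<close>.
  The second argument of \<open>\<phi>\<^sub>\<tau>\<close> is a local section \<open>(Y, \<xi>)\<close>; the value at \<open>x\<close> depends only on
  \<open>(Y x, \<xi> x)\<close>.
\<close>

definition phi ::
  "'a mfd \<Rightarrow> ('a \<Rightarrow> 'v::euclidean_space) \<Rightarrow> ('a \<Rightarrow> 'w::euclidean_space) \<Rightarrow>
   ('a \<Rightarrow> 'v set) \<Rightarrow> ('a \<Rightarrow> 'w set) \<Rightarrow> ('a \<Rightarrow> 'v \<Rightarrow> 'w) \<Rightarrow>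
   'a \<Rightarrow> 'a tvec \<Rightarrow> ('a \<Rightarrow> 'a tvec) \<Rightarrow> ('a \<Rightarrow> 'v) \<Rightarrow> 'v \<times> 'w" where
  "phi M f fh L Lh \<tau> x X Y \<xi> =
     (orth_proj (normal_space M f x \<inter> (L x)\<^sup>\<bottom>) (vderiv X (\<lambda>y. vderiv (Y y) f + \<xi> y)),
      orth_proj (normal_space M fh x \<inter> (Lh x)\<^sup>\<bottom>) (vderiv X (\<lambda>y. vderiv (Y y) fh + \<tau> y (\<xi> y))))"

definition phi_image ::
  "'a mfd \<Rightarrow> ('a \<Rightarrow> 'v::euclidean_space) \<Rightarrow> ('a \<Rightarrow> 'w::euclidean_space) \<Rightarrow>
   ('a \<Rightarrow> 'v set) \<Rightarrow> ('a \<Rightarrow> 'w set) \<Rightarrow> ('a \<Rightarrow> 'v \<Rightarrow> 'w) \<Rightarrow>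
   ('a \<Rightarrow> ('a tvec \<times> 'v) set) \<Rightarrow> 'a \<Rightarrow> ('v \<times> 'w) set" where
  "phi_image M f fh L Lh \<tau> D x =
     {phi M f fh L Lh \<tau> x X Y \<xi> | X U Y \<xi>. X \<in> tangent_space M x \<and> x \<in> U \<and>
        vector_field M U Y \<and> normal_section M L U \<xi> \<and> (Y x, \<xi> x) \<in> D x}"

definition null_subset :: "('v::euclidean_space \<times> 'w::euclidean_space) set \<Rightarrow> bool" where
  "null_subset S \<longleftrightarrow> (\<forall>\<eta>\<in>S. \<forall>\<zeta>\<in>S. fst \<eta> \<bullet> fst \<zeta> - snd \<eta> \<bullet> snd \<zeta> = 0)"

text \<open>The fibre over \<open>y\<close> is the span of \<open>d\<close> linearly independent smooth local sections of
  \<open>TM \<oplus> L\<close>, written out since \<open>'a tvec\<close> is not an instance of \<open>real_vector\<close>.\<close>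

definition subbundle_TM_plus ::
  "'a mfd \<Rightarrow> ('a \<Rightarrow> 'v::euclidean_space set) \<Rightarrow> nat \<Rightarrow> ('a \<Rightarrow> ('a tvec \<times> 'v) set) \<Rightarrow> bool" where
  "subbundle_TM_plus M L d D \<longleftrightarrow>
     (\<forall>x\<in>points M. \<exists>U Y \<xi>. x \<in> U \<and> openin (mtop M) U \<and>
        (\<forall>i<d. vector_field M U (Y i) \<and> normal_section M L U (\<xi> i)) \<and>
        (\<forall>y\<in>U.
           D y = {(\<lambda>g. \<Sum>i<d. a i * Y i y g, \<Sum>i<d. a i *\<^sub>R \<xi> i y) | a :: nat \<Rightarrow> real. True} \<and>
           (\<forall>a :: nat \<Rightarrow> real.
              (\<forall>g. (\<Sum>i<d. a i * Y i y g) = 0) \<and> (\<Sum>i<d. a i *\<^sub>R \<xi> i y) = 0 \<longrightarrow>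
              (\<forall>i<d. a i = 0))))"


section \<open>Ruled immersions\<close>

definition ruling ::
  "'a mfd \<Rightarrow> 'a metric \<Rightarrow> ('a \<Rightarrow> 'v::euclidean_space) \<Rightarrow> nat \<Rightarrow> ('a \<Rightarrow> 'a tvec set) \<Rightarrow>
   'a \<Rightarrow> 'a mfd \<Rightarrow> bool" where
  "ruling M G f d \<Delta> x S \<longleftrightarrow>
     submanifold S M \<and> mdim S = d \<and> totally_geodesic S M G \<and>
     x \<in> points S \<and> sub_tangent S M x = \<Delta> x \<and>
     (\<exists>A. affine A \<and> aff_dim A = int d \<and> openin (top_of_set A) (f ` points S))"

definition ruled ::
  "'a mfd \<Rightarrow> 'a metric \<Rightarrow> ('a \<Rightarrow> 'v::euclidean_space) \<Rightarrow> nat \<Rightarrow> ('a \<Rightarrow> 'a tvec set) \<Rightarrow> bool" where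
  "ruled M G f d \<Delta> \<longleftrightarrow> (\<forall>x\<in>points M. \<exists>S. ruling M G f d \<Delta> x S)"

definition mutually_ruled ::
  "'a mfd \<Rightarrow> 'a metric \<Rightarrow> ('a \<Rightarrow> 'v::euclidean_space) \<Rightarrow> ('a \<Rightarrow> 'w::euclidean_space) \<Rightarrow>
   nat \<Rightarrow> ('a \<Rightarrow> 'a tvec set) \<Rightarrow> bool" where
  "mutually_ruled M G f fh d \<Delta> \<longleftrightarrow> ruled M G f d \<Delta> \<and> ruled M G fh d \<Delta> \<and>
     (\<forall>x\<in>points M. \<exists>S. ruling M G f d \<Delta> x S \<and> ruling M G fh d \<Delta> x S)"

end

theory Submission
  imports Defs "HOL-Computational_Algebra.Polynomial"
begin

text \<open>
  Let \<open>(Y, \<xi>)\<close> be a local section of \<open>D\<close> and put \<open>v = f\<^sub>*Y + \<xi>\<close>, \<open>vh = fh\<^sub>*Y + \<tau>\<xi>\<close>. Because \<open>\<tau>\<close> is parallel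
  and preserves second fundamental forms, and \<open>\<phi>\<^sub>\<tau>(TM, D)\<close> is null, the cylinders
  \<open>(x, t) \<mapsto> f x + t v x\<close> and \<open>(x, t) \<mapsto> fh x + t vh x\<close> induce the same metric. Their failure to be immersions
  at \<open>(x, t)\<close> is the vanishing of minors that are polynomial in \<open>t\<close>. If these did not vanish identically,
  dividing by the lowest occurring power of \<open>t\<close> would give an open set on which the cylinders are
  immersions for small \<open>t \<noteq> 0\<close>, that is, a singular extension. So the differentials of both cylinders have a
  common kernel vector at every \<open>(x, t)\<close>.

  At \<open>t = 0\<close> this says that \<open>v\<close> is tangent, hence \<open>\<xi> = 0\<close>. For small \<open>t\<close> the rank is exactly \<open>n\<close>, and following the
  kernel back to \<open>t = 0\<close> shows that \<open>f x + v x\<close> and \<open>fh x + vh x\<close> are the images of one and the same point of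
  \<open>M\<close>, if \<open>Y\<close> is small. Letting \<open>Y\<close> run through the small combinations with constant coefficients of a frame of
  \<open>D\<close>, these points sweep out the common ruling through \<open>x\<close>. It is totally geodesic because \<open>f\<^sub>*Z\<close> stays in a
  fixed \<open>d\<close>-dimensional subspace along it when \<open>Z\<close> is tangent to it. No point of \<open>M\<close> has to be excluded, so the
  open dense set is all of \<open>M\<close>.
\<close>

section \<open>Calculus on coordinate spaces\<close>

text \<open>Both immersions are handled at once through the single map
  \<open>\<Phi> = (f, fh)\<close> into the product space. A kernel vector common to the two
  cylinders is a kernel vector of the cylinder over \<open>\<Phi>\<close>, so one map of base
  points, and hence one submanifold, serves \<open>f\<close> and \<open>fh\<close>, as mutual
  rulings demand.

  Coefficients are frozen along a frame of \<open>D\<close> because the differential of the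
  cylinder, \<open>f\<^sub>*X + t D\<^sub>Xv + r v\<close>, is then affine in \<open>t\<close> and
  linear in the coefficients. The factor \<open>t\<close> can be absorbed into them, so degeneracy
  of all frozen combinations at \<open>t = 1\<close> covers every \<open>t\<close>.

  The obstacle is to follow the kernel. Dimensions are numbers and not types, so coordinates live in
  an infinite-dimensional container, while the inverse function theorem is applied to a map of a
  Euclidean space to itself. The domain is therefore enlarged to the square of the target space, on
  which coordinates enter only through a left inverse of the differential. The inverse so obtained
  is merely differentiable; its higher derivatives are recovered from the fact that
  \<open>\<Phi>\<close> composed with the resulting map of base points is affine.\<close>

lemma bounded_linear_coord: "bounded_linear (\<lambda>x::seqs. apply_bcontfun x i)"
  by (rule bounded_linear_intro[where K=1])
     (auto simp: plus_bcontfun.rep_eq scaleR_bcontfun.rep_eq intro: norm_bounded[where 'b=real, simplified])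

lemma coord_simps [simp]:
  fixes x y :: seqs
  shows "apply_bcontfun (x + y) i = apply_bcontfun x i + apply_bcontfun y i"
    "apply_bcontfun (x - y) i = apply_bcontfun x i - apply_bcontfun y i"
    "apply_bcontfun (- x) i = - apply_bcontfun x i"
    "apply_bcontfun (r *\<^sub>R x) i = r * apply_bcontfun x i"
    "apply_bcontfun (0::seqs) i = 0"
  by (auto simp: plus_bcontfun.rep_eq minus_bcontfun.rep_eq uminus_bcontfun.rep_eq
      scaleR_bcontfun.rep_eq zero_bcontfun.rep_eq)

lemma coord_sum [simp]: "apply_bcontfun (sum (f :: 'i \<Rightarrow> seqs) A) i = (\<Sum>k\<in>A. apply_bcontfun (f k) i)"
  by (rule bounded_linear.linear[OF bounded_linear_coord, THEN linear_sum])

lemma abs_coord_le: "\<bar>apply_bcontfun (x::seqs) i\<bar> \<le> norm x"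
  using norm_bounded[of x i] by simp

definition unit_seq :: "nat \<Rightarrow> seqs" where
  "unit_seq i = Bcontfun (\<lambda>j. if j = i then 1 else 0)"

lemma coord_unit_seq [simp]: "apply_bcontfun (unit_seq i) j = (if j = i then 1 else 0)"
proof -
  have "(\<lambda>j. if j = i then 1 else (0::real)) \<in> bcontfun"
    by (rule bcontfun_normI[where b=1]) auto
  then show ?thesis
    by (simp add: unit_seq_def Bcontfun_inverse)
qed

lemma subspace_RR: "subspace (RR m)"
  by (auto simp: subspace_def RR_def)

lemma RR_add: "x \<in> RR m \<Longrightarrow> y \<in> RR m \<Longrightarrow> x + y \<in> RR m"
  and RR_diff: "x \<in> RR m \<Longrightarrow> y \<in> RR m \<Longrightarrow> x - y \<in> RR m"
  and RR_scaleR: "x \<in> RR m \<Longrightarrow> r *\<^sub>R x \<in> RR m"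
  and RR_uminus: "x \<in> RR m \<Longrightarrow> - x \<in> RR m"
  and RR_0: "0 \<in> RR m"
  and RR_unit_seq: "i < m \<Longrightarrow> unit_seq i \<in> RR m"
  by (auto simp: RR_def)

lemma RR_sum: "(\<And>i. i \<in> A \<Longrightarrow> f i \<in> RR m) \<Longrightarrow> sum f A \<in> RR m"
  by (auto simp: RR_def intro!: sum.neutral)

lemmas RR_intros = RR_add RR_diff RR_scaleR RR_uminus RR_0 RR_unit_seq RR_sum

lemma RR_mono: "k \<le> m \<Longrightarrow> RR k \<subseteq> RR m"
  by (auto simp: RR_def)

lemma RR_expand:
  assumes "x \<in> RR m"
  shows "(\<Sum>i<m. apply_bcontfun x i *\<^sub>R unit_seq i) = x"
proof (rule bcontfun_eqI)
  fix j
  have "(\<Sum>k<m. apply_bcontfun x k * (if j = k then 1 else 0)) = (if j < m then apply_bcontfun x j else 0)"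
    by (simp add: if_distrib[of "\<lambda>a. _ * a"] sum.delta' cong: if_cong)
  then show "apply_bcontfun (\<Sum>i<m. apply_bcontfun x i *\<^sub>R unit_seq i) j = apply_bcontfun x j"
    using assms by (auto simp: RR_def)
qed

lemma coord_sum_unit_seq:
  "apply_bcontfun (\<Sum>i<m. a i *\<^sub>R unit_seq i) j = (if j < m then a j else 0)"
  by (simp add: if_distrib[of "\<lambda>a. _ * a"] sum.delta' cong: if_cong)

lemma RR_eqI: "x \<in> RR m \<Longrightarrow> y \<in> RR m \<Longrightarrow> (\<And>i. i < m \<Longrightarrow> apply_bcontfun x i = apply_bcontfun y i) \<Longrightarrow> x = y"
  by (rule bcontfun_eqI) (metis (mono_tags, lifting) RR_def mem_Collect_eq not_le)

section \<open>Derivatives on relatively open subsets of \<open>RR m\<close>\<close>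

abbreviation open_RR :: "nat \<Rightarrow> seqs set \<Rightarrow> bool" where
  "open_RR m U \<equiv> openin (top_of_set (RR m)) U"

lemma open_RR_subset: "open_RR m U \<Longrightarrow> x \<in> U \<Longrightarrow> x \<in> RR m"
  using openin_imp_subset by blast

lemma open_RR_ball:
  assumes "open_RR m U" "x \<in> U"
  obtains e where "e > 0" "\<And>y. y \<in> RR m \<Longrightarrow> dist y x < e \<Longrightarrow> y \<in> U"
  using assms unfolding openin_euclidean_subtopology_iff by metis

lemma open_RR_line:
  assumes "open_RR m U" "x \<in> U" "v \<in> RR m"
  shows "\<forall>\<^sub>F t::real in nhds 0. x + t *\<^sub>R v \<in> U"
proof -
  obtain e where e: "e > 0" "\<And>y. y \<in> RR m \<Longrightarrow> dist y x < e \<Longrightarrow> y \<in> U"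
    using open_RR_ball assms by metis
  have "((\<lambda>t. x + t *\<^sub>R v) \<longlongrightarrow> x + 0 *\<^sub>R v) (nhds 0)"
    by (intro tendsto_intros) (simp add: filterlim_def)
  then have "\<forall>\<^sub>F t in nhds 0. dist (x + t *\<^sub>R v) x < e"
    using e(1) by (simp add: tendsto_iff)
  then show ?thesis
    by (rule eventually_mono) (rule e(2)[OF RR_add[OF open_RR_subset[OF assms(1,2)] RR_scaleR[OF assms(3)]]])
qed

lemma at_within_open_RR: "open_RR m U \<Longrightarrow> x \<in> U \<Longrightarrow> at x within U = at x within RR m"
  unfolding openin_open using at_within_nhd[of x _ U "RR m"] by blast

text \<open>Derivatives are taken within \<open>RR m\<close> throughout, since values off that
  subspace carry no information. On a relatively open set the filters within \<open>U\<close> and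
  within \<open>RR m\<close> coincide.\<close>

lemma has_derivative_transform_open_RR:
  assumes "(g has_derivative g') (at x within RR m)" "open_RR m U" "x \<in> U"
    and "\<And>y. y \<in> U \<Longrightarrow> g y = h y"
  shows "(h has_derivative g') (at x within RR m)"
proof -
  have "(g has_derivative g') (at x within U)"
    using assms(1) at_within_open_RR[OF assms(2,3)] by simp
  then have "(h has_derivative g') (at x within U)"
    by (rule has_derivative_transform[rotated 2]) (use assms in auto)
  then show ?thesis using at_within_open_RR[OF assms(2,3)] by simp
qed

lemma dir_deriv_eventually_cong:
  assumes "\<forall>\<^sub>F t in nhds 0. g (x + t *\<^sub>R v) = h (x + t *\<^sub>R v)"
  shows "dir_deriv v g x = dir_deriv v h x"
    and "(\<lambda>t::real. g (x + t *\<^sub>R v)) differentiable (at 0) \<longleftrightarrow> (\<lambda>t. h (x + t *\<^sub>R v)) differentiable (at 0)"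
proof -
  have "((\<lambda>t. g (x + t *\<^sub>R v)) has_derivative D) (at 0) \<longleftrightarrow> ((\<lambda>t. h (x + t *\<^sub>R v)) has_derivative D) (at 0)" for D
    using assms eventually_nhds_x_imp_x[OF assms]
    by (auto elim!: has_derivative_transform_eventually simp: eventually_at_filter
        elim!: eventually_mono)
  then show "dir_deriv v g x = dir_deriv v h x"
    "(\<lambda>t::real. g (x + t *\<^sub>R v)) differentiable (at 0) \<longleftrightarrow> (\<lambda>t. h (x + t *\<^sub>R v)) differentiable (at 0)"
    by (simp_all add: dir_deriv_def vector_derivative_def has_vector_derivative_def differentiable_def)
qed

lemma dir_deriv_cong_open:
  assumes "open_RR m U" "x \<in> U" "v \<in> RR m" "\<And>y. y \<in> U \<Longrightarrow> g y = h y"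
  shows "dir_deriv v g x = dir_deriv v h x"
    and "(\<lambda>t::real. g (x + t *\<^sub>R v)) differentiable (at 0) \<longleftrightarrow> (\<lambda>t. h (x + t *\<^sub>R v)) differentiable (at 0)"
  by (rule dir_deriv_eventually_cong, rule eventually_mono[OF open_RR_line[OF assms(1-3)]], simp add: assms(4))+

text \<open>The directions in \<open>C_k_on\<close> lie in \<open>RR m\<close>, so short segments
  from a point of \<open>U\<close> stay in \<open>U\<close> and values elsewhere never
  enter.\<close>

lemma C_k_on_cong:
  assumes "open_RR m U" "\<And>y. y \<in> U \<Longrightarrow> g y = h y"
  shows "C_k_on k m U g \<longleftrightarrow> C_k_on k m U h"
  using assms(2)
proof (induction k arbitrary: g h)
  case 0
  then show ?case by (simp cong: continuous_on_cong)
next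
  case (Suc k)
  have "dir_deriv v g y = dir_deriv v h y" if "v \<in> RR m" "y \<in> U" for v y
    using dir_deriv_cong_open(1)[OF assms(1) that(2,1)] Suc.prems by blast
  then have "C_k_on k m U (dir_deriv v g) = C_k_on k m U (dir_deriv v h)" if "v \<in> RR m" for v
    using Suc.IH that by blast
  moreover have "(\<lambda>t::real. g (x + t *\<^sub>R v)) differentiable (at 0) \<longleftrightarrow> (\<lambda>t. h (x + t *\<^sub>R v)) differentiable (at 0)"
    if "v \<in> RR m" "x \<in> U" for v x
    using dir_deriv_cong_open(2)[OF assms(1) that(2,1)] Suc.prems by blast
  ultimately show ?case
    using Suc.prems by (auto cong: continuous_on_cong)
qed

lemma C_k_on_subset: "C_k_on k m U g \<Longrightarrow> V \<subseteq> U \<Longrightarrow> C_k_on k m V g"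
  by (induction k arbitrary: g) (auto intro: continuous_on_subset)

lemma C_k_on_SucD: "C_k_on (Suc k) m U g \<Longrightarrow> C_k_on k m U g"
  by (induction k arbitrary: g) auto

lemma C_k_on_le: "C_k_on k m U g \<Longrightarrow> l \<le> k \<Longrightarrow> C_k_on l m U g"
  by (induction k) (auto simp: le_Suc_eq simp del: C_k_on.simps dest: C_k_on_SucD)

lemma C_k_on_continuous: "C_k_on k m U g \<Longrightarrow> continuous_on U g"
  by (cases k) auto

lemma dir_deriv_if_has_derivative:
  assumes "(g has_derivative g') (at x within RR m)" "x \<in> RR m" "v \<in> RR m"
  shows "dir_deriv v g x = g' v" "(\<lambda>t::real. g (x + t *\<^sub>R v)) differentiable (at 0)"
    "((\<lambda>t::real. g (x + t *\<^sub>R v)) has_vector_derivative g' v) (at 0)"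
proof -
  have "((\<lambda>t::real. x + t *\<^sub>R v) has_derivative (\<lambda>t. t *\<^sub>R v)) (at 0)"
    by (auto intro!: derivative_eq_intros)
  moreover have "(g has_derivative g') (at (x + 0 *\<^sub>R v) within (\<lambda>t::real. x + t *\<^sub>R v) ` UNIV)"
    using assms by (auto intro!: has_derivative_subset[OF assms(1)] RR_intros)
  ultimately have "((\<lambda>t::real. g (x + t *\<^sub>R v)) has_derivative (\<lambda>t. g' (t *\<^sub>R v))) (at 0)"
    using diff_chain_within[of "\<lambda>t::real. x + t *\<^sub>R v" "\<lambda>t. t *\<^sub>R v" 0 UNIV g g'] by (simp add: o_def)
  moreover have "linear g'" using assms(1) has_derivative_linear by blast
  ultimately show *: "((\<lambda>t::real. g (x + t *\<^sub>R v)) has_vector_derivative g' v) (at 0)"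
    by (simp add: has_vector_derivative_def linear_cmul)
  then show "dir_deriv v g x = g' v"
    by (simp add: dir_deriv_def vector_derivative_at)
  show "(\<lambda>t::real. g (x + t *\<^sub>R v)) differentiable (at 0)"
    using * differentiableI_vector by blast
qed

text \<open>Continuous partial derivatives give a total derivative: an increment is built up one
  coordinate at a time, and each single-coordinate move is controlled by the mean value inequality.
  This bridges the directional definition of \<open>C_k_on\<close> and the usual differentiation
  rules.\<close>

lemma C_1_on_has_derivative:
  fixes g :: "seqs \<Rightarrow> 'b::real_normed_vector"
  assumes g: "C_k_on (Suc 0) m U g" and U: "open_RR m U" and x: "x \<in> U"
  shows "(g has_derivative (\<lambda>v. \<Sum>i<m. apply_bcontfun v i *\<^sub>R dir_deriv (unit_seq i) g x)) (at x within RR m)"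
proof -
  let ?D = "\<lambda>k v. \<Sum>i<k. apply_bcontfun v i *\<^sub>R dir_deriv (unit_seq i) g x"
  have bl: "bounded_linear (?D k)" for k
    by (intro bounded_linear_sum bounded_linear_scaleR_const bounded_linear_coord)
  have xm: "x \<in> RR m" using U x open_RR_subset by blast
  have est: "\<exists>d>0. \<forall>y\<in>RR m. norm (y - x) < d \<longrightarrow>
         norm (g y - g x - ?D m (y - x)) \<le> e * norm (y - x)" if "e > 0" for e
  proof -
    \<comment> \<open>Each of the \<open>m\<close> coordinate moves may cost
      \<open>e' * norm (y - x)\<close>; the \<open>+ 1\<close> keeps the denominator positive when
      \<open>m = 0\<close>.\<close>
    define e' where "e' = e / (real m + 1)"
    have e': "e' > 0" "e' * real m \<le> e" using that
      by (auto simp: e'_def field_simps)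
    obtain d0 where d0: "d0 > 0" "\<And>y. y \<in> RR m \<Longrightarrow> dist y x < d0 \<Longrightarrow> y \<in> U"
      using open_RR_ball[OF U x] by metis
    have "\<exists>d>0. \<forall>y\<in>U. dist y x < d \<longrightarrow> dist (dir_deriv (unit_seq i) g y) (dir_deriv (unit_seq i) g x) < e'"
      if "i < m" for i
      using g x that e' RR_unit_seq[OF that] by (auto simp: continuous_on_iff)
    then obtain d1 where d1: "\<And>i. i < m \<Longrightarrow> d1 i > 0"
      "\<And>i y. i < m \<Longrightarrow> y\<in>U \<Longrightarrow> dist y x < d1 i \<Longrightarrow> dist (dir_deriv (unit_seq i) g y) (dir_deriv (unit_seq i) g x) < e'"
      by metis
    define d where "d = Min (insert d0 (d1 ` {..<m}))"
    have d: "d > 0" "d \<le> d0" "\<And>i. i < m \<Longrightarrow> d \<le> d1 i"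
      using d0 d1 by (auto simp: d_def)
    have inU: "y \<in> U" if "y \<in> RR m" "norm (y - x) < d" for y
      using d0 d that by (auto simp: dist_norm)
    \<comment> \<open>Induction on the number \<open>k\<close> of coordinates in which the increment
      may be nonzero; the error grows by \<open>e' * norm v\<close> per coordinate.\<close>
    have step: "norm (g (x + v) - g x - ?D k v) \<le> e' * (real k * norm v)"
      if "v \<in> RR k" "k \<le> m" "norm v < d" for v k
      using that
    proof (induction k arbitrary: v)
      case 0
      then have "v = 0" by (intro RR_eqI[of _ 0]) (auto simp: RR_0)
      then show ?case by simp
    next
      case (Suc k)
      define c where "c = apply_bcontfun v k"
      define w where "w = v - c *\<^sub>R unit_seq k"
      have w: "w \<in> RR k"
        using Suc.prems(1) by (auto simp: RR_def w_def c_def)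
      have wv: "apply_bcontfun w i = apply_bcontfun v i" if "i < k" for i
        using that by (simp add: w_def)
      \<comment> \<open>The norm is the supremum norm, so shrinking one coordinate cannot increase
        it; the whole segment therefore stays in the ball of radius \<open>d\<close>.\<close>
      have nw: "norm (w + t *\<^sub>R unit_seq k) \<le> norm v" if "\<bar>t\<bar> \<le> \<bar>c\<bar>" for t
      proof (rule norm_bound)
        fix j
        show "norm (apply_bcontfun (w + t *\<^sub>R unit_seq k) j) \<le> norm v"
          using that abs_coord_le[of v j] abs_coord_le[of v k] by (auto simp: w_def c_def)
      qed
      have Sm: "RR (Suc k) \<subseteq> RR m" "RR k \<subseteq> RR m" using Suc.prems by (auto intro!: RR_mono)
      have km: "k < m" using Suc.prems by simp
      have mem: "x + (w + t *\<^sub>R unit_seq k) \<in> U" "norm (w + t *\<^sub>R unit_seq k) < d" if "\<bar>t\<bar> \<le> \<bar>c\<bar>" for t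
      proof -
        show n: "norm (w + t *\<^sub>R unit_seq k) < d" using nw[OF that] Suc.prems by simp
        have "x + (w + t *\<^sub>R unit_seq k) \<in> RR m" using xm w Sm km by (intro RR_intros) auto
        then show "x + (w + t *\<^sub>R unit_seq k) \<in> U" using n by (intro inU) auto
      qed
      have IH: "norm (g (x + w) - g x - ?D k w) \<le> e' * (real k * norm w)"
        using Suc.IH[OF w] Suc.prems nw[of 0] by simp
      have Dw: "?D (Suc k) v = ?D k w + c *\<^sub>R dir_deriv (unit_seq k) g x"
        by (simp add: wv c_def)
      define h where "h t = g (x + (w + t *\<^sub>R unit_seq k))" for t
      have hd: "(h has_vector_derivative dir_deriv (unit_seq k) g (x + (w + t *\<^sub>R unit_seq k))) (at t within closed_segment 0 c)"
        if "t \<in> closed_segment 0 c" for t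
      proof -
        have t: "\<bar>t\<bar> \<le> \<bar>c\<bar>" using that by (auto simp: closed_segment_eq_real_ivl split: if_splits)
        have "((\<lambda>s. g ((x + (w + t *\<^sub>R unit_seq k)) + s *\<^sub>R unit_seq k)) has_vector_derivative
            dir_deriv (unit_seq k) g (x + (w + t *\<^sub>R unit_seq k))) (at 0)"
          using g mem[OF t] RR_unit_seq[OF km] by (auto simp: dir_deriv_def vector_derivative_works[symmetric])
        moreover have "g ((x + (w + t *\<^sub>R unit_seq k)) + s *\<^sub>R unit_seq k) = h (t + s)" for s
          by (simp add: h_def algebra_simps)
        ultimately have "((\<lambda>s. h (t + s)) has_vector_derivative
            dir_deriv (unit_seq k) g (x + (w + t *\<^sub>R unit_seq k))) (at (t - t))" by simp
        then have "(h has_vector_derivative dir_deriv (unit_seq k) g (x + (w + t *\<^sub>R unit_seq k))) (at t)"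
          unfolding has_vector_derivative_def
          using has_derivative_compose[of "\<lambda>s. s - t" "\<lambda>s. s" t UNIV "\<lambda>s. h (t + s)"]
          by (fastforce intro!: derivative_eq_intros)
        then show ?thesis using has_vector_derivative_at_within by blast
      qed
      have seg: "norm (h c - h 0 - (c - 0) *\<^sub>R dir_deriv (unit_seq k) g x) \<le> norm (c - 0) * e'"
      proof -
        have s: "closed_segment 0 c \<subseteq> {t. \<bar>t\<bar> \<le> \<bar>c\<bar>}"
          by (auto simp: closed_segment_eq_real_ivl split: if_splits)
        \<comment> \<open>Subtracting the linear part leaves a function whose derivative is the
          oscillation of the partial derivative, which is below \<open>e'\<close>.\<close>
        define h2 where "h2 t = h t - t *\<^sub>R dir_deriv (unit_seq k) g x" for t
        have "norm (h2 c - h2 0) \<le> e' * norm (c - 0)"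
        proof (rule differentiable_bound[of "closed_segment 0 c"])
          show "convex (closed_segment 0 c)" by (rule convex_closed_segment)
          fix t assume t: "t \<in> closed_segment 0 c"
          show "(h2 has_derivative (\<lambda>s. s *\<^sub>R (dir_deriv (unit_seq k) g (x + (w + t *\<^sub>R unit_seq k)) - dir_deriv (unit_seq k) g x)))
              (at t within closed_segment 0 c)"
            unfolding h2_def using hd[OF t, unfolded has_vector_derivative_def]
            by (auto intro!: derivative_eq_intros simp: algebra_simps)
          have "norm (dir_deriv (unit_seq k) g (x + (w + t *\<^sub>R unit_seq k)) - dir_deriv (unit_seq k) g x) < e'"
            using d1(2)[OF km mem(1)] mem(2) d(3)[OF km] t s by (fastforce simp: dist_norm)
          then show "onorm (\<lambda>s. s *\<^sub>R (dir_deriv (unit_seq k) g (x + (w + t *\<^sub>R unit_seq k)) - dir_deriv (unit_seq k) g x)) \<le> e'"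
            by (intro onorm_le) (simp add: mult.commute[of e'] mult_left_mono)
        qed auto
        then show ?thesis by (simp add: h2_def algebra_simps)
      qed
      have hc: "h c = g (x + v)" "h 0 = g (x + w)" by (simp_all add: h_def w_def)
      have "g (x + v) - g x - ?D (Suc k) v =
            (h c - h 0 - (c - 0) *\<^sub>R dir_deriv (unit_seq k) g x) + (g (x + w) - g x - ?D k w)"
        by (simp only: Dw hc) simp
      then have "norm (g (x + v) - g x - ?D (Suc k) v) \<le> norm (c - 0) * e' + e' * (real k * norm w)"
        using norm_triangle_mono[OF seg IH] by (simp only:)
      also have "\<dots> \<le> norm v * e' + e' * (real k * norm v)"
      proof (rule add_mono)
        show "norm (c - 0) * e' \<le> norm v * e'"
          using abs_coord_le[of v k] e' by (intro mult_right_mono) (auto simp: c_def)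
        show "e' * (real k * norm w) \<le> e' * (real k * norm v)"
          using nw[of 0] e' by (intro mult_left_mono) auto
      qed
      finally show ?case by (simp add: algebra_simps)
    qed
    have "norm (g y - g x - ?D m (y - x)) \<le> e * norm (y - x)" if "y \<in> RR m" "norm (y - x) < d" for y
    proof -
      have "norm (g (x + (y - x)) - g x - ?D m (y - x)) \<le> e' * (real m * norm (y - x))"
        using that xm by (intro step) (auto intro: RR_intros)
      also have "\<dots> \<le> e * norm (y - x)"
        using e'(2) mult_right_mono[of "e' * real m" e "norm (y - x)"] by (simp add: algebra_simps)
      finally show ?thesis by simp
    qed
    then show ?thesis using d(1) by blast
  qed
  show ?thesis
    unfolding has_derivative_within_alt using bl est by blast
qed

lemma C_k_on_has_derivative:
  assumes "C_k_on (Suc k) m U g" "open_RR m U" "x \<in> U"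
  shows "(g has_derivative (\<lambda>v. \<Sum>i<m. apply_bcontfun v i *\<^sub>R dir_deriv (unit_seq i) g x)) (at x within RR m)"
  by (rule C_1_on_has_derivative[OF C_k_on_le[OF assms(1)] assms(2,3)]) simp

text \<open>Trades the directional clause of \<open>C_k_on\<close> for a Frechet derivative, the
  form in which sum, product and chain rules apply. Regularity of composite expressions then becomes
  an induction on \<open>k\<close>.\<close>

lemma C_k_on_SucI:
  assumes U: "open_RR m U" and d: "\<And>x. x \<in> U \<Longrightarrow> (g has_derivative g' x) (at x within RR m)"
    and C: "\<And>v. v \<in> RR m \<Longrightarrow> C_k_on k m U (\<lambda>x. g' x v)"
  shows "C_k_on (Suc k) m U g"
proof -
  have "continuous_on U g"
    using d has_derivative_continuous at_within_open_RR[OF U] unfolding continuous_on_eq_continuous_within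
    by metis
  moreover have "dir_deriv v g x = g' x v" if "v \<in> RR m" "x \<in> U" for v x
    using dir_deriv_if_has_derivative[OF d] that open_RR_subset[OF U] by blast
  then have "C_k_on k m U (dir_deriv v g)" if "v \<in> RR m" for v
    using C_k_on_cong[OF U] C that by metis
  moreover have "(\<lambda>t::real. g (x + t *\<^sub>R v)) differentiable (at 0)" if "v \<in> RR m" "x \<in> U" for v x
    using dir_deriv_if_has_derivative[OF d] that open_RR_subset[OF U] by blast
  ultimately show ?thesis by simp
qed

text \<open>Being a finite sum of coordinate functionals, this is bounded linear for every
  \<open>g\<close> and \<open>x\<close>, differentiable or not, which keeps linearity free of side
  conditions.\<close>

definition deriv_at :: "nat \<Rightarrow> (seqs \<Rightarrow> 'b::real_normed_vector) \<Rightarrow> seqs \<Rightarrow> seqs \<Rightarrow> 'b" where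
  "deriv_at m g x v = (\<Sum>i<m. apply_bcontfun v i *\<^sub>R dir_deriv (unit_seq i) g x)"

lemma bounded_linear_deriv_at: "bounded_linear (deriv_at m g x)"
  unfolding deriv_at_def[abs_def]
  by (intro bounded_linear_sum bounded_linear_scaleR_const bounded_linear_coord)

lemma has_derivative_deriv_at:
  assumes "C_k_on (Suc k) m U g" "open_RR m U" "x \<in> U"
  shows "(g has_derivative deriv_at m g x) (at x within RR m)"
  using C_k_on_has_derivative[OF assms] by (simp add: deriv_at_def[abs_def])

lemma dir_deriv_eq_deriv_at:
  assumes "C_k_on (Suc k) m U g" "open_RR m U" "x \<in> U" "v \<in> RR m"
  shows "dir_deriv v g x = deriv_at m g x v"
  using dir_deriv_if_has_derivative(1)[OF has_derivative_deriv_at[OF assms(1-3)]] open_RR_subset assms by blast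

lemma deriv_at_eq:
  assumes "(g has_derivative g') (at x within RR m)" "x \<in> RR m" "v \<in> RR m"
  shows "deriv_at m g x v = g' v"
proof -
  interpret bounded_linear g' using assms(1) has_derivative_bounded_linear by blast
  have "deriv_at m g x v = (\<Sum>i<m. apply_bcontfun v i *\<^sub>R g' (unit_seq i))"
    unfolding deriv_at_def
    by (intro sum.cong refl) (use dir_deriv_if_has_derivative(1)[OF assms(1,2)] RR_unit_seq in auto)
  also have "\<dots> = g' (\<Sum>i<m. apply_bcontfun v i *\<^sub>R unit_seq i)"
    by (simp add: sum scaleR)
  finally show ?thesis using RR_expand[OF assms(3)] by simp
qed

lemma C_k_on_dir_deriv: "C_k_on (Suc k) m U g \<Longrightarrow> v \<in> RR m \<Longrightarrow> C_k_on k m U (dir_deriv v g)"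
  by simp

declare C_k_on.simps(2) [simp del]

section \<open>Closure properties of \<open>C_k_on\<close>\<close>

lemma C_k_on_bounded_linear:
  assumes U: "open_RR m U" and "bounded_linear T" "C_k_on k m U g"
  shows "C_k_on k m U (\<lambda>x. T (g x))"
  using assms(3)
proof (induction k arbitrary: g)
  case 0
  then show ?case using assms(2) by (simp add: bounded_linear.continuous_on)
next
  case (Suc k)
  show ?case
  proof (rule C_k_on_SucI[OF U])
    fix x assume "x \<in> U"
    then show "((\<lambda>x. T (g x)) has_derivative (\<lambda>v. T (deriv_at m g x v))) (at x within RR m)"
      using bounded_linear.has_derivative[OF assms(2) has_derivative_deriv_at[OF Suc.prems U]] by blast
  next
    fix v assume "v \<in> RR m"
    then have "C_k_on k m U (dir_deriv v g)" using Suc.prems C_k_on_dir_deriv by blast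
    then have "C_k_on k m U (\<lambda>x. T (dir_deriv v g x))" using Suc.IH by blast
    then show "C_k_on k m U (\<lambda>x. T (deriv_at m g x v))"
      by (rule C_k_on_cong[OF U, THEN iffD1, rotated])
         (simp add: dir_deriv_eq_deriv_at[OF Suc.prems U _ \<open>v \<in> RR m\<close>])
  qed
qed

lemma C_k_on_const: "open_RR m U \<Longrightarrow> C_k_on k m U (\<lambda>x. c)"
proof (induction k arbitrary: c)
  case (Suc k)
  show ?case
    by (rule C_k_on_SucI[OF Suc.prems, where g'="\<lambda>_ _. 0"]) (auto intro: Suc.IH[OF Suc.prems])
qed simp

lemma C_k_on_add:
  assumes U: "open_RR m U" and "C_k_on k m U g" "C_k_on k m U h"
  shows "C_k_on k m U (\<lambda>x. g x + h x)"
  using assms(2,3)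
proof (induction k arbitrary: g h)
  case 0
  then show ?case by (auto intro: continuous_intros)
next
  case (Suc k)
  show ?case
  proof (rule C_k_on_SucI[OF U])
    fix x assume "x \<in> U"
    then show "((\<lambda>x. g x + h x) has_derivative (\<lambda>v. deriv_at m g x v + deriv_at m h x v)) (at x within RR m)"
      by (intro has_derivative_add has_derivative_deriv_at[OF Suc.prems(1) U] has_derivative_deriv_at[OF Suc.prems(2) U])
  next
    fix v assume v: "v \<in> RR m"
    then have "C_k_on k m U (\<lambda>x. dir_deriv v g x + dir_deriv v h x)"
      using Suc.prems by (intro Suc.IH C_k_on_dir_deriv)
    then show "C_k_on k m U (\<lambda>x. deriv_at m g x v + deriv_at m h x v)"
      by (rule C_k_on_cong[OF U, THEN iffD1, rotated])
         (simp add: dir_deriv_eq_deriv_at[OF Suc.prems(1) U _ v] dir_deriv_eq_deriv_at[OF Suc.prems(2) U _ v])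
  qed
qed

lemma C_k_on_bilinear:
  assumes U: "open_RR m U" and B: "bounded_bilinear B" and "C_k_on k m U g" "C_k_on k m U h"
  shows "C_k_on k m U (\<lambda>x. B (g x) (h x))"
  using assms(3,4)
proof (induction k arbitrary: g h)
  case 0
  then show ?case by (simp add: bounded_bilinear.continuous_on[OF B])
next
  case (Suc k)
  show ?case
  proof (rule C_k_on_SucI[OF U])
    fix x assume "x \<in> U"
    then show "((\<lambda>x. B (g x) (h x)) has_derivative
        (\<lambda>v. B (g x) (deriv_at m h x v) + B (deriv_at m g x v) (h x))) (at x within RR m)"
      by (intro bounded_bilinear.FDERIV[OF B] has_derivative_deriv_at[OF Suc.prems(1) U] has_derivative_deriv_at[OF Suc.prems(2) U])
  next
    fix v assume v: "v \<in> RR m"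
    then have "C_k_on k m U (\<lambda>x. B (g x) (dir_deriv v h x) + B (dir_deriv v g x) (h x))"
      using Suc.prems by (intro C_k_on_add[OF U] Suc.IH) (auto intro: C_k_on_dir_deriv C_k_on_SucD)
    then show "C_k_on k m U (\<lambda>x. B (g x) (deriv_at m h x v) + B (deriv_at m g x v) (h x))"
      by (rule C_k_on_cong[OF U, THEN iffD1, rotated])
         (simp add: dir_deriv_eq_deriv_at[OF Suc.prems(1) U _ v] dir_deriv_eq_deriv_at[OF Suc.prems(2) U _ v])
  qed
qed

lemma C_k_on_sum:
  assumes "open_RR m U" "\<And>i. i \<in> A \<Longrightarrow> C_k_on k m U (g i)"
  shows "C_k_on k m U (\<lambda>x. \<Sum>i\<in>A. g i x)"
  using assms(2)
proof (induction A rule: infinite_finite_induct)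
  case (insert a A)
  then show ?case by (simp add: C_k_on_add[OF assms(1)])
qed (auto intro: C_k_on_const[OF assms(1)])

lemma C_k_on_affine:
  assumes U: "open_RR m U" and "bounded_linear T"
  shows "C_k_on k m U (\<lambda>x. a + T x)"
proof (cases k)
  case 0
  then show ?thesis using assms(2) by (simp add: continuous_on_add linear_continuous_on)
next
  case (Suc j)
  have "C_k_on (Suc j) m U (\<lambda>x. a + T x)"
    by (rule C_k_on_SucI[OF U, where g'="\<lambda>_. T"])
       (use C_k_on_const[OF U] bounded_linear_imp_has_derivative[OF assms(2)] in \<open>auto intro!: derivative_eq_intros\<close>)
  then show ?thesis using Suc by simp
qed

lemma C_k_on_linear: "open_RR m U \<Longrightarrow> bounded_linear T \<Longrightarrow> C_k_on k m U T"
  using C_k_on_affine[of m U T k 0] by simp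

lemma has_derivative_RR_compose:
  assumes "(h has_derivative h') (at x within RR m)" "(g has_derivative g') (at (h x) within RR m')"
    and "open_RR m U" "x \<in> U" "h ` U \<subseteq> RR m'"
  shows "((\<lambda>x. g (h x)) has_derivative (\<lambda>v. g' (h' v))) (at x within RR m)"
proof -
  have "(h has_derivative h') (at x within U)"
    using assms(1) at_within_open_RR[OF assms(3,4)] by simp
  moreover have "(g has_derivative g') (at (h x) within h ` U)"
    using assms(2,5) has_derivative_subset by blast
  ultimately show ?thesis
    using diff_chain_within at_within_open_RR[OF assms(3,4)] by (fastforce simp: o_def)
qed

text \<open>The coordinates of \<open>h\<close> from \<open>m'\<close> on vanish identically on
  \<open>U\<close>, hence so do their derivatives in directions of \<open>RR m\<close>.\<close>

lemma has_derivative_in_RR: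
  assumes "(h has_derivative h') (at x within RR m)" "open_RR m U" "x \<in> U" "h ` U \<subseteq> RR m'" "v \<in> RR m"
  shows "h' v \<in> RR m'"
  unfolding RR_def mem_Collect_eq
proof (intro allI impI)
  fix i assume i: "m' \<le> i"
  have "((\<lambda>x. apply_bcontfun (h x) i) has_derivative (\<lambda>v. apply_bcontfun (h' v) i)) (at x within RR m)"
    by (rule bounded_linear.has_derivative[OF bounded_linear_coord assms(1)])
  moreover have "((\<lambda>x. apply_bcontfun (h x) i) has_derivative (\<lambda>v. 0)) (at x within RR m)"
    by (rule has_derivative_transform_open_RR[OF _ assms(2,3), of "\<lambda>x. 0"])
       (use assms(4) i in \<open>auto simp: RR_def\<close>)
  ultimately show "apply_bcontfun (h' v) i = 0"
    using deriv_at_eq assms open_RR_subset by (metis (no_types, lifting))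
qed

text \<open>Written in coordinates, the chain rule expresses the derivative through the maps
  \<open>dir_deriv (unit_seq i) g\<close> composed with \<open>h\<close>. These have one derivative
  less, so the induction is over \<open>k\<close> with \<open>g\<close> arbitrary and
  \<open>h\<close> fixed.\<close>

lemma C_k_on_compose:
  assumes U: "open_RR m U" and U': "open_RR m' U'" and "h ` U \<subseteq> U'"
    and "C_k_on k m U h" "C_k_on k m' U' g"
  shows "C_k_on k m U (\<lambda>x. g (h x))"
  using assms(4,5)
proof (induction k arbitrary: g)
  case 0
  then show ?case using assms(3) by (auto intro: continuous_on_compose2)
next
  case (Suc k)
  have hU: "h ` U \<subseteq> RR m'" using assms(3) U' openin_imp_subset by blast
  show ?case
  proof (rule C_k_on_SucI[OF U])
    fix x assume "x \<in> U"
    then show "((\<lambda>x. g (h x)) has_derivative (\<lambda>v. deriv_at m' g (h x) (deriv_at m h x v))) (at x within RR m)"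
      using assms(3)
      by (intro has_derivative_RR_compose[OF has_derivative_deriv_at[OF Suc.prems(1) U]
          has_derivative_deriv_at[OF Suc.prems(2) U'] U _ hU]) auto
  next
    fix v assume v: "v \<in> RR m"
    have dg: "C_k_on k m U (\<lambda>x. dir_deriv (unit_seq i) g (h x))" if "i < m'" for i
      by (rule Suc.IH[OF C_k_on_SucD[OF Suc.prems(1)] C_k_on_dir_deriv[OF Suc.prems(2) RR_unit_seq[OF that]]])
    have "C_k_on k m U (\<lambda>x. apply_bcontfun (dir_deriv v h x) i)" for i
      by (rule C_k_on_bounded_linear[OF U bounded_linear_coord C_k_on_dir_deriv[OF Suc.prems(1) v]])
    then have "C_k_on k m U (\<lambda>x. \<Sum>i<m'. apply_bcontfun (dir_deriv v h x) i *\<^sub>R dir_deriv (unit_seq i) g (h x))"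
      using dg by (intro C_k_on_sum[OF U] C_k_on_bilinear[OF U bounded_bilinear_scaleR]) auto
    then show "C_k_on k m U (\<lambda>x. deriv_at m' g (h x) (deriv_at m h x v))"
      by (rule C_k_on_cong[OF U, THEN iffD1, rotated])
         (simp add: dir_deriv_eq_deriv_at[OF Suc.prems(1) U _ v] deriv_at_def[of m' g])
  qed
qed

subsection \<open>Smooth maps\<close>

lemma smooth_on_C_k: "smooth_on m U g \<Longrightarrow> C_k_on k m U g"
  by (simp add: smooth_on_def)

lemma smooth_on_cong:
  "open_RR m U \<Longrightarrow> (\<And>y. y \<in> U \<Longrightarrow> g y = h y) \<Longrightarrow> smooth_on m U g \<longleftrightarrow> smooth_on m U h"
  unfolding smooth_on_def by (metis C_k_on_cong)

lemma smooth_on_subset: "smooth_on m U g \<Longrightarrow> V \<subseteq> U \<Longrightarrow> smooth_on m V g"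
  unfolding smooth_on_def by (metis C_k_on_subset)

lemma smooth_on_continuous: "smooth_on m U g \<Longrightarrow> continuous_on U g"
  by (rule C_k_on_continuous[OF smooth_on_C_k[where k=0]])

lemma smooth_on_dir_deriv: "smooth_on m U g \<Longrightarrow> v \<in> RR m \<Longrightarrow> smooth_on m U (dir_deriv v g)"
  by (simp add: smooth_on_def C_k_on_dir_deriv)

lemma smooth_on_has_derivative:
  "smooth_on m U g \<Longrightarrow> open_RR m U \<Longrightarrow> x \<in> U \<Longrightarrow> (g has_derivative deriv_at m g x) (at x within RR m)"
  by (rule has_derivative_deriv_at[OF smooth_on_C_k[where k="Suc 0"]])

lemma smooth_on_dir_deriv_eq:
  "smooth_on m U g \<Longrightarrow> open_RR m U \<Longrightarrow> x \<in> U \<Longrightarrow> v \<in> RR m \<Longrightarrow> dir_deriv v g x = deriv_at m g x v"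
  by (rule dir_deriv_eq_deriv_at[OF smooth_on_C_k[where k="Suc 0"]])

lemma smooth_on_const: "open_RR m U \<Longrightarrow> smooth_on m U (\<lambda>x. c)"
  by (simp add: smooth_on_def C_k_on_const)

lemma smooth_on_add: "open_RR m U \<Longrightarrow> smooth_on m U g \<Longrightarrow> smooth_on m U h \<Longrightarrow> smooth_on m U (\<lambda>x. g x + h x)"
  by (simp add: smooth_on_def C_k_on_add)

lemma smooth_on_bilinear:
  "open_RR m U \<Longrightarrow> bounded_bilinear B \<Longrightarrow> smooth_on m U g \<Longrightarrow> smooth_on m U h \<Longrightarrow> smooth_on m U (\<lambda>x. B (g x) (h x))"
  by (simp add: smooth_on_def C_k_on_bilinear)

lemma smooth_on_sum: "open_RR m U \<Longrightarrow> (\<And>i. i \<in> A \<Longrightarrow> smooth_on m U (g i)) \<Longrightarrow> smooth_on m U (\<lambda>x. \<Sum>i\<in>A. g i x)"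
  by (simp add: smooth_on_def C_k_on_sum)

lemma smooth_on_bounded_linear: "open_RR m U \<Longrightarrow> bounded_linear T \<Longrightarrow> smooth_on m U g \<Longrightarrow> smooth_on m U (\<lambda>x. T (g x))"
  by (simp add: smooth_on_def C_k_on_bounded_linear)

lemma smooth_on_affine: "open_RR m U \<Longrightarrow> bounded_linear T \<Longrightarrow> smooth_on m U (\<lambda>x. a + T x)"
  by (simp add: smooth_on_def C_k_on_affine)

lemma smooth_on_linear: "open_RR m U \<Longrightarrow> bounded_linear T \<Longrightarrow> smooth_on m U T"
  by (simp add: smooth_on_def C_k_on_linear)

lemma smooth_on_compose:
  "open_RR m U \<Longrightarrow> open_RR m' U' \<Longrightarrow> h ` U \<subseteq> U' \<Longrightarrow> smooth_on m U h \<Longrightarrow> smooth_on m' U' g \<Longrightarrow>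
   smooth_on m U (\<lambda>x. g (h x))"
  unfolding smooth_on_def by (metis C_k_on_compose)

lemma smooth_on_minus: "open_RR m U \<Longrightarrow> smooth_on m U g \<Longrightarrow> smooth_on m U (\<lambda>x. - g x)"
  using smooth_on_bounded_linear[of m U "\<lambda>x. - x" g] bounded_linear_minus[OF bounded_linear_ident] by simp

lemma smooth_on_diff: "open_RR m U \<Longrightarrow> smooth_on m U g \<Longrightarrow> smooth_on m U h \<Longrightarrow> smooth_on m U (\<lambda>x. g x - h x)"
  using smooth_on_add[of m U g "\<lambda>x. - h x"] smooth_on_minus[of m U h] by simp

lemma smooth_on_deriv_at:
  assumes "open_RR m U" "smooth_on m U g" "smooth_on m U y"
  shows "smooth_on m U (\<lambda>x. deriv_at m g x (y x))"
  unfolding deriv_at_def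
  by (intro smooth_on_sum[OF assms(1)] smooth_on_bilinear[OF assms(1) bounded_bilinear_scaleR]
      smooth_on_bounded_linear[OF assms(1) bounded_linear_coord assms(3)])
     (auto intro: smooth_on_dir_deriv[OF assms(2)] RR_unit_seq)

lemma deriv_at_bounded_linear:
  assumes "smooth_on m U g" "open_RR m U" "x \<in> U" "v \<in> RR m" "bounded_linear T"
  shows "deriv_at m (\<lambda>x. T (g x)) x v = T (deriv_at m g x v)"
  using deriv_at_eq[OF bounded_linear.has_derivative[OF assms(5) smooth_on_has_derivative[OF assms(1-3)]]]
    open_RR_subset assms by blast

lemma deriv_at_in_RR:
  assumes "smooth_on m U h" "open_RR m U" "x \<in> U" "h ` U \<subseteq> RR m'" "v \<in> RR m"
  shows "deriv_at m h x v \<in> RR m'"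
  using has_derivative_in_RR[OF smooth_on_has_derivative[OF assms(1-3)] assms(2-5)] .

lemma deriv_at_compose:
  assumes "open_RR m U" "open_RR m' U'" "h ` U \<subseteq> U'" "smooth_on m U h" "smooth_on m' U' g" "x \<in> U" "v \<in> RR m"
  shows "deriv_at m (\<lambda>x. g (h x)) x v = deriv_at m' g (h x) (deriv_at m h x v)"
proof -
  have "h ` U \<subseteq> RR m'" using assms(2,3) openin_imp_subset by blast
  then have "((\<lambda>x. g (h x)) has_derivative (\<lambda>v. deriv_at m' g (h x) (deriv_at m h x v))) (at x within RR m)"
    using assms
    by (intro has_derivative_RR_compose[OF smooth_on_has_derivative[OF assms(4,1,6)]
          smooth_on_has_derivative[OF assms(5,2)] assms(1,6)]) auto
  then show ?thesis
    using deriv_at_eq open_RR_subset[OF assms(1,6)] assms(7) by blast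
qed

lemma deriv_at_cong_open:
  assumes "open_RR m U" "x \<in> U" "\<And>y. y \<in> U \<Longrightarrow> g y = h y"
  shows "deriv_at m g x v = deriv_at m h x v"
  unfolding deriv_at_def
  by (intro sum.cong refl arg_cong2[of _ _ _ _ scaleR] dir_deriv_cong_open(1)[OF assms(1,2)] RR_unit_seq assms(3)) auto

section \<open>Symmetry of second derivatives\<close>

lemma real_mvt_line:
  fixes p :: "real \<Rightarrow> real"
  assumes "s > 0" "\<And>t. 0 \<le> t \<Longrightarrow> t \<le> s \<Longrightarrow> (p has_vector_derivative p' t) (at t)"
  obtains \<xi> where "0 < \<xi>" "\<xi> < s" "p s - p 0 = s * p' \<xi>"
proof -
  have "\<exists>z. z > 0 \<and> z < s \<and> p s - p 0 = (s - 0) * p' z"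
    using assms by (intro MVT2) (auto simp: has_real_derivative_iff_has_vector_derivative)
  then show ?thesis using that by auto
qed

lemma has_vector_derivative_line:
  assumes "smooth_on m U g" "open_RR m U" "y + t *\<^sub>R v \<in> U" "v \<in> RR m"
  shows "((\<lambda>t. g (y + t *\<^sub>R v)) has_vector_derivative dir_deriv v g (y + t *\<^sub>R v)) (at t)"
proof -
  have "((\<lambda>s. g ((y + t *\<^sub>R v) + s *\<^sub>R v)) has_vector_derivative dir_deriv v g (y + t *\<^sub>R v)) (at 0)"
    using dir_deriv_if_has_derivative(3)[OF smooth_on_has_derivative[OF assms(1-3)] open_RR_subset[OF assms(2,3)] assms(4)]
      smooth_on_dir_deriv_eq[OF assms] by simp
  then have *: "((\<lambda>s. g ((y + t *\<^sub>R v) + s *\<^sub>R v)) has_derivative (\<lambda>x. x *\<^sub>R dir_deriv v g (y + t *\<^sub>R v))) (at (t - t))"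
    by (simp add: has_vector_derivative_def)
  have "((\<lambda>s::real. s - t) has_derivative (\<lambda>s. s)) (at t)"
    by (auto intro!: derivative_eq_intros)
  from has_derivative_compose[where g="\<lambda>s. g ((y + t *\<^sub>R v) + s *\<^sub>R v)", OF this *]
  show ?thesis by (simp add: has_vector_derivative_def algebra_simps)
qed

text \<open>Two applications of the mean value theorem, first along \<open>u\<close> and then along
  \<open>v\<close>. The left side is symmetric in \<open>u\<close> and \<open>v\<close> while the
  right side records an order of differentiation; the symmetry of second derivatives rests on this
  contrast.\<close>

lemma second_difference:
  fixes g :: "seqs \<Rightarrow> real"
  assumes g: "smooth_on m U g" and U: "open_RR m U" and uv: "u \<in> RR m" "v \<in> RR m" and s: "s > 0"
    and inU: "\<And>a b. 0 \<le> a \<Longrightarrow> a \<le> s \<Longrightarrow> 0 \<le> b \<Longrightarrow> b \<le> s \<Longrightarrow> x + a *\<^sub>R u + b *\<^sub>R v \<in> U"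
  obtains a b where "0 < a" "a < s" "0 < b" "b < s"
    "g (x + s *\<^sub>R u + s *\<^sub>R v) - g (x + s *\<^sub>R u) - g (x + s *\<^sub>R v) + g x
       = s\<^sup>2 * dir_deriv v (dir_deriv u g) (x + a *\<^sub>R u + b *\<^sub>R v)"
proof -
  define p where "p t = g ((x + s *\<^sub>R v) + t *\<^sub>R u) - g (x + t *\<^sub>R u)" for t
  define p' where "p' t = dir_deriv u g ((x + s *\<^sub>R v) + t *\<^sub>R u) - dir_deriv u g (x + t *\<^sub>R u)" for t
  have "(p has_vector_derivative p' t) (at t)" if "0 \<le> t" "t \<le> s" for t
    unfolding p_def p'_def using inU[OF that, of s] inU[OF that, of 0] s
    by (intro has_vector_derivative_diff has_vector_derivative_line[OF g U _ uv(1)]) (auto simp: add_ac)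
  with s obtain a where a: "0 < a" "a < s" "p s - p 0 = s * p' a"
    using real_mvt_line by blast
  define q where "q t = dir_deriv u g ((x + a *\<^sub>R u) + t *\<^sub>R v)" for t
  define q' where "q' t = dir_deriv v (dir_deriv u g) ((x + a *\<^sub>R u) + t *\<^sub>R v)" for t
  have "(q has_vector_derivative q' t) (at t)" if "0 \<le> t" "t \<le> s" for t
    unfolding q_def q'_def using inU[OF _ _ that, of a] a
    by (intro has_vector_derivative_line[OF smooth_on_dir_deriv[OF g uv(1)] U _ uv(2)]) auto
  with s obtain b where b: "0 < b" "b < s" "q s - q 0 = s * q' b"
    using real_mvt_line by blast
  have "p' a = q s - q 0" by (simp add: p'_def q_def add_ac)
  then have "p s - p 0 = s\<^sup>2 * q' b" using a(3) b(3) by (simp add: power2_eq_square)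
  then show ?thesis
    using that[OF a(1,2) b(1,2)] by (simp add: p_def q'_def add_ac)
qed

lemma dir_deriv_commute_real:
  fixes g :: "seqs \<Rightarrow> real"
  assumes g: "smooth_on m U g" and U: "open_RR m U" and x: "x \<in> U" and uv: "u \<in> RR m" "v \<in> RR m"
  shows "dir_deriv u (dir_deriv v g) x = dir_deriv v (dir_deriv u g) x"
proof (rule ccontr)
  let ?P = "dir_deriv u (dir_deriv v g)" and ?Q = "dir_deriv v (dir_deriv u g)"
  assume "?P x \<noteq> ?Q x"
  define e where "e = dist (?P x) (?Q x) / 2"
  have e: "e > 0" using \<open>?P x \<noteq> ?Q x\<close> by (simp add: e_def)
  have "continuous_on U ?P" "continuous_on U ?Q"
    by (rule smooth_on_continuous[OF smooth_on_dir_deriv[OF smooth_on_dir_deriv[OF g]]]; rule uv)+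
  then obtain d1 d2 where d12: "d1 > 0" "d2 > 0"
    "\<And>y. y \<in> U \<Longrightarrow> dist y x < d1 \<Longrightarrow> dist (?P y) (?P x) < e"
    "\<And>y. y \<in> U \<Longrightarrow> dist y x < d2 \<Longrightarrow> dist (?Q y) (?Q x) < e"
    using e x unfolding continuous_on_iff by metis
  obtain d3 where d3: "d3 > 0" "\<And>y. y \<in> RR m \<Longrightarrow> dist y x < d3 \<Longrightarrow> y \<in> U"
    using open_RR_ball[OF U x] by metis
  define d where "d = min d1 (min d2 d3)"
  have d: "d > 0" "d \<le> d1" "d \<le> d2" "d \<le> d3" using d12 d3 by (auto simp: d_def)
  \<comment> \<open>Small enough for the parallelogram with sides \<open>s *\<^sub>R u\<close> and
    \<open>s *\<^sub>R v\<close> to lie within distance \<open>d / 2\<close> of \<open>x\<close>;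
    the \<open>+ 1\<close> covers the case \<open>u = v = 0\<close>.\<close>
  define s where "s = d / (2 * (norm u + norm v + 1))"
  have N: "norm u + norm v + 1 > 0" by (smt (verit) norm_ge_zero)
  have s: "s > 0" using d N by (simp add: s_def)
  have near: "dist (x + a *\<^sub>R u + b *\<^sub>R v) x < d" if "0 \<le> a" "a \<le> s" "0 \<le> b" "b \<le> s" for a b
  proof -
    have "norm (a *\<^sub>R u + b *\<^sub>R v) \<le> s * norm u + s * norm v"
      using that by (intro norm_triangle_mono) (auto intro: mult_right_mono)
    also have "\<dots> \<le> s * (norm u + norm v + 1)" using s by (simp add: algebra_simps)
    also have "\<dots> = d / 2" using N unfolding s_def by (simp add: divide_simps)
    also have "\<dots> < d" using d by simp
    finally show ?thesis by (simp add: dist_norm add.assoc)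
  qed
  have inU: "x + a *\<^sub>R u + b *\<^sub>R v \<in> U" if "0 \<le> a" "a \<le> s" "0 \<le> b" "b \<le> s" for a b
    using near[OF that] d open_RR_subset[OF U x] uv by (intro d3(2)) (auto intro: RR_add RR_scaleR)
  have inU': "x + b *\<^sub>R v + a *\<^sub>R u \<in> U" "dist (x + b *\<^sub>R v + a *\<^sub>R u) x < d"
    if "0 \<le> a" "a \<le> s" "0 \<le> b" "b \<le> s" for a b
    using inU[OF that] near[OF that] by (simp_all add: add_ac)
  obtain a b where ab: "0 < a" "a < s" "0 < b" "b < s"
    "g (x + s *\<^sub>R u + s *\<^sub>R v) - g (x + s *\<^sub>R u) - g (x + s *\<^sub>R v) + g x = s\<^sup>2 * ?Q (x + a *\<^sub>R u + b *\<^sub>R v)"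
    using second_difference[OF g U uv s inU] by blast
  obtain a' b' where ab': "0 < a'" "a' < s" "0 < b'" "b' < s"
    "g (x + s *\<^sub>R v + s *\<^sub>R u) - g (x + s *\<^sub>R v) - g (x + s *\<^sub>R u) + g x = s\<^sup>2 * ?P (x + a' *\<^sub>R v + b' *\<^sub>R u)"
    using second_difference[OF g U uv(2,1) s inU'(1)] by blast
  \<comment> \<open>The same second difference, read in the two orders, evaluates both mixed
    derivatives at points near \<open>x\<close>.\<close>
  have "g (x + s *\<^sub>R u + s *\<^sub>R v) = g (x + s *\<^sub>R v + s *\<^sub>R u)" by (simp add: add_ac)
  then have "s\<^sup>2 * ?Q (x + a *\<^sub>R u + b *\<^sub>R v) = s\<^sup>2 * ?P (x + a' *\<^sub>R v + b' *\<^sub>R u)"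
    using ab(5) ab'(5) by linarith
  then have eq: "?Q (x + a *\<^sub>R u + b *\<^sub>R v) = ?P (x + a' *\<^sub>R v + b' *\<^sub>R u)" using s by simp
  have "dist (?Q (x + a *\<^sub>R u + b *\<^sub>R v)) (?Q x) < e"
    using near[of a b] inU[of a b] ab d by (intro d12) auto
  moreover have "dist (?P (x + a' *\<^sub>R v + b' *\<^sub>R u)) (?P x) < e"
    using inU'[of b' a'] ab' d by (intro d12) auto
  ultimately have "dist (?P x) (?Q x) < 2 * e"
    using eq by (smt (verit) dist_triangle2 dist_commute)
  then show False by (simp add: e_def)
qed

lemma dir_deriv_bounded_linear:
  assumes "smooth_on m U g" "open_RR m U" "x \<in> U" "v \<in> RR m" "bounded_linear T"
  shows "dir_deriv v (\<lambda>x. T (g x)) x = T (dir_deriv v g x)"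
  using deriv_at_bounded_linear[OF assms] smooth_on_dir_deriv_eq[OF assms(1-4)]
    smooth_on_dir_deriv_eq[OF smooth_on_bounded_linear[OF assms(2,5,1)] assms(2-4)] by simp

lemma dir_deriv_commute:
  fixes g :: "seqs \<Rightarrow> 'b::euclidean_space"
  assumes g: "smooth_on m U g" and U: "open_RR m U" and x: "x \<in> U" and uv: "u \<in> RR m" "v \<in> RR m"
  shows "dir_deriv u (dir_deriv v g) x = dir_deriv v (dir_deriv u g) x"
proof (rule euclidean_eqI)
  fix b :: 'b assume "b \<in> Basis"
  have bl: "bounded_linear (\<lambda>z::'b. z \<bullet> b)" by (rule bounded_linear_inner_left)
  have gb: "smooth_on m U (\<lambda>z. g z \<bullet> b)" by (rule smooth_on_bounded_linear[OF U bl g])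
  have *: "dir_deriv w (dir_deriv w' g) x \<bullet> b = dir_deriv w (dir_deriv w' (\<lambda>z. g z \<bullet> b)) x"
    if "w \<in> RR m" "w' \<in> RR m" for w w'
  proof -
    have "dir_deriv w (dir_deriv w' (\<lambda>z. g z \<bullet> b)) x = dir_deriv w (\<lambda>z. dir_deriv w' g z \<bullet> b) x"
      by (rule dir_deriv_cong_open[OF U x that(1)]) (rule dir_deriv_bounded_linear[OF g U _ that(2) bl])
    then show ?thesis
      using dir_deriv_bounded_linear[OF smooth_on_dir_deriv[OF g that(2)] U x that(1) bl] by simp
  qed
  show "dir_deriv u (dir_deriv v g) x \<bullet> b = dir_deriv v (dir_deriv u g) x \<bullet> b"
    using *[OF uv] *[OF uv(2,1)] dir_deriv_commute_real[OF gb U x uv] by simp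
qed

text \<open>Leibniz rule for a derivative along a variable direction. It isolates the second-order
  term, which is symmetric in the two directions and cancels in commutators, from the first-order
  term that forms the Lie bracket.\<close>

lemma deriv_at_deriv_at:
  fixes g :: "seqs \<Rightarrow> 'b::real_normed_vector"
  assumes g: "smooth_on m U g" and U: "open_RR m U" and x: "x \<in> U" and y: "smooth_on m U y" "y ` U \<subseteq> RR m"
    and a: "a \<in> RR m"
  shows "deriv_at m (\<lambda>z. deriv_at m g z (y z)) x a =
    dir_deriv a (dir_deriv (y x) g) x + deriv_at m g x (deriv_at m y x a)"
proof -
  have yx: "y x \<in> RR m" using x y(2) by blast
  let ?c = "\<lambda>z i. apply_bcontfun z i"
  have d: "((\<lambda>z. deriv_at m g z (y z)) has_derivative
     (\<lambda>a. \<Sum>i<m. ?c (y x) i *\<^sub>R deriv_at m (dir_deriv (unit_seq i) g) x a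
         + ?c (deriv_at m y x a) i *\<^sub>R dir_deriv (unit_seq i) g x)) (at x within RR m)"
    unfolding deriv_at_def[of m g]
    by (intro has_derivative_sum has_derivative_scaleR bounded_linear.has_derivative[OF bounded_linear_coord]
        smooth_on_has_derivative[OF y(1) U x] smooth_on_has_derivative[OF smooth_on_dir_deriv[OF g] U x])
       (auto intro: RR_unit_seq)
  have d2: "((\<lambda>z. deriv_at m g z (y x)) has_derivative
     (\<lambda>a. \<Sum>i<m. ?c (y x) i *\<^sub>R deriv_at m (dir_deriv (unit_seq i) g) x a)) (at x within RR m)"
    unfolding deriv_at_def[of m g]
    by (intro has_derivative_sum has_derivative_scaleR_right
        smooth_on_has_derivative[OF smooth_on_dir_deriv[OF g] U x])
       (auto intro: RR_unit_seq)
  have xm: "x \<in> RR m" using U x open_RR_subset by blast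
  have "dir_deriv a (dir_deriv (y x) g) x = dir_deriv a (\<lambda>z. deriv_at m g z (y x)) x"
    by (rule dir_deriv_cong_open[OF U x a]) (rule smooth_on_dir_deriv_eq[OF g U _ yx])
  also have "\<dots> = (\<Sum>i<m. ?c (y x) i *\<^sub>R deriv_at m (dir_deriv (unit_seq i) g) x a)"
    using dir_deriv_if_has_derivative(1)[OF d2 xm a] .
  finally show ?thesis
    using deriv_at_eq[OF d xm a] by (simp add: deriv_at_def[of m g x "deriv_at m y x a"] sum.distrib)
qed

section \<open>Regularity of operator inversion\<close>

lemma has_vector_derivative_at_0_iff:
  fixes F :: "real \<Rightarrow> 'b::real_normed_vector"
  shows "(F has_vector_derivative D) (at 0) \<longleftrightarrow> ((\<lambda>t. (F t - F 0) /\<^sub>R t) \<longlongrightarrow> D) (at 0)"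
proof -
  have "norm (F (0 + h) - F 0 - h *\<^sub>R D) / norm h = norm ((F h - F 0) /\<^sub>R h - D)" if "h \<noteq> 0" for h
  proof -
    have "(F h - F 0) /\<^sub>R h - D = (F (0 + h) - F 0 - h *\<^sub>R D) /\<^sub>R h"
      using that by (simp add: scaleR_diff_right)
    then show ?thesis by (simp add: divide_inverse mult.commute)
  qed
  then have "((\<lambda>h. norm (F (0 + h) - F 0 - h *\<^sub>R D) / norm h) \<longlongrightarrow> 0) (at 0) \<longleftrightarrow>
      ((\<lambda>h. norm ((F h - F 0) /\<^sub>R h - D)) \<longlongrightarrow> 0) (at 0)"
    by (intro filterlim_cong refl) (auto simp: eventually_at_filter)
  then show ?thesis
    unfolding has_vector_derivative_def has_derivative_at tendsto_norm_zero_iff LIM_zero_iff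
    by (simp add: bounded_linear_scaleR_left)
qed

text \<open>The derivative of \<open>B\<close> is \<open>- B A' B\<close>, so each derivative of
  \<open>A\<close> buys one of \<open>B\<close>. The uniform bound \<open>K\<close> yields the
  continuity with which the induction starts.\<close>

lemma C_k_on_blinfun_inverse:
  fixes A B :: "seqs \<Rightarrow> 'u::real_normed_vector \<Rightarrow>\<^sub>L 'u"
  assumes U: "open_RR m U" and A: "C_k_on k m U A"
    and AB: "\<And>x. x \<in> U \<Longrightarrow> A x o\<^sub>L B x = id_blinfun" "\<And>x. x \<in> U \<Longrightarrow> B x o\<^sub>L A x = id_blinfun"
    and bd: "\<And>x. x \<in> U \<Longrightarrow> norm (B x) \<le> K"
  shows "C_k_on k m U B"
proof -
  \<comment> \<open>The resolvent identity. It gives continuity through the bound on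
    \<open>B y\<close>, and the derivative after division by \<open>t\<close>.\<close>
  have diff: "B y - B x = B y o\<^sub>L ((A x - A y) o\<^sub>L B x)" if "x \<in> U" "y \<in> U" for x y
  proof -
    have "B y (A y z) = z" "A x (B x z) = z" for z
      using AB that by (metis blinfun_apply_blinfun_compose id_blinfun.rep_eq id_apply)+
    then show ?thesis
      by (intro blinfun_eqI) (simp add: blinfun.bilinear_simps)
  qed
  have cont: "continuous_on U B" if "continuous_on U A"
    unfolding continuous_on_def
  proof
    fix x assume x: "x \<in> U"
    have "(A \<longlongrightarrow> A x) (at x within U)"
      using that x by (auto simp: continuous_on_def)
    then have "((\<lambda>y. K * (norm (A x - A y) * norm (B x))) \<longlongrightarrow> K * (norm (A x - A x) * norm (B x))) (at x within U)"
      by (intro tendsto_intros)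
    then have lim: "((\<lambda>y. K * (norm (A x - A y) * norm (B x))) \<longlongrightarrow> 0) (at x within U)"
      by (simp only: diff_self norm_zero mult_zero_left mult_zero_right)
    have "((\<lambda>y. B y - B x) \<longlongrightarrow> 0) (at x within U)"
    proof (rule Lim_null_comparison[OF _ lim])
      show "\<forall>\<^sub>F y in at x within U. norm (B y - B x) \<le> K * (norm (A x - A y) * norm (B x))"
        unfolding eventually_at_filter
      proof (rule always_eventually, intro allI impI)
        fix y assume y: "y \<in> U"
        have "norm (B y - B x) \<le> norm (B y) * norm ((A x - A y) o\<^sub>L B x)"
          unfolding diff[OF x y] by (rule norm_blinfun_compose)
        also have "\<dots> \<le> K * (norm (A x - A y) * norm (B x))"
          by (rule mult_mono[OF bd[OF y] norm_blinfun_compose]) (use bd[OF y] norm_ge_zero order_trans in blast, simp)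
        finally show "norm (B y - B x) \<le> K * (norm (A x - A y) * norm (B x))" .
      qed
    qed
    then show "(B \<longlongrightarrow> B x) (at x within U)" using LIM_zero_cancel by blast
  qed
  show ?thesis
    using A
  proof (induction k)
    case 0
    then show ?case using cont by simp
  next
    case (Suc k)
    have A0: "continuous_on U A" and B0: "continuous_on U B"
      using C_k_on_continuous[OF Suc.prems] cont by auto
    have IH: "C_k_on k m U B" by (rule Suc.IH[OF C_k_on_SucD[OF Suc.prems]])
    have dd: "((\<lambda>t. B (x + t *\<^sub>R v)) has_vector_derivative - (B x o\<^sub>L (dir_deriv v A x o\<^sub>L B x))) (at 0)"
      if x: "x \<in> U" and v: "v \<in> RR m" for x v
    proof -
      have ev: "\<forall>\<^sub>F t in at 0. x + t *\<^sub>R v \<in> U"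
        using open_RR_line[OF U x v] by (auto simp: eventually_at_filter elim: eventually_mono)
      have xm: "x \<in> RR m" using open_RR_subset U x by blast
      have Adir: "((\<lambda>t. A (x + t *\<^sub>R v)) has_vector_derivative dir_deriv v A x) (at 0)"
        using dir_deriv_if_has_derivative(3)[OF has_derivative_deriv_at[OF Suc.prems U x] xm v]
          dir_deriv_eq_deriv_at[OF Suc.prems U x v] by simp
      then have limA: "((\<lambda>t. (A (x + t *\<^sub>R v) - A x) /\<^sub>R t) \<longlongrightarrow> dir_deriv v A x) (at 0)"
        by (simp add: has_vector_derivative_at_0_iff)
      \<comment> \<open>The punctured filter at \<open>x\<close> requires
        \<open>x + t *\<^sub>R v \<noteq> x\<close>, hence \<open>v \<noteq> 0\<close>; for
        \<open>v = 0\<close> the limit is constant.\<close>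
      have "filterlim (\<lambda>t. x + t *\<^sub>R v) (at x within U) (at 0)" if "v \<noteq> 0"
        unfolding filterlim_at using ev that
        by (auto intro!: tendsto_eq_intros simp: eventually_at_filter)
      then have limB: "((\<lambda>t. B (x + t *\<^sub>R v)) \<longlongrightarrow> B x) (at 0)"
        using B0 x filterlim_compose[of B "nhds (B x)" "at x within U"]
        by (cases "v = 0") (auto simp: continuous_on_def)
      have "((\<lambda>t. - (B (x + t *\<^sub>R v) o\<^sub>L (((A (x + t *\<^sub>R v) - A x) /\<^sub>R t) o\<^sub>L B x))) \<longlongrightarrow>
            - (B x o\<^sub>L (dir_deriv v A x o\<^sub>L B x))) (at 0)"
        by (intro tendsto_minus bounded_bilinear.tendsto[OF bounded_bilinear_blinfun_compose] limA limB tendsto_const)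
      then have "((\<lambda>t. (B (x + t *\<^sub>R v) - B x) /\<^sub>R t) \<longlongrightarrow> - (B x o\<^sub>L (dir_deriv v A x o\<^sub>L B x))) (at 0)"
      proof (rule Lim_transform_eventually)
        show "\<forall>\<^sub>F t in at 0. - (B (x + t *\<^sub>R v) o\<^sub>L (((A (x + t *\<^sub>R v) - A x) /\<^sub>R t) o\<^sub>L B x)) = (B (x + t *\<^sub>R v) - B x) /\<^sub>R t"
          using ev
        proof eventually_elim
          case (elim t)
          show ?case unfolding diff[OF x elim]
            by (intro blinfun_eqI) (simp add: blinfun.bilinear_simps algebra_simps)
        qed
      qed
      then show ?thesis
        by (simp add: has_vector_derivative_at_0_iff)
    qed
    have Cd: "C_k_on k m U (\<lambda>x. - (B x o\<^sub>L (dir_deriv v A x o\<^sub>L B x)))" if "v \<in> RR m" for v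
      using C_k_on_bounded_linear[OF U bounded_linear_minus[OF bounded_linear_ident]
          C_k_on_bilinear[OF U bounded_bilinear_blinfun_compose IH
            C_k_on_bilinear[OF U bounded_bilinear_blinfun_compose C_k_on_dir_deriv[OF Suc.prems that] IH]]] .
    have "dir_deriv v B x = - (B x o\<^sub>L (dir_deriv v A x o\<^sub>L B x))" if "x \<in> U" "v \<in> RR m" for x v
      using dd[OF that] by (simp add: dir_deriv_def vector_derivative_at)
    then have "C_k_on k m U (dir_deriv v B)" if "v \<in> RR m" for v
      using C_k_on_cong[OF U, of "dir_deriv v B" "\<lambda>x. - (B x o\<^sub>L (dir_deriv v A x o\<^sub>L B x))"] Cd[OF that] that by simp
    moreover have "(\<lambda>t::real. B (x + t *\<^sub>R v)) differentiable (at 0)" if "x \<in> U" "v \<in> RR m" for x v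
      using dd[OF that] differentiableI_vector by blast
    ultimately show ?case using B0 by (simp add: C_k_on.simps(2))
  qed
qed

section \<open>Countable bases for subsets of coordinate space\<close>

lemma second_countable_euclidean: "second_countable (euclidean :: 'z::second_countable_topology topology)"
proof -
  obtain B :: "'z set set" where B: "countable B" "topological_basis B"
    using ex_countable_basis by blast
  have 1: "openin euclidean V" if "V \<in> B" for V
    using topological_basis_open[OF B(2) that] by (rule open_openin[THEN iffD1])
  have 2: "\<exists>V\<in>B. x \<in> V \<and> V \<subseteq> U" if "openin euclidean U" "x \<in> U" for U x
  proof -
    have "open U" using that(1) by (rule open_openin[THEN iffD2])
    from topological_basisE[OF B(2) this that(2)] show ?thesis by metis
  qed
  show ?thesis
    unfolding second_countable_def using B(1) 1 2 by metis
qed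

text \<open>The ambient space of bounded sequences is not separable, so the property cannot be
  inherited from it. On \<open>RR m\<close> the coordinates give a homeomorphism onto a subset of
  the product space of real sequences, which does have a countable base.\<close>

lemma second_countable_RR:
  assumes "N \<subseteq> RR m"
  shows "second_countable (top_of_set N)"
proof -
  let ?g = "\<lambda>f::nat \<Rightarrow> real. \<Sum>i<m. f i *\<^sub>R unit_seq i"
  have "homeomorphic_maps (top_of_set N) (top_of_set (apply_bcontfun ` N)) apply_bcontfun ?g"
    unfolding homeomorphic_maps_def
  proof (intro conjI ballI)
    have "continuous_on N (apply_bcontfun :: seqs \<Rightarrow> nat \<Rightarrow> real)"
      by (intro continuous_on_coordinatewise_then_product linear_continuous_on bounded_linear_coord)
    then show "continuous_map (top_of_set N) (top_of_set (apply_bcontfun ` N)) apply_bcontfun"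
      by auto
    have "continuous_on (apply_bcontfun ` N) ?g"
      by (intro continuous_intros continuous_on_subset[OF continuous_on_product_coordinates]) simp
    moreover have "?g (apply_bcontfun x) = x" if "x \<in> N" for x
      using RR_expand assms that by blast
    ultimately show "continuous_map (top_of_set (apply_bcontfun ` N)) (top_of_set N) ?g"
      by auto
    show "?g (apply_bcontfun x) = x" if "x \<in> topspace (top_of_set N)" for x
      using RR_expand assms that by auto
    then show "apply_bcontfun (?g y) = y" if "y \<in> topspace (top_of_set (apply_bcontfun ` N))" for y
      using that by auto
  qed
  then have "top_of_set N homeomorphic_space top_of_set ((apply_bcontfun :: seqs \<Rightarrow> nat \<Rightarrow> real) ` N)"
    using homeomorphic_maps_imp_homeomorphic_space by blast
  moreover have "second_countable (top_of_set ((apply_bcontfun :: seqs \<Rightarrow> nat \<Rightarrow> real) ` N))"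
    using second_countable_subtopology[OF second_countable_euclidean] by auto
  ultimately show ?thesis
    using homeomorphic_space_second_countability by blast
qed

subsection \<open>Linearly independent families\<close>

text \<open>Stated for indexed families, so that repetitions count as dependence and the index can
  double as a coordinate number.\<close>

definition lin_indep :: "nat \<Rightarrow> (nat \<Rightarrow> 'u::real_vector) \<Rightarrow> bool" where
  "lin_indep m w \<longleftrightarrow> (\<forall>a :: nat \<Rightarrow> real. (\<Sum>i<m. a i *\<^sub>R w i) = 0 \<longrightarrow> (\<forall>i<m. a i = 0))"

lemma lin_indep_independent:
  fixes w :: "nat \<Rightarrow> 'u::real_vector"
  assumes w: "lin_indep m w"
  shows "inj_on w {..<m}" "independent (w ` {..<m})"
proof -
  show inj: "inj_on w {..<m}"
  proof (rule inj_onI)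
    fix i j assume ij: "i \<in> {..<m}" "j \<in> {..<m}" "w i = w j"
    show "i = j"
    proof (rule ccontr)
      assume "i \<noteq> j"
      define a where "a k = (if k = i then 1 else 0) - (if k = j then 1 else (0::real))" for k
      have "(\<Sum>k<m. a k *\<^sub>R w k) = w i - w j"
        using ij by (simp add: a_def scaleR_diff_left sum_subtractf if_distrib[of "\<lambda>c. c *\<^sub>R _"] sum.delta cong: if_cong)
      then have "a i = 0" using w ij unfolding lin_indep_def by simp
      then show False using \<open>i \<noteq> j\<close> by (simp add: a_def)
    qed
  qed
  show "independent (w ` {..<m})"
    unfolding dependent_finite[OF finite_imageI[OF finite_lessThan]]
  proof clarsimp
    fix u k assume k: "k < m" "u (w k) \<noteq> 0" and s: "(\<Sum>v\<in>w ` {..<m}. u v *\<^sub>R v) = 0"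
    have "(\<Sum>i<m. u (w i) *\<^sub>R w i) = 0"
      using s by (simp add: sum.reindex[OF inj])
    then show False using w k unfolding lin_indep_def by (metis (mono_tags))
  qed
qed

lemma lin_indep_dual:
  fixes w :: "nat \<Rightarrow> 'u::euclidean_space"
  assumes w: "lin_indep m w"
  obtains \<beta> :: "nat \<Rightarrow> 'u \<Rightarrow> real"
  where "\<And>i. bounded_linear (\<beta> i)" "\<And>i j. i < m \<Longrightarrow> j < m \<Longrightarrow> \<beta> i (w j) = (if j = i then 1 else 0)"
proof -
  note inj = lin_indep_independent(1)[OF w] and ind = lin_indep_independent(2)[OF w]
  have "\<exists>g. linear g \<and> (\<forall>v\<in>w ` {..<m}. g v = (if v = w i then 1 else (0::real)))" for i
    using linear_independent_extend[OF ind] .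
  then obtain g where g: "\<And>i. linear (g i)" "\<And>i v. v \<in> w ` {..<m} \<Longrightarrow> g i v = (if v = w i then 1 else (0::real))"
    by metis
  have "g i (w j) = (if j = i then 1 else 0)" if "i < m" "j < m" for i j
    using g(2)[of "w j" i] that inj by (auto simp: inj_on_def)
  then show ?thesis
    using that[of g] g(1) linear_conv_bounded_linear by blast
qed

text \<open>These functions play the role of the minors of a matrix whose entries are affine in \<open>t\<close>.\<close>

definition poly_family :: "'z::metric_space set \<Rightarrow> ('z \<Rightarrow> real \<Rightarrow> real) \<Rightarrow> bool" where
  "poly_family S q \<longleftrightarrow> (\<exists>(P :: 'z \<Rightarrow> real poly) K. (\<forall>k. continuous_on S (\<lambda>z. coeff (P z) k)) \<and>
     (\<forall>z\<in>S. degree (P z) \<le> K \<and> (\<forall>t. q z t = poly (P z) t)))"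

lemma poly_family_affine:
  assumes "continuous_on S a" "continuous_on S b"
  shows "poly_family S (\<lambda>z t. a z + t * b z)"
  unfolding poly_family_def
proof (rule exI[of _ "\<lambda>z. [:a z, b z:]"], rule exI[of _ 1], intro conjI allI ballI)
  fix k
  show "continuous_on S (\<lambda>z. coeff [:a z, b z:] k)"
    using assms by (cases k; cases "k - 1") auto
qed auto

lemma poly_family_mult:
  assumes "poly_family S q" "poly_family S r"
  shows "poly_family S (\<lambda>z t. q z t * r z t)"
proof -
  obtain P K where P: "\<And>k. continuous_on S (\<lambda>z. coeff (P z) k)" "\<And>z. z \<in> S \<Longrightarrow> degree (P z) \<le> K"
    "\<And>z t. z \<in> S \<Longrightarrow> q z t = poly (P z) t" using assms(1) unfolding poly_family_def by metis
  obtain R L where R: "\<And>k. continuous_on S (\<lambda>z. coeff (R z) k)" "\<And>z. z \<in> S \<Longrightarrow> degree (R z) \<le> L"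
    "\<And>z t. z \<in> S \<Longrightarrow> r z t = poly (R z) t" using assms(2) unfolding poly_family_def by metis
  show ?thesis
    unfolding poly_family_def
  proof (rule exI[of _ "\<lambda>z. P z * R z"], rule exI[of _ "K + L"], intro conjI allI ballI)
    show "continuous_on S (\<lambda>z. coeff (P z * R z) k)" for k
      unfolding coeff_mult by (intro continuous_intros P R)
    show "degree (P z * R z) \<le> K + L" if "z \<in> S" for z
      using degree_mult_le[of "P z" "R z"] P(2)[OF that] R(2)[OF that] by linarith
  qed (use P R in auto)
qed

lemma poly_family_diff:
  assumes "poly_family S q" "poly_family S r"
  shows "poly_family S (\<lambda>z t. q z t - r z t)"
proof -
  obtain P K where P: "\<And>k. continuous_on S (\<lambda>z. coeff (P z) k)" "\<And>z. z \<in> S \<Longrightarrow> degree (P z) \<le> K"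
    "\<And>z t. z \<in> S \<Longrightarrow> q z t = poly (P z) t" using assms(1) unfolding poly_family_def by metis
  obtain R L where R: "\<And>k. continuous_on S (\<lambda>z. coeff (R z) k)" "\<And>z. z \<in> S \<Longrightarrow> degree (R z) \<le> L"
    "\<And>z t. z \<in> S \<Longrightarrow> r z t = poly (R z) t" using assms(2) unfolding poly_family_def by metis
  show ?thesis
    unfolding poly_family_def
  proof (rule exI[of _ "\<lambda>z. P z - R z"], rule exI[of _ "max K L"], intro conjI allI ballI)
    show "continuous_on S (\<lambda>z. coeff (P z - R z) k)" for k
      unfolding coeff_diff by (intro continuous_intros P R)
    show "degree (P z - R z) \<le> max K L" if "z \<in> S" for z
      using P(2)[OF that] R(2)[OF that] by (intro degree_diff_le) auto
  qed (use P R in auto)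
qed

text \<open>Divide out the lowest power of \<open>t\<close> whose coefficient is not identically zero, and evaluate
  at a point where that coefficient does not vanish.\<close>

lemma poly_family_nonzero:
  fixes S :: "'z::metric_space set"
  assumes q: "poly_family S q" and z0: "z0 \<in> S" "q z0 t0 \<noteq> 0"
  obtains z1 \<delta> where "z1 \<in> S" "\<delta> > 0"
    "\<And>z t. z \<in> S \<Longrightarrow> dist z z1 < \<delta> \<Longrightarrow> t \<noteq> 0 \<Longrightarrow> \<bar>t\<bar> < \<delta> \<Longrightarrow> q z t \<noteq> 0"
proof -
  obtain P K where P: "\<And>k. continuous_on S (\<lambda>z. coeff (P z) k)" "\<And>z. z \<in> S \<Longrightarrow> degree (P z) \<le> K"
    "\<And>z t. z \<in> S \<Longrightarrow> q z t = poly (P z) t" using q unfolding poly_family_def by metis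
  have "P z0 \<noteq> 0" using z0 P(3) by fastforce
  then have ex: "\<exists>k. \<exists>z\<in>S. coeff (P z) k \<noteq> 0" using z0(1) by (metis leading_coeff_0_iff)
  define k where "k = (LEAST k. \<exists>z\<in>S. coeff (P z) k \<noteq> 0)"
  obtain z1 where z1: "z1 \<in> S" "coeff (P z1) k \<noteq> 0"
    using LeastI_ex[OF ex] unfolding k_def by blast
  have low: "coeff (P z) i = 0" if "i < k" "z \<in> S" for i z
    using not_less_Least[of i "\<lambda>k. \<exists>z\<in>S. coeff (P z) k \<noteq> 0"] that unfolding k_def by blast
  \<comment> \<open>The quotient of \<open>q\<close> by \<open>t ^ k\<close>. The number of terms is
    the same for all \<open>z\<close>, although the degree varies, so \<open>R\<close> is jointly
    continuous; the surplus coefficients are zero.\<close>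
  define R where "R x = (\<Sum>i<Suc K. coeff (P (fst x)) (k + i) * snd x ^ i)" for x :: "'z \<times> real"
  have fact: "q z t = t ^ k * R (z, t)" if z: "z \<in> S" for z t
  proof -
    have "q z t = (\<Sum>i\<le>degree (P z). coeff (P z) i * t ^ i)" using P(3)[OF z] by (simp add: poly_altdef)
    also have "\<dots> = (\<Sum>i=0..<k + Suc K. coeff (P z) i * t ^ i)"
      using P(2)[OF z] by (intro sum.mono_neutral_left) (auto simp: coeff_eq_0)
    also have "\<dots> = (\<Sum>i=0..<k. coeff (P z) i * t ^ i) + (\<Sum>i=k..<k + Suc K. coeff (P z) i * t ^ i)"
      by (simp add: sum.atLeastLessThan_concat)
    also have "(\<Sum>i=0..<k. coeff (P z) i * t ^ i) = 0"
      using low z by (intro sum.neutral) auto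
    also have "(\<Sum>i=k..<k + Suc K. coeff (P z) i * t ^ i) = (\<Sum>i=0..<Suc K. coeff (P z) (i + k) * t ^ (i + k))"
      using sum.shift_bounds_nat_ivl[of "\<lambda>i. coeff (P z) i * t ^ i" 0 k "Suc K"] by (simp add: add.commute)
    also have "\<dots> = t ^ k * R (z, t)"
      unfolding R_def sum_distrib_left atLeast0LessThan by (intro sum.cong) (auto simp: power_add add.commute)
    finally show ?thesis by simp
  qed
  have "continuous_on (S \<times> UNIV) R"
    unfolding R_def
    by (intro continuous_intros continuous_on_compose2[OF P(1) continuous_on_fst]) auto
  moreover have R1: "R (z1, 0) \<noteq> 0"
    using z1 by (simp add: R_def sum.lessThan_Suc_shift)
  ultimately obtain \<delta> where \<delta>: "\<delta> > 0"
    "\<And>x. x \<in> S \<times> UNIV \<Longrightarrow> dist x (z1, 0) < \<delta> \<Longrightarrow> dist (R x) (R (z1, 0)) < \<bar>R (z1, 0)\<bar>"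
    using z1(1) unfolding continuous_on_iff by (metis (no_types, lifting) SigmaI UNIV_I zero_less_abs_iff)
  show ?thesis
  proof (rule that[OF z1(1), of "\<delta> / 2"])
    fix z t assume *: "z \<in> S" "dist z z1 < \<delta> / 2" "t \<noteq> 0" "\<bar>t\<bar> < \<delta> / 2"
    have "dist (z, t) (z1, 0) \<le> dist z z1 + \<bar>t\<bar>"
      unfolding dist_Pair_Pair using sqrt_sum_squares_le_sum[of "dist z z1" "\<bar>t\<bar>"] by simp
    then have "dist (R (z, t)) (R (z1, 0)) < \<bar>R (z1, 0)\<bar>"
      using * by (intro \<delta>(2)) auto
    then have "R (z, t) \<noteq> 0" by (auto simp: dist_real_def)
    then show "q z t \<noteq> 0" using fact[OF *(1)] *(3) by simp
  qed (use \<delta> in simp)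
qed

text \<open>Gaussian elimination without division.\<close>

lemma poly_family_lin_indep:
  fixes w :: "nat \<Rightarrow> 'z::metric_space \<Rightarrow> real \<Rightarrow> 'u::euclidean_space"
  assumes "\<And>j b. j < m \<Longrightarrow> poly_family S (\<lambda>z t. w j z t \<bullet> b)" "z0 \<in> S" "lin_indep m (\<lambda>j. w j z0 t0)"
  shows "\<exists>Q. poly_family S Q \<and> Q z0 t0 \<noteq> 0 \<and> (\<forall>z\<in>S. \<forall>t. Q z t \<noteq> 0 \<longrightarrow> lin_indep m (\<lambda>j. w j z t))"
  using assms
proof (induction m arbitrary: w)
  case 0
  show ?case
    using poly_family_affine[of S "\<lambda>_. 1" "\<lambda>_. 0"] by (intro exI[of _ "\<lambda>_ _. 1"]) (auto simp: lin_indep_def)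
next
  case (Suc m)
  have "w m z0 t0 \<noteq> 0"
  proof
    assume "w m z0 t0 = 0"
    then have "(\<Sum>j<Suc m. (if j = m then 1 else 0) *\<^sub>R w j z0 t0) = 0" by simp
    then show False using Suc.prems(3) unfolding lin_indep_def by fastforce
  qed
  then obtain b where b: "w m z0 t0 \<bullet> b \<noteq> 0" by (metis inner_eq_zero_iff)
  \<comment> \<open>Elimination with pivot \<open>w m z t \<bullet> b\<close>: the new vectors have
    no component along \<open>b\<close>, and cross-multiplication keeps their components polynomial
    in \<open>t\<close>.\<close>
  define w' where "w' j z t = (w m z t \<bullet> b) *\<^sub>R w j z t - (w j z t \<bullet> b) *\<^sub>R w m z t" for j z t
  have sum': "(\<Sum>j<m. a j *\<^sub>R w' j z t) =
     (w m z t \<bullet> b) *\<^sub>R (\<Sum>j<m. a j *\<^sub>R w j z t) - ((\<Sum>j<m. a j *\<^sub>R w j z t) \<bullet> b) *\<^sub>R w m z t" for a z t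
    by (simp add: w'_def scaleR_diff_right sum_subtractf scaleR_sum_right scaleR_sum_left inner_sum_left mult.commute)
  have "poly_family S (\<lambda>z t. w' j z t \<bullet> c)" if "j < m" for j c
    unfolding w'_def inner_diff_left inner_scaleR_left
    using that by (intro poly_family_diff poly_family_mult Suc.prems(1)) auto
  moreover have "lin_indep m (\<lambda>j. w' j z0 t0)"
    unfolding lin_indep_def
  proof (intro allI impI)
    fix a :: "nat \<Rightarrow> real" and i assume "(\<Sum>j<m. a j *\<^sub>R w' j z0 t0) = 0" and i: "i < m"
    \<comment> \<open>A relation among the eliminated vectors is a relation among the original ones:
      the pivot scales the old coefficients, and the last coefficient compensates the component
      along \<open>b\<close>.\<close>
    define c where "c j = (if j = m then - ((\<Sum>j<m. a j *\<^sub>R w j z0 t0) \<bullet> b) else (w m z0 t0 \<bullet> b) * a j)" for j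
    have "(\<Sum>j<Suc m. c j *\<^sub>R w j z0 t0) = (\<Sum>j<m. a j *\<^sub>R w' j z0 t0)"
      unfolding sum' by (simp add: c_def scaleR_sum_right)
    also have "\<dots> = 0" by fact
    finally have "c i = 0" using Suc.prems(3) i unfolding lin_indep_def by (metis less_SucI)
    then show "a i = 0" using i b by (simp add: c_def)
  qed
  ultimately obtain Q where Q: "poly_family S Q" "Q z0 t0 \<noteq> 0"
    "\<And>z t. z \<in> S \<Longrightarrow> Q z t \<noteq> 0 \<Longrightarrow> lin_indep m (\<lambda>j. w' j z t)"
    using Suc.IH[of w'] Suc.prems(2) by blast
  show ?case
  proof (intro exI[of _ "\<lambda>z t. (w m z t \<bullet> b) * Q z t"] conjI ballI allI impI)
    show "poly_family S (\<lambda>z t. (w m z t \<bullet> b) * Q z t)"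
      by (intro poly_family_mult Suc.prems(1) Q(1)) simp
    show "(w m z0 t0 \<bullet> b) * Q z0 t0 \<noteq> 0" using b Q(2) by simp
    fix z t assume z: "z \<in> S" and nz: "(w m z t \<bullet> b) * Q z t \<noteq> 0"
    show "lin_indep (Suc m) (\<lambda>j. w j z t)"
      unfolding lin_indep_def
    proof (intro allI impI)
      fix a :: "nat \<Rightarrow> real" and i assume a: "(\<Sum>j<Suc m. a j *\<^sub>R w j z t) = 0" and i: "i < Suc m"
      have s: "(\<Sum>j<m. a j *\<^sub>R w j z t) = - a m *\<^sub>R w m z t"
        using a by (simp add: eq_neg_iff_add_eq_0)
      have "(\<Sum>j<m. a j *\<^sub>R w' j z t) = 0" unfolding sum' s by (simp add: mult.commute)
      then have a0: "a j = 0" if "j < m" for j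
        using Q(3)[OF z] nz that unfolding lin_indep_def by auto
      then have "a m *\<^sub>R w m z t = 0" using s by simp
      then have "a m = 0" using nz by auto
      then show "a i = 0" using a0 i by (metis less_SucE)
    qed
  qed
qed

text \<open>Independence at one pair \<open>(z0, t0)\<close>, with \<open>t0\<close> of any size,
  spreads to all small nonzero \<open>t\<close> near some \<open>z1\<close>, because a polynomial
  minor that is nonzero once has only isolated zeros in \<open>t\<close>. The point
  \<open>z1\<close> may differ from \<open>z0\<close>: at \<open>z0\<close> the lowest coefficient
  may vanish.\<close>

lemma lin_indep_affine_family:
  fixes A B :: "nat \<Rightarrow> 'z::metric_space \<Rightarrow> 'u::euclidean_space"
  assumes "\<And>j. j < m \<Longrightarrow> continuous_on S (A j)" "\<And>j. j < m \<Longrightarrow> continuous_on S (B j)"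
    and "z0 \<in> S" "lin_indep m (\<lambda>j. A j z0 + t0 *\<^sub>R B j z0)"
  obtains z1 \<delta> where "z1 \<in> S" "\<delta> > 0"
    "\<And>z t. z \<in> S \<Longrightarrow> dist z z1 < \<delta> \<Longrightarrow> t \<noteq> 0 \<Longrightarrow> \<bar>t\<bar> < \<delta> \<Longrightarrow> lin_indep m (\<lambda>j. A j z + t *\<^sub>R B j z)"
proof -
  have "poly_family S (\<lambda>z t. (A j z + t *\<^sub>R B j z) \<bullet> b)" if "j < m" for j b
    unfolding inner_add_left inner_scaleR_left
    by (intro poly_family_affine continuous_intros assms that)
  then obtain Q where Q: "poly_family S Q" "Q z0 t0 \<noteq> 0"
    "\<And>z t. z \<in> S \<Longrightarrow> Q z t \<noteq> 0 \<Longrightarrow> lin_indep m (\<lambda>j. A j z + t *\<^sub>R B j z)"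
    using poly_family_lin_indep[of m S "\<lambda>j z t. A j z + t *\<^sub>R B j z" z0 t0] assms(3,4) by blast
  show ?thesis
    using poly_family_nonzero[OF Q(1) assms(3) Q(2)] Q(3) that by metis
qed

section \<open>Left inverses of immersions and regularity of lifts\<close>

lemma linear_left_inverse_RR:
  fixes w :: "nat \<Rightarrow> 'u::euclidean_space"
  assumes "lin_indep n w"
  shows "\<exists>\<beta> lam. (\<forall>j. bounded_linear (\<beta> j)) \<and> lam = (\<lambda>u. \<Sum>j<n. \<beta> j u *\<^sub>R unit_seq j) \<and>
    bounded_linear lam \<and> (\<forall>u. lam u \<in> RR n) \<and>
    (\<forall>v\<in>RR n. lam (\<Sum>j<n. apply_bcontfun v j *\<^sub>R w j) = v)"
proof -
  obtain \<beta> where \<beta>: "\<And>i. bounded_linear (\<beta> i)"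
    "\<And>i j. i < n \<Longrightarrow> j < n \<Longrightarrow> \<beta> i (w j) = (if j = i then 1 else (0::real))"
    using lin_indep_dual[OF assms] by metis
  define lam where "lam = (\<lambda>u. \<Sum>j<n. \<beta> j u *\<^sub>R unit_seq j)"
  have "lam (\<Sum>j<n. apply_bcontfun v j *\<^sub>R w j) = v" if "v \<in> RR n" for v
  proof -
    have "\<beta> i (\<Sum>j<n. apply_bcontfun v j *\<^sub>R w j) = apply_bcontfun v i" if "i < n" for i
    proof -
      have "\<beta> i (\<Sum>j<n. apply_bcontfun v j *\<^sub>R w j) = (\<Sum>j<n. apply_bcontfun v j *\<^sub>R \<beta> i (w j))"
        using \<beta>(1)[of i] by (simp add: bounded_linear.linear linear_sum linear_cmul)
      also have "\<dots> = (\<Sum>j<n. if j = i then apply_bcontfun v j else 0)"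
        using that by (intro sum.cong) (auto simp: \<beta>(2))
      finally show ?thesis using that by simp
    qed
    then show ?thesis unfolding lam_def using RR_expand[OF that] by simp
  qed
  moreover have "bounded_linear lam"
    unfolding lam_def by (intro bounded_linear_sum bounded_linear_scaleR_const \<beta>)
  moreover have "lam u \<in> RR n" for u unfolding lam_def by (intro RR_intros) auto
  ultimately show ?thesis using \<beta>(1) lam_def by blast
qed

text \<open>A bootstrap: since \<open>\<phi>\<close> is an immersion near \<open>z0\<close>, the
  derivative of \<open>s\<close> can be solved for from that of \<open>\<phi> \<circ> s\<close>,
  with coefficients depending on \<open>s\<close> itself. If \<open>s\<close> is of class
  \<open>k\<close>, so are the coefficients, and \<open>s\<close> is of class \<open>k + 1\<close>.
  Here a merely differentiable inverse becomes smooth.\<close>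

lemma smooth_lift:
  fixes \<phi> :: "seqs \<Rightarrow> 'u::euclidean_space"
  assumes Om: "open_RR n Om" and \<phi>: "smooth_on n Om \<phi>" and z0: "z0 \<in> Om"
    and ind: "lin_indep n (\<lambda>j. dir_deriv (unit_seq j) \<phi> z0)"
    and B: "open_RR d B" and a0: "a0 \<in> B" "s a0 = z0" and sB: "s ` B \<subseteq> Om"
    and s': "\<And>a. a \<in> B \<Longrightarrow> (s has_derivative s' a) (at a within RR d)"
    and \<phi>s: "smooth_on d B (\<lambda>a. \<phi> (s a))"
  shows "\<exists>B'. a0 \<in> B' \<and> B' \<subseteq> B \<and> open_RR d B' \<and> smooth_on d B' s"
proof -
  obtain \<beta> lam where \<beta>: "\<And>j. bounded_linear (\<beta> j)" and lam_eq: "lam = (\<lambda>u. \<Sum>j<n. \<beta> j u *\<^sub>R unit_seq j)"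
    and lam: "bounded_linear lam" "\<And>u. lam u \<in> RR n"
    "\<And>v. v \<in> RR n \<Longrightarrow> lam (deriv_at n \<phi> z0 v) = v"
    using linear_left_inverse_RR[OF ind] unfolding deriv_at_def[abs_def] by blast
  have sR: "s ` B \<subseteq> RR n" using sB Om openin_imp_subset by blast
  \<comment> \<open>The rank-one operator \<open>p \<mapsto> \<beta> j p *\<^sub>R c\<close>,
    bounded linear in \<open>c\<close>; sums of these turn partial derivatives into operators on the
    target space.\<close>
  define R where "R j c = blinfun_scaleR_left c o\<^sub>L Blinfun (\<beta> j)" for j and c :: 'u
  have Rbl: "bounded_linear (R j)" for j
    unfolding R_def[abs_def]
    by (rule bounded_linear_compose[OF bounded_bilinear.bounded_linear_left[OF bounded_bilinear_blinfun_compose]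
          bounded_linear_blinfun_scaleR_left])
  have Rapp: "blinfun_apply (R j c) p = \<beta> j p *\<^sub>R c" for j c p
    by (simp add: R_def bounded_linear_Blinfun_apply[OF \<beta>])
  \<comment> \<open>An operator on the whole target space that is the identity at \<open>z0\<close>
    and carries the differential at \<open>z0\<close> to the differential at \<open>z\<close>.
    Inverting it replaces inverting a map out of \<open>RR n\<close>.\<close>
  define A where "A z = id_blinfun + (\<Sum>j<n. R j (dir_deriv (unit_seq j) \<phi> z - dir_deriv (unit_seq j) \<phi> z0))" for z
  have Aapp: "blinfun_apply (A z) p = p + (deriv_at n \<phi> z (lam p) - deriv_at n \<phi> z0 (lam p))" for z p
    by (simp add: A_def blinfun.add_left blinfun.sum_left Rapp deriv_at_def lam_eq coord_sum_unit_seq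
        scaleR_diff_right sum_subtractf del: coord_sum)
  have A\<phi>: "blinfun_apply (A z) (deriv_at n \<phi> z0 u) = deriv_at n \<phi> z u" if "u \<in> RR n" for z u
    unfolding Aapp using lam(3)[OF that] by simp
  have Asm: "smooth_on n Om A"
    unfolding A_def
    by (intro smooth_on_add[OF Om] smooth_on_const[OF Om] smooth_on_sum[OF Om] smooth_on_bounded_linear[OF Om Rbl]
        smooth_on_diff[OF Om] smooth_on_dir_deriv[OF \<phi>]) (auto intro: RR_unit_seq)
  have "A z0 = id_blinfun" by (simp add: A_def bounded_linear.linear[OF Rbl] linear_0)
  moreover have contA: "continuous_on B (\<lambda>a. A (s a))"
  proof (rule continuous_on_compose2[OF smooth_on_continuous[OF Asm] _ sB])
    show "continuous_on B s"
      using s' has_derivative_continuous at_within_open_RR[OF B] unfolding continuous_on_eq_continuous_within by metis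
  qed
  ultimately obtain \<epsilon> where \<epsilon>: "\<epsilon> > 0" "\<And>a. a \<in> B \<Longrightarrow> dist a a0 < \<epsilon> \<Longrightarrow> norm (A (s a) - id_blinfun) < 1/2"
    using a0 unfolding continuous_on_iff dist_norm by (metis half_gt_zero zero_less_one)
  define B' where "B' = B \<inter> ball a0 \<epsilon>"
  have B': "a0 \<in> B'" "B' \<subseteq> B" "open_RR d B'"
    using a0 \<epsilon> B by (auto simp: B'_def intro: openin_Int_open)
  have small: "norm (A (s a) - id_blinfun) \<le> 1/2" if "a \<in> B'" for a
    using \<epsilon>(2)[of a] that by (auto simp: B'_def dist_commute less_imp_le)
  \<comment> \<open>Distance at most \<open>1/2\<close> from the identity shrinks norms at most by
    the factor \<open>2\<close>; this makes \<open>A (s a)\<close> invertible with inverse of norm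
    at most \<open>2\<close>.\<close>
  have lower: "norm p / 2 \<le> norm (A (s a) p)" if "a \<in> B'" for a p
  proof -
    have "norm ((A (s a) - id_blinfun) p) \<le> 1/2 * norm p"
      using norm_blinfun[of "A (s a) - id_blinfun" p] mult_right_mono[OF small[OF that] norm_ge_zero, of p] by linarith
    moreover have "p = A (s a) p - (A (s a) - id_blinfun) p" by (simp add: blinfun.diff_left)
    ultimately show ?thesis using norm_triangle_ineq4[of "A (s a) p" "(A (s a) - id_blinfun) p"] by simp
  qed
  have "\<exists>C. A (s a) o\<^sub>L C = id_blinfun \<and> C o\<^sub>L A (s a) = id_blinfun \<and> norm C \<le> 2" if a: "a \<in> B'" for a
  proof -
    have lin: "linear (blinfun_apply (A (s a)))" by (simp add: blinfun.bounded_linear_right bounded_linear.linear)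
    have "inj (blinfun_apply (A (s a)))"
      unfolding linear_injective_0[OF lin] using lower[OF a] by (metis norm_le_zero_iff divide_le_0_iff not_numeral_le_zero norm_zero)
    then obtain C where C: "linear C" "\<And>p. C (A (s a) p) = p" "\<And>p. A (s a) (C p) = p"
      using linear_injective_isomorphism[OF lin] by blast
    have ap: "blinfun_apply (Blinfun C) = C"
      using C(1) linear_conv_bounded_linear bounded_linear_Blinfun_apply by blast
    have "norm (C p) \<le> 2 * norm p" for p using lower[OF a, of "C p"] C(3) by simp
    then have "norm (Blinfun C) \<le> 2" by (intro norm_blinfun_bound) (auto simp: ap)
    then show ?thesis
      by (intro exI[of _ "Blinfun C"] conjI blinfun_eqI) (auto simp: ap C)
  qed
  then obtain C where C: "\<And>a. a \<in> B' \<Longrightarrow> A (s a) o\<^sub>L C a = id_blinfun" "\<And>a. a \<in> B' \<Longrightarrow> C a o\<^sub>L A (s a) = id_blinfun"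
    "\<And>a. a \<in> B' \<Longrightarrow> norm (C a) \<le> 2" by metis
  \<comment> \<open>Chain rule for \<open>\<phi> \<circ> s\<close>, solved for the derivative of
    \<open>s\<close>: undo \<open>A (s a)\<close> and then apply the left inverse of the
    differential at \<open>z0\<close>.\<close>
  have s'eq: "s' a b = lam (C a (dir_deriv b (\<lambda>a. \<phi> (s a)) a))" if a: "a \<in> B'" and b: "b \<in> RR d" for a b
  proof -
    have aB: "a \<in> B" "a \<in> RR d" using a B' open_RR_subset by blast+
    have s'R: "s' a b \<in> RR n" by (rule has_derivative_in_RR[OF s'[OF aB(1)] B aB(1) sR b])
    have "((\<lambda>a. \<phi> (s a)) has_derivative (\<lambda>v. deriv_at n \<phi> (s a) (s' a v))) (at a within RR d)"
      using sB aB by (intro has_derivative_RR_compose[OF s'[OF aB(1)] smooth_on_has_derivative[OF \<phi> Om] B aB(1) sR]) auto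
    then have "dir_deriv b (\<lambda>a. \<phi> (s a)) a = deriv_at n \<phi> (s a) (s' a b)"
      using dir_deriv_if_has_derivative(1) aB b by blast
    also have "\<dots> = A (s a) (deriv_at n \<phi> z0 (s' a b))" using A\<phi>[OF s'R] by simp
    finally have "C a (dir_deriv b (\<lambda>a. \<phi> (s a)) a) = deriv_at n \<phi> z0 (s' a b)"
      using C(2)[OF a] by (metis blinfun_apply_blinfun_compose id_blinfun.rep_eq id_apply)
    then show ?thesis using lam(3)[OF s'R] by simp
  qed
  have "C_k_on k d B' s" for k
  proof (induction k)
    case 0
    have "continuous_on B' s"
      using s' B'(2) has_derivative_continuous at_within_open_RR[OF B'(3)]
      unfolding continuous_on_eq_continuous_within by (metis subsetD)
    then show ?case by simp
  next
    case (Suc k)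
    have sB': "s ` B' \<subseteq> Om" using sB B' by blast
    have "C_k_on k d B' (\<lambda>a. A (s a))"
      by (rule C_k_on_compose[OF B'(3) Om sB' Suc smooth_on_C_k[OF Asm]])
    then have Ck: "C_k_on k d B' C"
      by (rule C_k_on_blinfun_inverse[OF B'(3), of k "\<lambda>a. A (s a)" C 2]) (simp_all add: C)
    show ?case
    proof (rule C_k_on_SucI[OF B'(3)])
      show "(s has_derivative s' a) (at a within RR d)" if "a \<in> B'" for a
        using s' that B' by blast
      fix b assume b: "b \<in> RR d"
      have "C_k_on k d B' (dir_deriv b (\<lambda>a. \<phi> (s a)))"
        by (rule smooth_on_C_k[OF smooth_on_subset[OF smooth_on_dir_deriv[OF \<phi>s b] B'(2)]])
      then have "C_k_on k d B' (\<lambda>a. lam (C a (dir_deriv b (\<lambda>a. \<phi> (s a)) a)))"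
        by (intro C_k_on_bounded_linear[OF B'(3) lam(1)] C_k_on_bilinear[OF B'(3) bounded_bilinear_blinfun_apply Ck])
      then show "C_k_on k d B' (\<lambda>a. s' a b)"
        using C_k_on_cong[OF B'(3), of "\<lambda>a. s' a b"] s'eq[OF _ b] by (metis (mono_tags, lifting))
    qed
  qed
  then show ?thesis using B' unfolding smooth_on_def by blast
qed

text \<open>The hypothesis \<open>degenerate\<close> says that \<open>(z, t) \<mapsto> \<phi> z + t y\<^sub>a z\<close>, with \<open>y\<^sub>a = \<Sum>\<^sub>i a\<^sub>i y\<^sub>i\<close>, nowhere
  has rank \<open>n + 1\<close>. Where its rank is \<open>n\<close>, the kernel of its differential is transverse to the slices
  \<open>t = const\<close>, so \<open>\<phi> z0 + y\<^sub>a z0\<close> can be carried along the kernel curve to a point of the slice \<open>t = 0\<close>.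
  That curve is obtained from the inverse function theorem, as the curve on which the component of
  \<open>\<phi> z + t y\<^sub>a z\<close> along the image of \<open>d\<phi> z0\<close> is constant.\<close>

lemma lines_in_image:
  fixes \<phi> :: "seqs \<Rightarrow> 'u::euclidean_space" and y :: "nat \<Rightarrow> seqs \<Rightarrow> 'u"
  assumes Om: "open_RR n Om" and z0: "z0 \<in> Om"
    and \<phi>: "smooth_on n Om \<phi>" and y: "\<And>i. i < d \<Longrightarrow> smooth_on n Om (y i)"
    and ind: "lin_indep n (\<lambda>j. dir_deriv (unit_seq j) \<phi> z0)" and indy: "lin_indep d (\<lambda>i. y i z0)"
    and degenerate: "\<And>z a. z \<in> Om \<Longrightarrow> \<exists>u\<in>RR n. \<exists>r. (u \<noteq> 0 \<or> r \<noteq> 0) \<and>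
       deriv_at n \<phi> z u + (\<Sum>i<d. a i *\<^sub>R deriv_at n (y i) z u) + r *\<^sub>R (\<Sum>i<d. a i *\<^sub>R y i z) = 0"
  shows "\<exists>B s. open_RR d B \<and> 0 \<in> B \<and> smooth_on d B s \<and> s ` B \<subseteq> Om \<and> s 0 = z0 \<and>
    (\<forall>a\<in>B. \<phi> (s a) = \<phi> z0 + (\<Sum>i<d. apply_bcontfun a i *\<^sub>R y i z0))"
proof -
  obtain lam where lam: "bounded_linear lam" "\<And>u. lam u \<in> RR n"
    "\<And>v. v \<in> RR n \<Longrightarrow> lam (deriv_at n \<phi> z0 v) = v"
    using linear_left_inverse_RR[OF ind] unfolding deriv_at_def[abs_def] by blast
  obtain \<alpha> where \<alpha>: "\<And>i. bounded_linear (\<alpha> i)"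
    "\<And>i j. i < d \<Longrightarrow> j < d \<Longrightarrow> \<alpha> i (y j z0) = (if j = i then 1 else (0::real))"
    using lin_indep_dual[OF indy] by metis
  interpret lam: bounded_linear lam by fact
  interpret d0: bounded_linear "deriv_at n \<phi> z0" by (rule bounded_linear_deriv_at)
  have dlin: "linear (deriv_at n g z)" for g :: "seqs \<Rightarrow> 'u" and z
    by (rule bounded_linear.linear[OF bounded_linear_deriv_at])
  have \<alpha>lin: "linear (\<alpha> i)" for i by (rule bounded_linear.linear[OF \<alpha>(1)])
  have z0R: "z0 \<in> RR n" using Om z0 open_RR_subset by blast
  \<comment> \<open>The projection onto the image of the differential at \<open>z0\<close> along the
    kernel of \<open>lam\<close>.\<close>
  define P where "P u = deriv_at n \<phi> z0 (lam u)" for u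
  have Pbl: "bounded_linear P"
    unfolding P_def[abs_def] by (rule bounded_linear_compose[OF bounded_linear_deriv_at lam(1)])
  interpret P: bounded_linear P by fact
  have lamP: "lam (P u) = lam u" for u unfolding P_def using lam(3)[OF lam(2)] .
  have PP: "P (P u) = P u" for u using lamP by (metis P_def)
  \<comment> \<open>A coefficient vector is encoded as an ambient vector \<open>w\<close>, decoded
    by the dual functionals of the \<open>y i z0\<close>. The parameter space thus becomes the
    Euclidean target type.\<close>
  define Y where "Y w z = (\<Sum>i<d. \<alpha> i w *\<^sub>R y i z)" for w z
  \<comment> \<open>Base points are read off from the first component through \<open>lam\<close>
    alone; its kernel directions are idle and serve only to make the domain a Euclidean
    space.\<close>
  define Z where "Z x = z0 + lam (fst x)" for x :: "'u \<times> 'u"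
  define \<Omega> where "\<Omega> = {x. Z x \<in> Om}"
  have ZR: "Z x \<in> RR n" for x unfolding Z_def by (intro RR_intros z0R lam)
  have Zder: "(Z has_derivative (\<lambda>x'. lam (fst x'))) (at x within S)" for x S
    unfolding Z_def[abs_def] by (auto intro!: derivative_eq_intros lam.has_derivative)
  have Zcont: "continuous_on S Z" for S
    using Zder has_derivative_continuous unfolding continuous_on_eq_continuous_within by metis
  obtain T where T: "open T" "Om = RR n \<inter> T" using Om unfolding openin_open by blast
  have "\<Omega> = Z -` T" using ZR T(2) by (auto simp: \<Omega>_def)
  then have op\<Omega>: "open \<Omega>" using open_vimage[OF T(1) Zcont] by simp
  have Z00: "Z (0, w) = z0" for w by (simp add: Z_def lam.zero)
  have Zsm: "((\<lambda>x. g (Z x)) has_derivative (\<lambda>x'. deriv_at n g (Z x) (lam (fst x')))) (at x)"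
    if "smooth_on n Om g" "x \<in> \<Omega>" for g :: "seqs \<Rightarrow> 'u" and x
  proof -
    have "(g has_derivative deriv_at n g (Z x)) (at (Z x) within range Z)"
      using smooth_on_has_derivative[OF that(1) Om, of "Z x"] that(2) ZR
      by (auto simp: \<Omega>_def intro: has_derivative_subset)
    then show ?thesis using diff_chain_within[OF Zder[of x UNIV]] by (simp add: o_def)
  qed
  have Zcont': "continuous_on \<Omega> (\<lambda>x. g (Z x))" if "smooth_on n Om g" for g :: "seqs \<Rightarrow> 'u"
    by (rule continuous_on_compose2[OF smooth_on_continuous[OF that] Zcont]) (auto simp: \<Omega>_def)
  define F' where "F' x u = deriv_at n \<phi> (Z x) u + (\<Sum>i<d. \<alpha> i (snd x) *\<^sub>R deriv_at n (y i) (Z x) u)" for x u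
  \<comment> \<open>Idle directions and the parameter are kept; the remaining part of the first
    component is replaced by the component of the displaced point along the image of the
    differential at \<open>z0\<close>. Level curves of the first component of \<open>\<Psi>\<close>
    are the kernel curves.\<close>
  define \<Psi> where "\<Psi> x = (fst x - P (fst x) + P (\<phi> (Z x) - \<phi> z0 + Y (snd x) (Z x)), snd x)" for x
  define d\<Psi> where "d\<Psi> x x' = (fst x' - P (fst x') + P (F' x (lam (fst x')) + Y (snd x') (Z x)), snd x')" for x x'
  have der: "(\<Psi> has_derivative d\<Psi> x) (at x)" if x: "x \<in> \<Omega>" for x
  proof -
    have "((\<lambda>x. \<phi> (Z x) - \<phi> z0 + Y (snd x) (Z x)) has_derivative (\<lambda>x'. deriv_at n \<phi> (Z x) (lam (fst x')) - 0 +
        (\<Sum>i<d. \<alpha> i (snd x) *\<^sub>R deriv_at n (y i) (Z x) (lam (fst x')) + \<alpha> i (snd x') *\<^sub>R y i (Z x)))) (at x)"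
      unfolding Y_def
      by (intro has_derivative_add has_derivative_diff has_derivative_const Zsm[OF \<phi> x] has_derivative_sum
          has_derivative_scaleR bounded_linear.has_derivative[OF \<alpha>(1) has_derivative_snd[OF has_derivative_ident]] Zsm[OF y x]) auto
    then have "((\<lambda>x. \<phi> (Z x) - \<phi> z0 + Y (snd x) (Z x)) has_derivative (\<lambda>x'. F' x (lam (fst x')) + Y (snd x') (Z x))) (at x)"
      by (simp add: F'_def Y_def sum.distrib add.assoc)
    from P.has_derivative[OF this] show ?thesis
      unfolding \<Psi>_def[abs_def] d\<Psi>_def[abs_def]
      by (intro has_derivative_Pair has_derivative_add[of "\<lambda>x. fst x - P (fst x)"] has_derivative_diff
          P.has_derivative[of fst] has_derivative_fst has_derivative_snd has_derivative_ident)
  qed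
  define f' where "f' x = Blinfun (d\<Psi> x)" for x
  have f': "blinfun_apply (f' x) = d\<Psi> x" if "x \<in> \<Omega>" for x
    unfolding f'_def using der[OF that] has_derivative_bounded_linear bounded_linear_Blinfun_apply by blast
  have derf: "(\<Psi> has_derivative blinfun_apply (f' x)) (at x)" if "x \<in> \<Omega>" for x
    using der[OF that] f'[OF that] by simp
  have contf: "continuous_on \<Omega> f'"
  proof (rule continuous_on_blinfun_componentwise)
    fix i :: "'u \<times> 'u" assume "i \<in> Basis"
    have dd: "continuous_on \<Omega> (\<lambda>x. deriv_at n g (Z x) v)" if "smooth_on n Om g" for g :: "seqs \<Rightarrow> 'u" and v
      using Zcont'[OF smooth_on_dir_deriv[OF that RR_unit_seq]]
      unfolding deriv_at_def by (auto intro!: continuous_intros)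
    have "continuous_on \<Omega> (\<lambda>x. d\<Psi> x i)"
      unfolding d\<Psi>_def F'_def Y_def
      by (intro continuous_on_Pair continuous_on_add continuous_on_diff continuous_on_const P.continuous_on continuous_on_sum
          continuous_on_scaleR dd[OF \<phi>] dd[OF y] Zcont'[OF y] bounded_linear.continuous_on[OF \<alpha>(1)]
          continuous_on_snd continuous_on_id) auto
    then show "continuous_on \<Omega> (\<lambda>x. blinfun_apply (f' x) i)"
      using f' by (simp cong: continuous_on_cong)
  qed
  have 0: "(0, 0) \<in> \<Omega>" using z0 Z00 by (simp add: \<Omega>_def)
  have Y0: "Y 0 z = 0" for z by (simp add: Y_def linear_0[OF \<alpha>lin])
  have YP: "bounded_linear (\<lambda>w. P (Y w z0))"
    unfolding Y_def by (intro bounded_linear_compose[OF Pbl] bounded_linear_sum bounded_linear_scaleR_const \<alpha>)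
  \<comment> \<open>At the origin the derivative of \<open>\<Psi>\<close> is the shear adding
    \<open>P (Y w z0)\<close>; its inverse subtracts the same term.\<close>
  define invf where "invf = Blinfun (\<lambda>x. (fst x - P (Y (snd x) z0), snd x))"
  have invf_app: "blinfun_apply invf = (\<lambda>x. (fst x - P (Y (snd x) z0), snd x))"
    unfolding invf_def
    by (intro bounded_linear_Blinfun_apply bounded_linear_Pair bounded_linear_sub bounded_linear_fst bounded_linear_snd
        bounded_linear_compose[OF YP bounded_linear_snd])
  have "d\<Psi> (0, 0) x = (fst x + P (Y (snd x) z0), snd x)" for x
    by (simp add: d\<Psi>_def F'_def Z00 linear_0[OF \<alpha>lin] P.add PP flip: P_def)
  then have inv: "invf o\<^sub>L f' (0, 0) = id_blinfun"
    by (intro blinfun_eqI) (simp add: f'[OF 0] invf_app)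
  obtain U' V g g' where UV: "open U'" "U' \<subseteq> \<Omega>" "(0, 0) \<in> U'" "open V" "\<Psi> (0, 0) \<in> V" "homeomorphism U' V \<Psi> g"
    "\<And>v. v \<in> V \<Longrightarrow> (g has_derivative (g' v)) (at v)"
    "\<And>v. v \<in> V \<Longrightarrow> bij (blinfun_apply (f' (g v)))"
    using inverse_function_theorem[OF op\<Omega> derf contf 0 inv] by metis
  have gU: "g v \<in> U'" "\<Psi> (g v) = v" if "v \<in> V" for v
    using UV(6) that unfolding homeomorphism_def by blast+
  have g\<Psi>: "g (\<Psi> x) = x" "\<Psi> x \<in> V" if "x \<in> U'" for x
    using UV(6) that unfolding homeomorphism_def by blast+
  have \<Psi>0: "\<Psi> (0, w) = (P (Y w z0), w)" for w by (simp add: \<Psi>_def Z00 P.zero)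
  have V0: "(0, 0) \<in> V" "g (0, 0) = (0, 0)" using UV(5) g\<Psi>(1)[OF UV(3)] by (simp_all add: \<Psi>0 Y0 P.zero)
  \<comment> \<open>Bijectivity of the derivative of \<open>\<Psi>\<close>, tested on vectors in the
    image of the differential at \<open>z0\<close>: the differential of the slice has rank
    \<open>n\<close>, even after composing with \<open>lam\<close>.\<close>
  have injF: "u = 0" if v: "v \<in> V" and u: "u \<in> RR n" "lam (F' (g v) u) = 0" for v u
  proof -
    have lamu: "lam (deriv_at n \<phi> z0 u) = u" by (rule lam(3)[OF u(1)])
    have "d\<Psi> (g v) (deriv_at n \<phi> z0 u, 0) = (0, 0)"
      using u(2) by (simp add: d\<Psi>_def lamu Y0) (simp add: P_def lamu d0.zero)
    moreover have "d\<Psi> (g v) (0, 0) = (0, 0)"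
      by (simp add: d\<Psi>_def lam.zero F'_def linear_0[OF dlin] Y0 P.zero)
    moreover have "g v \<in> \<Omega>" using gU(1)[OF v] UV(2) by blast
    then have "inj (d\<Psi> (g v))" using UV(8)[OF v] f' bij_is_inj by metis
    ultimately have "deriv_at n \<phi> z0 u = 0" using injD[of "d\<Psi> (g v)" "(deriv_at n \<phi> z0 u, 0)" "(0, 0)"] by simp
    then show "u = 0" using lamu lam.zero by simp
  qed
  \<comment> \<open>The degenerate direction must have \<open>r \<noteq> 0\<close>, for with
    \<open>r = 0\<close> it would be a nonzero kernel vector of an injective map. Division by
    \<open>r\<close> then writes \<open>Y\<close> as a derivative along the slice.\<close>
  have spanY: "\<exists>u\<in>RR n. Y (snd (g v)) (Z (g v)) = F' (g v) u" if v: "v \<in> V" for v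
  proof -
    have "Z (g v) \<in> Om" using gU(1)[OF v] UV(2) by (auto simp: \<Omega>_def)
    then obtain u r where ur: "u \<in> RR n" "u \<noteq> 0 \<or> r \<noteq> 0"
      "F' (g v) u + r *\<^sub>R Y (snd (g v)) (Z (g v)) = 0"
      using degenerate[of "Z (g v)" "\<lambda>i. \<alpha> i (snd (g v))"] unfolding F'_def Y_def by blast
    have "r \<noteq> 0"
      using ur injF[OF v ur(1)] lam.zero by auto
    have "linear (F' (g v))"
      unfolding F'_def by (intro linear_compose_add linear_compose_sum ballI linear_compose_scale_right dlin)
    then have "F' (g v) ((- 1 / r) *\<^sub>R u) = (- 1 / r) *\<^sub>R F' (g v) u" by (rule linear_cmul)
    also have "F' (g v) u = - (r *\<^sub>R Y (snd (g v)) (Z (g v)))" using ur(3) by (simp add: eq_neg_iff_add_eq_0)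
    finally have "F' (g v) ((- 1 / r) *\<^sub>R u) = Y (snd (g v)) (Z (g v))" using \<open>r \<noteq> 0\<close> by simp
    then show ?thesis using ur(1) RR_scaleR by metis
  qed
  \<comment> \<open>The path \<open>c\<close> in the image of \<open>\<Psi>\<close> moves only the
    parameter, from \<open>0\<close> to \<open>w\<close>. Its lift \<open>x\<close> ends at
    \<open>(0, w)\<close>, over \<open>z0\<close>, and starts at the sought base point. Along it the
    displaced point \<open>h\<close> is constant: \<open>lam\<close> does not see it move, and its
    velocity is a slice derivative, on which \<open>lam\<close> is injective.\<close>
  have key: "\<phi> (Z (g (P (Y w z0), 0))) = \<phi> z0 + Y w z0"
    if w: "(0, w) \<in> U'" and seg: "\<And>t. t \<in> {0..1} \<Longrightarrow> (P (Y w z0), t *\<^sub>R w) \<in> V" for w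
  proof -
    define c where "c t = (P (Y w z0), t *\<^sub>R w)" for t :: real
    define x where "x t = g (c t)" for t
    define h where "h t = \<phi> (Z (x t)) + Y (snd (x t)) (Z (x t))" for t
    have sx: "snd (x t) = t *\<^sub>R w" "lam (h t) = lam (\<phi> z0) + lam (P (Y w z0))" if "t \<in> {0..1}" for t
    proof -
      have *: "\<Psi> (x t) = c t" unfolding x_def c_def using gU(2)[OF seg[OF that]] .
      then show "snd (x t) = t *\<^sub>R w" by (simp add: \<Psi>_def c_def)
      have "lam (fst (x t) - P (fst (x t)) + P (\<phi> (Z (x t)) - \<phi> z0 + Y (snd (x t)) (Z (x t)))) = lam (P (Y w z0))"
        using arg_cong[OF *, of "\<lambda>x. lam (fst x)"] by (simp only: \<Psi>_def c_def fst_conv)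
      then have "lam (\<phi> (Z (x t)) - \<phi> z0 + Y (snd (x t)) (Z (x t))) = lam (P (Y w z0))"
        by (simp add: lam.add lam.diff lamP)
      then show "lam (h t) = lam (\<phi> z0) + lam (P (Y w z0))"
        by (simp add: h_def lam.add lam.diff algebra_simps)
    qed
    have xder: "\<exists>p' w'. (x has_derivative (\<lambda>s. s *\<^sub>R (p', w'))) (at t)" if "t \<in> {0..1}" for t
    proof -
      have "(c has_derivative (\<lambda>s. (0, s *\<^sub>R w))) (at t)"
        unfolding c_def[abs_def] by (auto intro!: derivative_eq_intros)
      then have "(x has_derivative (\<lambda>s. g' (c t) (0, s *\<^sub>R w))) (at t)"
        unfolding x_def using UV(7)[OF seg[OF that]] has_derivative_compose[of c "\<lambda>s. (0, s *\<^sub>R w)" t UNIV g "g' (c t)"]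
        by (simp add: c_def)
      moreover have "linear (g' (c t))" using UV(7)[OF seg[OF that]] has_derivative_linear c_def by metis
      then have "g' (c t) (0, s *\<^sub>R w) = s *\<^sub>R g' (c t) (0, w)" for s
        using linear_cmul[of "g' (c t)" s "(0, w)"] by simp
      ultimately have "(x has_derivative (\<lambda>s. s *\<^sub>R g' (c t) (0, w))) (at t)" by simp
      then show ?thesis by (metis surj_pair)
    qed
    have hder: "(h has_derivative (\<lambda>s. s *\<^sub>R (F' (x t) (lam p') + Y w' (Z (x t))))) (at t)"
      if t: "t \<in> {0..1}" and p': "(x has_derivative (\<lambda>s. s *\<^sub>R (p', w'))) (at t)" for t p' w'
    proof -
      have xt: "x t \<in> \<Omega>" unfolding x_def c_def using gU(1)[OF seg[OF t]] UV(2) by blast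
      have "((\<lambda>x. \<phi> (Z x) + Y (snd x) (Z x)) has_derivative (\<lambda>x'. deriv_at n \<phi> (Z (x t)) (lam (fst x')) +
        (\<Sum>i<d. \<alpha> i (snd (x t)) *\<^sub>R deriv_at n (y i) (Z (x t)) (lam (fst x')) + \<alpha> i (snd x') *\<^sub>R y i (Z (x t))))) (at (x t))"
        unfolding Y_def
        by (intro has_derivative_add Zsm[OF \<phi> xt] has_derivative_sum
          has_derivative_scaleR bounded_linear.has_derivative[OF \<alpha>(1) has_derivative_snd[OF has_derivative_ident]] Zsm[OF y xt]) auto
      then have "((\<lambda>x. \<phi> (Z x) + Y (snd x) (Z x)) has_derivative
          (\<lambda>x'. F' (x t) (lam (fst x')) + Y (snd x') (Z (x t)))) (at (x t))"
        by (simp add: F'_def Y_def sum.distrib add.assoc)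
      from has_derivative_compose[OF p' this]
      have "(h has_derivative (\<lambda>s. F' (x t) (lam (s *\<^sub>R p')) + Y (s *\<^sub>R w') (Z (x t)))) (at t)"
        by (simp add: h_def[abs_def])
      moreover have "F' (x t) (lam (s *\<^sub>R p')) + Y (s *\<^sub>R w') (Z (x t)) = s *\<^sub>R (F' (x t) (lam p') + Y w' (Z (x t)))" for s
        by (simp add: F'_def Y_def lam.scaleR linear_cmul[OF dlin] linear_cmul[OF \<alpha>lin] scaleR_add_right
            scaleR_sum_right mult.commute)
      ultimately show ?thesis by simp
    qed
    \<comment> \<open>The endpoints are left to continuity. At \<open>t = 0\<close> the degeneracy
      hypothesis concerns the zero combination and says nothing about \<open>Y w\<close>.\<close>
    have "h 1 = h 0"
    proof (rule has_derivative_zero_unique_strong_interval[of "{0, 1}" 0 1 h "h 0" 1])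
      show "continuous_on {0..1} h"
        unfolding continuous_on_eq_continuous_within
        using xder hder has_derivative_continuous has_derivative_at_withinI by metis
      fix t assume "t \<in> {0..1} - {0, 1::real}"
      then have t: "t \<in> {0..1}" "t \<noteq> 0" "0 < t" "t < 1" by auto
      obtain p' w' where p': "(x has_derivative (\<lambda>s. s *\<^sub>R (p', w'))) (at t)" using xder[OF t(1)] by blast
      let ?D = "F' (x t) (lam p') + Y w' (Z (x t))"
      note hd = hder[OF t(1) p']
      have ev: "\<forall>\<^sub>F s in nhds t. s \<in> {0..1}"
        using t by (intro eventually_nhds_in_open[of "{0<..<1}", THEN eventually_mono]) auto
      have "((\<lambda>s. s *\<^sub>R w) has_derivative (\<lambda>s. snd (s *\<^sub>R (p', w')))) (at t)"
        by (rule has_derivative_transform_eventually[OF has_derivative_snd[OF p']])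
           (use ev sx t in \<open>auto simp: eventually_at_filter elim: eventually_mono\<close>)
      moreover have "((\<lambda>s. s *\<^sub>R w) has_derivative (\<lambda>s. s *\<^sub>R w)) (at t)"
        by (auto intro!: derivative_eq_intros)
      ultimately have "(\<lambda>s. snd (s *\<^sub>R (p', w'))) = (\<lambda>s. s *\<^sub>R w)" using has_derivative_unique by blast
      from fun_cong[OF this, of 1] have w': "w' = w" by simp
      have "((\<lambda>s. lam (h s)) has_derivative (\<lambda>s. lam (s *\<^sub>R ?D))) (at t)" by (rule lam.has_derivative[OF hd])
      moreover have "((\<lambda>s. lam (h s)) has_derivative (\<lambda>s. 0)) (at t)"
        by (rule has_derivative_transform_eventually[OF has_derivative_const[of "lam (\<phi> z0) + lam (P (Y w z0))"]])
           (use ev sx t in \<open>auto simp: eventually_at_filter elim: eventually_mono\<close>)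
      ultimately have "(\<lambda>s. lam (s *\<^sub>R ?D)) = (\<lambda>s. 0)" using has_derivative_unique by blast
      from fun_cong[OF this, of 1] have lD: "lam ?D = 0" by simp
      obtain u where u: "u \<in> RR n" "Y (t *\<^sub>R w) (Z (x t)) = F' (x t) u"
        using spanY[OF seg[OF t(1)]] sx(1)[OF t(1)] unfolding x_def c_def by auto
      have linF: "linear (F' (x t))"
        unfolding F'_def by (intro linear_compose_add linear_compose_sum ballI linear_compose_scale_right dlin)
      have "Y (t *\<^sub>R w) (Z (x t)) = t *\<^sub>R Y w (Z (x t))"
        by (simp add: Y_def linear_cmul[OF \<alpha>lin] scaleR_sum_right)
      \<comment> \<open>Degeneracy is known for the scaled combination \<open>t *\<^sub>R w\<close>;
        the velocity involves \<open>w\<close> itself.\<close>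
      then have "Y w (Z (x t)) = (1 / t) *\<^sub>R F' (x t) u" using u(2) t(2) by (metis divide_inverse_commute mult.right_neutral scaleR_cancel_left scaleR_one scaleR_scaleR right_inverse inverse_eq_divide)
      then have "?D = F' (x t) (lam p' + (1 / t) *\<^sub>R u)"
        by (simp add: w' linear_add[OF linF] linear_cmul[OF linF])
      moreover have "lam p' + (1 / t) *\<^sub>R u \<in> RR n" by (intro RR_intros lam u)
      ultimately have "?D = F' (x t) 0"
        using injF[OF seg[OF t(1)], of "lam p' + (1 / t) *\<^sub>R u"] lD unfolding x_def c_def by simp
      then have "?D = 0" using linear_0[OF linF] by simp
      then show "(h has_derivative (\<lambda>h. 0)) (at t within {0..1})"
        using hd has_derivative_at_withinI by simp
    qed auto
    moreover have "x 1 = (0, w)" using g\<Psi>(1)[OF w] by (simp add: x_def c_def \<Psi>0)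
    then have "h 1 = \<phi> z0 + Y w z0" by (simp add: h_def Z00)
    moreover have "h 0 = \<phi> (Z (g (P (Y w z0), 0)))"
      using sx(1)[of 0] by (simp add: h_def Y0) (simp add: x_def c_def)
    ultimately show ?thesis by simp
  qed
  define W where "W a = (\<Sum>i<d. apply_bcontfun a i *\<^sub>R y i z0)" for a
  have Wbl: "bounded_linear W"
    unfolding W_def by (intro bounded_linear_sum bounded_linear_scaleR_const bounded_linear_coord)
  \<comment> \<open>Only vectors in the span of the \<open>y i z0\<close> are reproduced by
    \<open>Y _ z0\<close>; the parameters are now restricted to these.\<close>
  have YW: "Y (W a) z0 = W a" for a
  proof -
    have "\<alpha> i (W a) = apply_bcontfun a i" if "i < d" for i
    proof -
      have "\<alpha> i (W a) = (\<Sum>j<d. apply_bcontfun a j *\<^sub>R \<alpha> i (y j z0))"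
        unfolding W_def by (simp add: linear_sum[OF \<alpha>lin] linear_cmul[OF \<alpha>lin])
      also have "\<dots> = (\<Sum>j<d. if j = i then apply_bcontfun a j else 0)"
        using that by (intro sum.cong) (auto simp: \<alpha>(2))
      finally show ?thesis using that by simp
    qed
    then show ?thesis by (simp add: Y_def W_def)
  qed
  define q where "q a = P (W a)" for a
  have qbl: "bounded_linear q" unfolding q_def[abs_def] by (rule bounded_linear_compose[OF Pbl Wbl])
  define s where "s a = Z (g (q a, 0))" for a
  have "open (U' \<inter> V)" "(0, 0) \<in> U' \<inter> V" using UV V0 by auto
  then obtain \<rho> where \<rho>: "\<rho> > 0" "ball (0, 0) \<rho> \<subseteq> U' \<inter> V" using open_contains_ball by metis
  obtain K1 where K1: "K1 > 0" "\<And>a. norm (q a) \<le> norm a * K1" using bounded_linear.pos_bounded[OF qbl] by blast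
  obtain K2 where K2: "K2 > 0" "\<And>a. norm (W a) \<le> norm a * K2" using bounded_linear.pos_bounded[OF Wbl] by blast
  \<comment> \<open>For \<open>norm a < e\<close> the sum of the norms of \<open>q a\<close> and
    \<open>W a\<close> stays below \<open>\<rho>\<close>.\<close>
  define e where "e = \<rho> / (K1 + K2)"
  have e: "e > 0" using \<rho> K1 K2 by (simp add: e_def)
  define B where "B = RR d \<inter> ball 0 e"
  have B: "open_RR d B" "0 \<in> B" using e by (auto simp: B_def RR_0 intro: openin_open_Int)
  \<comment> \<open>Stated for a general \<open>q'\<close> to cover both uses: \<open>q' = 0\<close>
    puts the endpoint \<open>(0, W a)\<close> into \<open>U'\<close>, and \<open>q' = q a\<close>
    puts the whole path into \<open>V\<close>.\<close>
  have near: "(q', t *\<^sub>R W a) \<in> U' \<inter> V" if "a \<in> B" "t \<in> {0..1}" "norm q' \<le> norm (q a)" for a t q'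
  proof -
    have "norm (q', t *\<^sub>R W a) \<le> norm q' + norm (t *\<^sub>R W a)" by (rule norm_Pair_le)
    also have "\<dots> \<le> norm a * K1 + norm a * K2"
    proof (rule add_mono)
      show "norm q' \<le> norm a * K1" using that(3) K1(2)[of a] by linarith
      have "norm (t *\<^sub>R W a) \<le> norm (W a)" using that(2) by (simp add: mult_left_le_one_le)
      then show "norm (t *\<^sub>R W a) \<le> norm a * K2" using K2(2)[of a] by linarith
    qed
    also have "\<dots> = norm a * (K1 + K2)" by (simp add: distrib_left)
    also have "\<dots> < e * (K1 + K2)" using that(1) K1 K2 by (intro mult_strict_right_mono) (auto simp: B_def)
    also have "\<dots> = \<rho>" using K1 K2 by (simp add: e_def)
    finally have "(q', t *\<^sub>R W a) \<in> ball (0, 0) \<rho>" unfolding zero_prod_def[symmetric] by simp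
    then show ?thesis using \<rho>(2) by blast
  qed
  have q0: "(q a, 0) \<in> V" if "a \<in> B" for a using near[OF that, of 0 "q a"] by simp
  have sO: "s ` B \<subseteq> Om"
    using gU(1)[OF q0] UV(2) by (auto simp: s_def \<Omega>_def)
  have \<phi>s: "\<phi> (s a) = \<phi> z0 + W a" if a: "a \<in> B" for a
    using key[of "W a"] near[OF a, of 1 0] near[OF a, of _ "q a"] unfolding YW s_def q_def by auto
  have s0: "s 0 = z0" using V0 Z00 by (simp add: s_def bounded_linear.linear[OF qbl] linear_0)
  have s': "(s has_derivative (\<lambda>b. lam (fst (g' (q a, 0) (q b, 0))))) (at a within RR d)" if a: "a \<in> B" for a
  proof -
    have "((\<lambda>a. (q a, 0)) has_derivative (\<lambda>b. (q b, 0))) (at a within RR d)"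
      by (intro has_derivative_Pair has_derivative_const bounded_linear_imp_has_derivative qbl)
    from has_derivative_compose[OF this UV(7)[OF q0[OF a]]]
    have "((\<lambda>a. g (q a, 0)) has_derivative (\<lambda>b. g' (q a, 0) (q b, 0))) (at a within RR d)" .
    from has_derivative_compose[OF this Zder[of _ UNIV]]
    show ?thesis by (simp add: s_def[abs_def])
  qed
  \<comment> \<open>The inverse \<open>g\<close> is known to be differentiable only, but
    \<open>\<phi> \<circ> s\<close> is affine, so the lift can be smoothed.\<close>
  have "smooth_on d B (\<lambda>a. \<phi> z0 + W a)" by (rule smooth_on_affine[OF B(1) Wbl])
  then have "smooth_on d B (\<lambda>a. \<phi> (s a))"
    using smooth_on_cong[OF B(1), of "\<lambda>a. \<phi> z0 + W a" "\<lambda>a. \<phi> (s a)"] \<phi>s by simp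
  from smooth_lift[OF Om \<phi> z0 ind B(1) B(2) s0 sO s' this]
  obtain B' where B': "0 \<in> B'" "B' \<subseteq> B" "open_RR d B'" "smooth_on d B' s" by blast
  have "s ` B' \<subseteq> Om" using sO B'(2) by blast
  moreover have "\<forall>a\<in>B'. \<phi> (s a) = \<phi> z0 + (\<Sum>i<d. apply_bcontfun a i *\<^sub>R y i z0)"
    using \<phi>s B'(2) unfolding W_def by blast
  ultimately show ?thesis using B' s0 by blast
qed

section \<open>Smooth functions and tangent vectors\<close>

locale smooth_mfd =
  fixes M :: "'a mfd"
  assumes smooth: "smooth_manifold M"

locale mfd_chart = smooth_mfd +
  fixes V :: "'a set" and c :: "'a \<Rightarrow> seqs"
  assumes chart: "(V, c) \<in> mcharts M"
begin

abbreviation m where "m \<equiv> mdim M"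
abbreviation ci where "ci \<equiv> inv_into V c"

lemma chart_props:
  "openin (mtop M) V" "open_RR m (c ` V)" "homeomorphic_map (subtopology (mtop M) V) (top_of_set (c ` V)) c"
  using smooth chart unfolding smooth_manifold_def by fast+

lemma V_subset: "V \<subseteq> points M"
  using chart_props(1) by (rule openin_subset)

lemma inj_c: "inj_on c V"
  using homeomorphic_imp_injective_map[OF chart_props(3)] V_subset by (simp add: Int_absorb1)

lemma ci_c [simp]: "x \<in> V \<Longrightarrow> ci (c x) = x"
  by (rule inv_into_f_f[OF inj_c])

lemma c_ci [simp]: "z \<in> c ` V \<Longrightarrow> c (ci z) = z"
  by (rule f_inv_into_f)

lemma ci_in: "z \<in> c ` V \<Longrightarrow> ci z \<in> V"
  by (rule inv_into_into)

lemma ci_image: "U \<subseteq> V \<Longrightarrow> z \<in> c ` U \<Longrightarrow> ci z \<in> U"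
  by auto

lemma open_image:
  assumes "openin (mtop M) U" "U \<subseteq> V"
  shows "open_RR m (c ` U)"
proof -
  have "openin (subtopology (mtop M) V) U"
    using assms by (simp add: openin_open_subtopology chart_props(1))
  then have "openin (top_of_set (c ` V)) (c ` U)"
    using homeomorphic_imp_open_map[OF chart_props(3)] unfolding open_map_def by blast
  then show ?thesis using chart_props(2) openin_trans by blast
qed

lemma open_image_Int: "openin (mtop M) U \<Longrightarrow> open_RR m (c ` (V \<inter> U))"
  by (rule open_image) (auto intro: openin_Int chart_props)

lemma open_preimage:
  assumes "open_RR m Z" "Z \<subseteq> c ` V"
  shows "openin (mtop M) {x \<in> V. c x \<in> Z}"
proof -
  have "openin (top_of_set (c ` V)) Z"
    by (rule openin_subset_trans[OF assms openin_imp_subset[OF chart_props(2)]])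
  then have "openin (subtopology (mtop M) V) {x \<in> topspace (subtopology (mtop M) V). c x \<in> Z}"
    using homeomorphic_imp_continuous_map[OF chart_props(3)] openin_continuous_map_preimage by blast
  then have "openin (subtopology (mtop M) V) {x \<in> V. c x \<in> Z}"
    using V_subset by (simp add: Int_absorb1)
  then show ?thesis using openin_trans_full chart_props(1) by blast
qed

lemma smooth_fun_chart: "smooth_fun M U g \<Longrightarrow> smooth_on m (c ` (V \<inter> U)) (\<lambda>z. g (ci z))"
  using chart unfolding smooth_fun_def comp_def by fastforce

lemma transition:
  assumes "(W, d) \<in> mcharts M"
  shows "smooth_on m (c ` (V \<inter> W)) (\<lambda>z. d (ci z))"
proof -
  have "\<forall>p\<in>mcharts M. \<forall>q\<in>mcharts M. smooth_on (mdim M) (snd p ` (fst p \<inter> fst q)) (snd q \<circ> inv_into (fst p) (snd p))"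
    using smooth unfolding smooth_manifold_def case_prod_beta by (elim conjE)
  from this[rule_format, OF chart assms] show ?thesis by (simp add: comp_def)
qed

end

lemma smooth_fun_openin: "smooth_fun M U g \<Longrightarrow> openin (mtop M) U"
  by (simp add: smooth_fun_def)

context smooth_mfd
begin

lemma mfd_chartI: "(V, c) \<in> mcharts M \<Longrightarrow> mfd_chart M V c"
  by unfold_locales

lemma ex_chart:
  assumes "x \<in> points M"
  obtains V c where "mfd_chart M V c" "x \<in> V"
proof -
  have "(\<Union>(V, c)\<in>mcharts M. V) = points M" using smooth unfolding smooth_manifold_def by (elim conjE)
  then have "x \<in> (\<Union>(V, c)\<in>mcharts M. V)" using assms by simp
  then obtain V c where "(V, c) \<in> mcharts M" "x \<in> V" by auto
  then show ?thesis using that[OF mfd_chartI] by simp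
qed

lemma smooth_funI:
  assumes "openin (mtop M) U" "\<And>V c. mfd_chart M V c \<Longrightarrow> smooth_on (mdim M) (c ` (V \<inter> U)) (\<lambda>z. g (inv_into V c z))"
  shows "smooth_fun M U g"
  unfolding smooth_fun_def
proof (intro conjI assms(1) ballI, clarify)
  fix V c assume "(V, c) \<in> mcharts M"
  from assms(2)[OF mfd_chartI[OF this]]
  show "smooth_on (mdim M) (c ` (V \<inter> U)) (g \<circ> inv_into V c)" by (simp add: comp_def)
qed

lemma smooth_fun_cong:
  assumes "\<And>x. x \<in> U \<Longrightarrow> g x = h x" "smooth_fun M U g"
  shows "smooth_fun M U h"
proof (rule smooth_funI)
  show o: "openin (mtop M) U" by (rule smooth_fun_openin[OF assms(2)])
  fix V c assume "mfd_chart M V c"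
  then interpret mfd_chart M V c .
  have "g (ci z) = h (ci z)" if "z \<in> c ` (V \<inter> U)" for z
    using assms(1) ci_image[OF _ that] by blast
  then show "smooth_on (mdim M) (c ` (V \<inter> U)) (\<lambda>z. h (inv_into V c z))"
    using smooth_on_cong[OF open_image_Int[OF o], of "\<lambda>z. g (ci z)" "\<lambda>z. h (ci z)"] smooth_fun_chart[OF assms(2)] by simp
qed

lemma smooth_fun_subset:
  assumes "smooth_fun M U g" "openin (mtop M) U'" "U' \<subseteq> U"
  shows "smooth_fun M U' g"
proof (rule smooth_funI[OF assms(2)])
  fix V c assume "mfd_chart M V c"
  then interpret mfd_chart M V c .
  show "smooth_on (mdim M) (c ` (V \<inter> U')) (\<lambda>z. g (inv_into V c z))"
    by (rule smooth_on_subset[OF smooth_fun_chart[OF assms(1)]]) (use assms(3) in blast)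
qed

lemma smooth_fun_const: "openin (mtop M) U \<Longrightarrow> smooth_fun M U (\<lambda>_. k)"
  by (rule smooth_funI) (auto intro: smooth_on_const mfd_chart.open_image_Int)

lemma smooth_fun_bounded_linear:
  assumes "bounded_linear T" "smooth_fun M U g"
  shows "smooth_fun M U (\<lambda>x. T (g x))"
  by (rule smooth_funI[OF smooth_fun_openin[OF assms(2)]],
      rule smooth_on_bounded_linear[OF mfd_chart.open_image_Int[OF _ smooth_fun_openin[OF assms(2)]] assms(1)
        mfd_chart.smooth_fun_chart[OF _ assms(2)]])

lemma smooth_fun_add:
  assumes "smooth_fun M U g" "smooth_fun M U h"
  shows "smooth_fun M U (\<lambda>x. g x + h x)"
  by (rule smooth_funI[OF smooth_fun_openin[OF assms(2)]],
      rule smooth_on_add[OF mfd_chart.open_image_Int[OF _ smooth_fun_openin[OF assms(2)]]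
        mfd_chart.smooth_fun_chart[OF _ assms(1)] mfd_chart.smooth_fun_chart[OF _ assms(2)]])

lemma smooth_fun_bilinear:
  assumes "bounded_bilinear B" "smooth_fun M U g" "smooth_fun M U h"
  shows "smooth_fun M U (\<lambda>x. B (g x) (h x))"
  by (rule smooth_funI[OF smooth_fun_openin[OF assms(2)]],
      rule smooth_on_bilinear[OF mfd_chart.open_image_Int[OF _ smooth_fun_openin[OF assms(2)]] assms(1)
        mfd_chart.smooth_fun_chart[OF _ assms(2)] mfd_chart.smooth_fun_chart[OF _ assms(3)]])

lemma smooth_fun_sum:
  assumes "openin (mtop M) U" "\<And>i. i \<in> A \<Longrightarrow> smooth_fun M U (g i)"
  shows "smooth_fun M U (\<lambda>x. \<Sum>i\<in>A. g i x)"
  using assms(2)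
proof (induction A rule: infinite_finite_induct)
  case (insert a A)
  then show ?case by (simp add: smooth_fun_add)
qed (auto intro: smooth_fun_const assms(1))

lemma smooth_fun_inner_const:
  fixes f :: "'a \<Rightarrow> 'v::euclidean_space"
  shows "smooth_fun M U f \<Longrightarrow> smooth_fun M U (\<lambda>x. f x \<bullet> b)"
  by (rule smooth_fun_bounded_linear[OF bounded_linear_inner_left])

lemma smooth_at_cong:
  assumes "openin (mtop M) U" "x \<in> U" "\<And>y. y \<in> U \<Longrightarrow> g y = h y" "smooth_at M x g"
  shows "smooth_at M x h"
proof -
  obtain W where W: "x \<in> W" "smooth_fun M W g" using assms(4) unfolding smooth_at_def by blast
  have "smooth_fun M (W \<inter> U) g"
    by (rule smooth_fun_subset[OF W(2)]) (auto intro: openin_Int assms smooth_fun_openin[OF W(2)])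
  then have "smooth_fun M (W \<inter> U) h" by (rule smooth_fun_cong[rotated]) (use assms(3) in auto)
  then show ?thesis unfolding smooth_at_def using W assms(2) by blast
qed

end

context mfd_chart
begin

text \<open>On a set inside one chart domain the other charts give the same information, since they
  differ by smooth transition maps.\<close>

lemma smooth_fun_chartI:
  assumes "openin (mtop M) U" "U \<subseteq> V" "smooth_on m (c ` U) (\<lambda>z. g (ci z))"
  shows "smooth_fun M U g"
proof (rule smooth_funI[OF assms(1)])
  fix W d assume W: "mfd_chart M W d"
  then interpret W: mfd_chart M W d .
  have t: "smooth_on m (d ` (W \<inter> U)) (\<lambda>z. c (W.ci z))"
    by (rule smooth_on_subset[OF W.transition[OF chart]]) (use assms(2) in blast)
  have "smooth_on m (d ` (W \<inter> U)) (\<lambda>z. g (ci (c (W.ci z))))"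
  proof (rule smooth_on_compose[OF W.open_image_Int[OF assms(1)] open_image[OF assms(1,2)] _ t assms(3)])
    show "(\<lambda>z. c (W.ci z)) ` d ` (W \<inter> U) \<subseteq> c ` U" by auto
  qed
  then show "smooth_on m (d ` (W \<inter> U)) (\<lambda>z. g (W.ci z))"
  proof (rule smooth_on_cong[OF W.open_image_Int[OF assms(1)], THEN iffD1, rotated])
    fix z assume "z \<in> d ` (W \<inter> U)"
    then show "g (ci (c (W.ci z))) = g (W.ci z)" using assms(2) by auto
  qed
qed

lemma smooth_fun_c: "smooth_fun M V c"
proof (rule smooth_fun_chartI[OF chart_props(1) subset_refl])
  have "smooth_on m (c ` V) (\<lambda>z. z)" by (rule smooth_on_linear[OF chart_props(2) bounded_linear_ident])
  then show "smooth_on m (c ` V) (\<lambda>z. c (ci z))"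
    by (rule smooth_on_cong[OF chart_props(2), THEN iffD1, rotated]) simp
qed

lemma smooth_fun_coord: "smooth_fun M V (\<lambda>x. apply_bcontfun (c x) i)"
  by (rule smooth_fun_bounded_linear[OF bounded_linear_coord smooth_fun_c])

lemma chart_vector_apply:
  assumes g: "smooth_fun M U g" and x: "x \<in> U" "x \<in> V" and a: "a \<in> RR m"
  shows "chart_vector M (V, c) x a g = deriv_at m (\<lambda>z. g (ci z)) (c x) a"
proof -
  have "smooth_at M x g" unfolding smooth_at_def using g x by blast
  moreover have "dir_deriv a (\<lambda>z. g (ci z)) (c x) = deriv_at m (\<lambda>z. g (ci z)) (c x) a"
    by (rule smooth_on_dir_deriv_eq[OF smooth_fun_chart[OF g] open_image_Int[OF smooth_fun_openin[OF g]] _ a])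
       (use x in blast)
  ultimately show ?thesis by (simp add: chart_vector_def comp_def)
qed

text \<open>The components transform by the derivative of the transition map. The equality holds for
  the functionals on all functions, because both sides are \<open>0\<close> on functions not smooth
  near \<open>x\<close>.\<close>

lemma chart_vector_change:
  assumes W: "mfd_chart M W d" and x: "x \<in> V" "x \<in> W" and b: "b \<in> RR m"
  shows "chart_vector M (W, d) x b = chart_vector M (V, c) x (deriv_at m (\<lambda>z. c (inv_into W d z)) (d x) b)"
    and "deriv_at m (\<lambda>z. c (inv_into W d z)) (d x) b \<in> RR m"
proof -
  interpret W: mfd_chart M W d by fact
  have o: "open_RR m (d ` (W \<inter> V))" by (rule W.open_image_Int[OF chart_props(1)])
  have t: "smooth_on m (d ` (W \<inter> V)) (\<lambda>z. c (W.ci z))" by (rule W.transition[OF chart])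
  have dx: "d x \<in> d ` (W \<inter> V)" using x by blast
  have im: "(\<lambda>z. c (W.ci z)) ` d ` (W \<inter> V) \<subseteq> RR m"
    using openin_imp_subset[OF chart_props(2)] by auto
  show b': "deriv_at m (\<lambda>z. c (inv_into W d z)) (d x) b \<in> RR m" (is "?b \<in> _")
    by (rule deriv_at_in_RR[OF t o dx im b])
  show "chart_vector M (W, d) x b = chart_vector M (V, c) x ?b"
  proof
    fix g
    show "chart_vector M (W, d) x b g = chart_vector M (V, c) x ?b g"
    proof (cases "smooth_at M x g")
      case True
      then obtain U where U: "x \<in> U" "smooth_fun M U g" unfolding smooth_at_def by blast
      note oU = smooth_fun_openin[OF U(2)]
      have o2: "open_RR m (d ` (W \<inter> (V \<inter> U)))" by (rule W.open_image_Int) (intro openin_Int chart_props oU)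
      have dx2: "d x \<in> d ` (W \<inter> (V \<inter> U))" using x U by blast
      have t2: "smooth_on m (d ` (W \<inter> (V \<inter> U))) (\<lambda>z. c (W.ci z))"
        by (rule smooth_on_subset[OF t]) blast
      have "deriv_at m (\<lambda>z. g (W.ci z)) (d x) b = deriv_at m (\<lambda>z. g (ci (c (W.ci z)))) (d x) b"
        by (rule deriv_at_cong_open[OF o2 dx2]) auto
      also have "\<dots> = deriv_at m (\<lambda>z. g (ci z)) (c (W.ci (d x))) ?b"
        by (rule deriv_at_compose[OF o2 open_image_Int[OF oU] _ t2 smooth_fun_chart[OF U(2)] dx2 b]) auto
      also have "c (W.ci (d x)) = c x" using x by simp
      finally show ?thesis
        using W.chart_vector_apply[OF U(2,1) x(2) b] chart_vector_apply[OF U(2,1) x(1) b'] by simp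
    next
      case False
      then show ?thesis by (simp add: chart_vector_def)
    qed
  qed
qed

lemma tangent_space_eq:
  assumes "x \<in> V"
  shows "tangent_space M x = chart_vector M (V, c) x ` RR m"
proof
  show "chart_vector M (V, c) x ` RR m \<subseteq> tangent_space M x"
    unfolding tangent_space_def using chart assms by blast
  show "tangent_space M x \<subseteq> chart_vector M (V, c) x ` RR m"
  proof
    fix X assume "X \<in> tangent_space M x"
    then obtain W d b where "(W, d) \<in> mcharts M" "x \<in> W" "b \<in> RR m" "X = chart_vector M (W, d) x b"
      unfolding tangent_space_def by blast
    then show "X \<in> chart_vector M (V, c) x ` RR m"
      using chart_vector_change[OF mfd_chartI _ _, of W d x b] assms by blast
  qed
qed

lemma chart_vector_in: "x \<in> V \<Longrightarrow> a \<in> RR m \<Longrightarrow> chart_vector M (V, c) x a \<in> tangent_space M x"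
  using tangent_space_eq by blast

lemma chart_vector_linear:
  assumes "x \<in> V" "a \<in> RR m" "b \<in> RR m"
  shows "chart_vector M (V, c) x (r *\<^sub>R a + s *\<^sub>R b) = (\<lambda>g. r * chart_vector M (V, c) x a g + s * chart_vector M (V, c) x b g)"
proof
  fix g
  show "chart_vector M (V, c) x (r *\<^sub>R a + s *\<^sub>R b) g = r * chart_vector M (V, c) x a g + s * chart_vector M (V, c) x b g"
  proof (cases "smooth_at M x g")
    case True
    then obtain U where U: "x \<in> U" "smooth_fun M U g" unfolding smooth_at_def by blast
    have l: "linear (deriv_at m (\<lambda>z. g (ci z)) (c x))" by (rule bounded_linear.linear[OF bounded_linear_deriv_at])
    have rs: "r *\<^sub>R a + s *\<^sub>R b \<in> RR m" using assms by (intro RR_intros)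
    show ?thesis
      unfolding chart_vector_apply[OF U(2,1) assms(1) rs] chart_vector_apply[OF U(2,1) assms(1,2)]
        chart_vector_apply[OF U(2,1) assms(1,3)] by (simp add: linear_add[OF l] linear_cmul[OF l])
  qed (simp add: chart_vector_def)
qed

lemma chart_vector_coord:
  assumes "x \<in> V" "a \<in> RR m"
  shows "chart_vector M (V, c) x a (\<lambda>x. apply_bcontfun (c x) i) = apply_bcontfun a i"
proof -
  have cx: "c x \<in> c ` V" "c x \<in> RR m" using assms open_RR_subset[OF chart_props(2)] by auto
  have "chart_vector M (V, c) x a (\<lambda>x. apply_bcontfun (c x) i) = deriv_at m (\<lambda>z. apply_bcontfun (c (ci z)) i) (c x) a"
    by (rule chart_vector_apply[OF smooth_fun_coord assms(1,1,2)])
  also have "\<dots> = deriv_at m (\<lambda>z. apply_bcontfun z i) (c x) a"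
    by (rule deriv_at_cong_open[OF chart_props(2) cx(1)]) simp
  also have "\<dots> = apply_bcontfun a i"
    by (rule deriv_at_eq[OF bounded_linear_imp_has_derivative[OF bounded_linear_coord] cx(2) assms(2)])
  finally show ?thesis .
qed

lemma chart_vector_inj:
  assumes "x \<in> V" "a \<in> RR m" "b \<in> RR m" "\<And>i. chart_vector M (V, c) x a (\<lambda>x. apply_bcontfun (c x) i) = chart_vector M (V, c) x b (\<lambda>x. apply_bcontfun (c x) i)"
  shows "a = b"
  by (rule RR_eqI[OF assms(2,3)]) (use assms(4) in \<open>simp add: chart_vector_coord[OF assms(1)] assms(2,3)\<close>)

lemma vderiv_chart_vector:
  fixes f :: "'a \<Rightarrow> 'v::euclidean_space"
  assumes f: "smooth_fun M U f" and x: "x \<in> U" "x \<in> V" and a: "a \<in> RR m"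
  shows "vderiv (chart_vector M (V, c) x a) f = deriv_at m (\<lambda>z. f (ci z)) (c x) a"
proof -
  have "chart_vector M (V, c) x a (\<lambda>y. f y \<bullet> b) = deriv_at m (\<lambda>z. f (ci z)) (c x) a \<bullet> b" for b
    unfolding chart_vector_apply[OF smooth_fun_inner_const[OF f] x a]
    by (rule deriv_at_bounded_linear[OF smooth_fun_chart[OF f] open_image_Int[OF smooth_fun_openin[OF f]] _ a
          bounded_linear_inner_left]) (use x in blast)
  then show ?thesis by (simp add: vderiv_def euclidean_representation)
qed

text \<open>Applying \<open>Y\<close> to the coordinate functions recovers its components, and they
  are smooth because a vector field sends smooth functions to smooth functions.\<close>

lemma vector_field_components:
  assumes Y: "vector_field M U Y"
  shows "\<exists>y. smooth_on m (c ` (V \<inter> U)) y \<and> y ` c ` (V \<inter> U) \<subseteq> RR m \<and>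
    (\<forall>x\<in>V \<inter> U. Y x = chart_vector M (V, c) x (y (c x)))"
proof -
  have oU: "openin (mtop M) U" and YT: "\<And>x. x \<in> U \<Longrightarrow> Y x \<in> tangent_space M x"
    using Y unfolding vector_field_def by blast+
  have oVU: "openin (mtop M) (V \<inter> U)" by (intro openin_Int chart_props oU)
  define y where "y z = (\<Sum>i<m. Y (ci z) (\<lambda>x. apply_bcontfun (c x) i) *\<^sub>R unit_seq i)" for z
  have yR: "y z \<in> RR m" for z unfolding y_def by (intro RR_intros) auto
  have "smooth_fun M (V \<inter> U) (\<lambda>x. Y x (\<lambda>x. apply_bcontfun (c x) i))" for i
    using Y smooth_fun_subset[OF smooth_fun_coord oVU] unfolding vector_field_def by blast
  from smooth_fun_chart[OF this]
  have sm: "smooth_on m (c ` (V \<inter> U)) (\<lambda>z. Y (ci z) (\<lambda>x. apply_bcontfun (c x) i))" for i by simp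
  show ?thesis
  proof (intro exI[of _ y] conjI ballI)
    show "smooth_on m (c ` (V \<inter> U)) y"
      unfolding y_def
      by (intro smooth_on_sum[OF open_image_Int[OF oU]]
          smooth_on_bounded_linear[OF open_image_Int[OF oU] bounded_linear_scaleR_left] sm)
    show "y ` c ` (V \<inter> U) \<subseteq> RR m" using yR by blast
    fix x assume "x \<in> V \<inter> U"
    then have x: "x \<in> V" "x \<in> U" by auto
    obtain a where a: "a \<in> RR m" "Y x = chart_vector M (V, c) x a"
      using YT[OF x(2)] tangent_space_eq[OF x(1)] by blast
    have "y (c x) = a"
      unfolding y_def using x(1) by (simp add: a(2) chart_vector_coord[OF x(1) a(1)] RR_expand[OF a(1)])
    then show "Y x = chart_vector M (V, c) x (y (c x))" using a(2) by simp
  qed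
qed

lemma vector_field_apply_smooth:
  assumes y: "smooth_on m (c ` U) y" "y ` c ` U \<subseteq> RR m" and U: "openin (mtop M) U" "U \<subseteq> V"
  shows "vector_field M U (\<lambda>x. chart_vector M (V, c) x (y (c x)))"
  unfolding vector_field_def
proof (intro conjI ballI allI impI U(1))
  fix x assume "x \<in> U"
  then show "chart_vector M (V, c) x (y (c x)) \<in> tangent_space M x"
    using U(2) y(2) by (intro chart_vector_in) auto
next
  fix W and g :: "'a \<Rightarrow> real" assume "W \<subseteq> U \<and> smooth_fun M W g"
  then have W: "W \<subseteq> U" "smooth_fun M W g" "W \<subseteq> V" using U(2) by blast+
  have oW: "openin (mtop M) W" by (rule smooth_fun_openin[OF W(2)])
  have VW: "V \<inter> W = W" using W(3) by blast
  have "smooth_on m (c ` W) (\<lambda>z. deriv_at m (\<lambda>z. g (ci z)) z (y z))"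
    by (rule smooth_on_deriv_at[OF open_image[OF oW W(3)] smooth_fun_chart[OF W(2), unfolded VW] smooth_on_subset[OF y(1)]])
       (use W(1) in blast)
  then have "smooth_on m (c ` W) (\<lambda>z. chart_vector M (V, c) (ci z) (y (c (ci z))) g)"
  proof (rule smooth_on_cong[OF open_image[OF oW W(3)], THEN iffD1, rotated])
    fix z assume "z \<in> c ` W"
    then obtain x where x: "x \<in> W" "z = c x" by blast
    then show "deriv_at m (\<lambda>z. g (ci z)) z (y z) = chart_vector M (V, c) (ci z) (y (c (ci z))) g"
      using W y(2) chart_vector_apply[OF W(2) x(1), of "y (c x)"] by (auto simp: subset_iff)
  qed
  then show "smooth_fun M W (\<lambda>x. chart_vector M (V, c) x (y (c x)) g)"
    by (rule smooth_fun_chartI[OF oW W(3)])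
qed

lemma const_vector_field: "a \<in> RR m \<Longrightarrow> vector_field M V (\<lambda>x. chart_vector M (V, c) x a)"
  using vector_field_apply_smooth[of V "\<lambda>_. a"] smooth_on_const[OF chart_props(2)] chart_props(1) by auto

end

section \<open>Extension, locality and differentiation rules for tangent vectors\<close>

lemma vector_fieldD:
  assumes "vector_field M U Y"
  shows "openin (mtop M) U" "y \<in> U \<Longrightarrow> Y y \<in> tangent_space M y"
    "W \<subseteq> U \<Longrightarrow> smooth_fun M W g \<Longrightarrow> smooth_fun M W (\<lambda>y. Y y g)"
  using assms unfolding vector_field_def by blast+

lemma vector_field_subset:
  "vector_field M U Y \<Longrightarrow> openin (mtop M) U' \<Longrightarrow> U' \<subseteq> U \<Longrightarrow> vector_field M U' Y"
  unfolding vector_field_def by (meson subset_trans subsetD)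

context smooth_mfd
begin

text \<open>Constant components in a chart extend a single vector to a field. This lets pointwise
  claims be tested by statements that quantify over vector fields.\<close>

lemma tangent_extend:
  assumes "x \<in> points M" "X \<in> tangent_space M x"
  obtains U Z where "x \<in> U" "vector_field M U Z" "Z x = X"
proof -
  obtain V c where Vc: "mfd_chart M V c" "x \<in> V" using ex_chart[OF assms(1)] .
  then interpret mfd_chart M V c by blast
  obtain a where "a \<in> RR m" "X = chart_vector M (V, c) x a" using assms(2) tangent_space_eq[OF Vc(2)] by blast
  then show ?thesis using that[OF Vc(2) const_vector_field] by blast
qed

lemma tangent_linear:
  assumes "x \<in> points M" "X \<in> tangent_space M x" "Y \<in> tangent_space M x"
  shows "(\<lambda>g. r * X g + s * Y g) \<in> tangent_space M x"
proof -
  obtain V c where Vc: "mfd_chart M V c" "x \<in> V" using ex_chart[OF assms(1)] .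
  then interpret mfd_chart M V c by blast
  obtain a b where "a \<in> RR m" "X = chart_vector M (V, c) x a" "b \<in> RR m" "Y = chart_vector M (V, c) x b"
    using assms(2,3) tangent_space_eq[OF Vc(2)] by blast
  then show ?thesis
    using chart_vector_linear[OF Vc(2), of a b r s] chart_vector_in[OF Vc(2) RR_add[OF RR_scaleR RR_scaleR], of a b r s] by simp
qed

lemma tangent_zero: "x \<in> points M \<Longrightarrow> (\<lambda>_. 0) \<in> tangent_space M x"
proof -
  assume x: "x \<in> points M"
  obtain V c where Vc: "mfd_chart M V c" "x \<in> V" using ex_chart[OF x] .
  then interpret mfd_chart M V c by blast
  have "chart_vector M (V, c) x 0 \<in> tangent_space M x" by (rule chart_vector_in[OF Vc(2) RR_0])
  from tangent_linear[OF x this this, of 0 0] show ?thesis by simp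
qed

lemma tangent_sum:
  assumes "x \<in> points M" "\<And>i. i < d \<Longrightarrow> Y i \<in> tangent_space M x"
  shows "(\<lambda>g. \<Sum>i<(d::nat). a i * Y i g) \<in> tangent_space M x"
  using assms(2)
proof (induction d)
  case 0
  then show ?case using tangent_zero[OF assms(1)] by simp
next
  case (Suc d)
  then show ?case using tangent_linear[OF assms(1) Suc.IH Suc.prems[of d], of 1 "a d"] by simp
qed

lemma tangent_cong:
  assumes X: "X \<in> tangent_space M x" and U: "openin (mtop M) U" "x \<in> U" and gh: "\<And>y. y \<in> U \<Longrightarrow> g y = h y"
  shows "X g = X h"
proof -
  have "x \<in> points M" using U openin_subset by blast
  then obtain V c where Vc: "mfd_chart M V c" "x \<in> V" using ex_chart by metis
  then interpret mfd_chart M V c by blast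
  obtain a where a: "a \<in> RR m" "X = chart_vector M (V, c) x a" using X tangent_space_eq[OF Vc(2)] by blast
  have sg: "smooth_at M x g \<longleftrightarrow> smooth_at M x h"
    using smooth_at_cong[OF U] gh by metis
  have "dir_deriv a (\<lambda>z. g (ci z)) (c x) = dir_deriv a (\<lambda>z. h (ci z)) (c x)"
    by (rule dir_deriv_cong_open[OF open_image_Int[OF U(1)] _ a(1)]) (use U Vc gh in auto)
  then show ?thesis using sg by (simp add: a(2) chart_vector_def comp_def)
qed

lemma vderiv_cong:
  assumes "X \<in> tangent_space M x" "openin (mtop M) U" "x \<in> U" "\<And>y. y \<in> U \<Longrightarrow> f y = h y"
  shows "vderiv X f = vderiv X h"
  unfolding vderiv_def
  by (intro sum.cong refl arg_cong2[where f=scaleR] tangent_cong[OF assms(1-3)]) (simp add: assms(4))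

lemma vector_field_sum:
  assumes "openin (mtop M) U" "\<And>i. i < d \<Longrightarrow> vector_field M U (Y i)"
  shows "vector_field M U (\<lambda>x g. \<Sum>i<(d::nat). a i * Y i x g)"
  unfolding vector_field_def
proof (intro conjI ballI allI impI assms(1))
  fix y assume y: "y \<in> U"
  then show "(\<lambda>g. \<Sum>i<d. a i * Y i y g) \<in> tangent_space M y"
    using openin_subset[OF assms(1)] vector_fieldD(2)[OF assms(2) y] by (intro tangent_sum) auto
next
  fix W and g :: "'a \<Rightarrow> real" assume W: "W \<subseteq> U \<and> smooth_fun M W g"
  then show "smooth_fun M W (\<lambda>y. \<Sum>i<d. a i * Y i y g)"
    using vector_fieldD(3)[OF assms(2)] smooth_fun_openin
    by (intro smooth_fun_sum smooth_fun_bounded_linear[OF bounded_linear_mult_right]) auto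
qed

lemma smooth_fun_vderiv:
  fixes f :: "'a \<Rightarrow> 'v::euclidean_space"
  assumes "vector_field M U Y" "smooth_fun M W f" "W \<subseteq> U"
  shows "smooth_fun M W (\<lambda>x. vderiv (Y x) f)"
  unfolding vderiv_def
  by (intro smooth_fun_sum smooth_fun_openin[OF assms(2)] smooth_fun_bounded_linear[OF bounded_linear_scaleR_left]
      vector_fieldD(3)[OF assms(1,3)] smooth_fun_inner_const[OF assms(2)])

lemma vderiv_linear_left: "vderiv (\<lambda>g. r * X g + s * Y g) f = r *\<^sub>R vderiv X f + s *\<^sub>R vderiv Y f"
  by (simp add: vderiv_def scaleR_add_left sum.distrib scaleR_sum_right)

lemma vderiv_sum_left: "vderiv (\<lambda>g. \<Sum>i\<in>A. a i * Y i g) f = (\<Sum>i\<in>A. a i *\<^sub>R vderiv (Y i) f)"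
  by (simp add: vderiv_def scaleR_sum_left scaleR_sum_right) (subst sum.swap, simp)

lemma vderiv_real: "X \<in> tangent_space M x \<Longrightarrow> vderiv X (g :: 'a \<Rightarrow> real) = X g"
  by (simp add: vderiv_def)

lemma vderiv_bilinear:
  fixes f :: "'a \<Rightarrow> 'v::euclidean_space" and h :: "'a \<Rightarrow> 'w::euclidean_space" and B :: "'v \<Rightarrow> 'w \<Rightarrow> 'u::euclidean_space"
  assumes B: "bounded_bilinear B" and X: "X \<in> tangent_space M x" and x: "x \<in> U" and f: "smooth_fun M U f" and h: "smooth_fun M U h"
  shows "vderiv X (\<lambda>y. B (f y) (h y)) = B (f x) (vderiv X h) + B (vderiv X f) (h x)"
proof -
  have oU: "openin (mtop M) U" by (rule smooth_fun_openin[OF f])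
  then have "x \<in> points M" using x openin_subset by blast
  then obtain V c where Vc: "mfd_chart M V c" "x \<in> V" using ex_chart by metis
  then interpret mfd_chart M V c by blast
  obtain a where a: "a \<in> RR m" "X = chart_vector M (V, c) x a" using X tangent_space_eq[OF Vc(2)] by blast
  have cx: "c x \<in> c ` (V \<inter> U)" using x Vc by blast
  have cxR: "c x \<in> RR m" by (rule open_RR_subset[OF open_image_Int[OF oU] cx])
  have "deriv_at m (\<lambda>z. B (f (ci z)) (h (ci z))) (c x) a =
      B (f (ci (c x))) (deriv_at m (\<lambda>z. h (ci z)) (c x) a) + B (deriv_at m (\<lambda>z. f (ci z)) (c x) a) (h (ci (c x)))"
    by (rule deriv_at_eq[OF bounded_bilinear.FDERIV[OF B
          smooth_on_has_derivative[OF smooth_fun_chart[OF f] open_image_Int[OF oU] cx]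
          smooth_on_has_derivative[OF smooth_fun_chart[OF h] open_image_Int[OF oU] cx]] cxR a(1)])
  then show ?thesis
    unfolding a(2) vderiv_chart_vector[OF smooth_fun_bilinear[OF B f h] x Vc(2) a(1)]
      vderiv_chart_vector[OF f x Vc(2) a(1)] vderiv_chart_vector[OF h x Vc(2) a(1)] using Vc(2) by simp
qed

lemma vderiv_inner:
  fixes f h :: "'a \<Rightarrow> 'v::euclidean_space"
  assumes "X \<in> tangent_space M x" "x \<in> U" "smooth_fun M U f" "smooth_fun M U h"
  shows "X (\<lambda>y. f y \<bullet> h y) = f x \<bullet> vderiv X h + vderiv X f \<bullet> h x"
  using vderiv_bilinear[OF bounded_bilinear_inner assms] vderiv_real[OF assms(1)] by simp

lemma vderiv_add:
  fixes f h :: "'a \<Rightarrow> 'v::euclidean_space"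
  assumes X: "X \<in> tangent_space M x" and x: "x \<in> U" and f: "smooth_fun M U f" and h: "smooth_fun M U h"
  shows "vderiv X (\<lambda>y. f y + h y) = vderiv X f + vderiv X h"
proof -
  have oU: "openin (mtop M) U" by (rule smooth_fun_openin[OF f])
  then have "x \<in> points M" using x openin_subset by blast
  then obtain V c where Vc: "mfd_chart M V c" "x \<in> V" using ex_chart by metis
  then interpret mfd_chart M V c by blast
  obtain a where a: "a \<in> RR m" "X = chart_vector M (V, c) x a" using X tangent_space_eq[OF Vc(2)] by blast
  have cx: "c x \<in> c ` (V \<inter> U)" using x Vc by blast
  have cxR: "c x \<in> RR m" by (rule open_RR_subset[OF open_image_Int[OF oU] cx])
  have "deriv_at m (\<lambda>z. f (ci z) + h (ci z)) (c x) a = deriv_at m (\<lambda>z. f (ci z)) (c x) a + deriv_at m (\<lambda>z. h (ci z)) (c x) a"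
    by (rule deriv_at_eq[OF has_derivative_add[OF
          smooth_on_has_derivative[OF smooth_fun_chart[OF f] open_image_Int[OF oU] cx]
          smooth_on_has_derivative[OF smooth_fun_chart[OF h] open_image_Int[OF oU] cx]] cxR a(1)])
  then show ?thesis
    unfolding a(2) vderiv_chart_vector[OF smooth_fun_add[OF f h] x Vc(2) a(1)]
      vderiv_chart_vector[OF f x Vc(2) a(1)] vderiv_chart_vector[OF h x Vc(2) a(1)] by simp
qed

section \<open>Brackets and the Koszul formula\<close>

lemma vector_field_deriv_chart:
  fixes g :: "'a \<Rightarrow> 'v::euclidean_space"
  assumes "mfd_chart M V c" and X: "vector_field M U X" and Y: "vector_field M U Y" and x: "x \<in> U" "x \<in> V"
    and xc: "smooth_on (mdim M) (c ` (V \<inter> U)) xc" "xc ` c ` (V \<inter> U) \<subseteq> RR (mdim M)"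
      "\<forall>p\<in>V \<inter> U. X p = chart_vector M (V, c) p (xc (c p))"
    and yc: "smooth_on (mdim M) (c ` (V \<inter> U)) yc" "yc ` c ` (V \<inter> U) \<subseteq> RR (mdim M)"
      "\<forall>p\<in>V \<inter> U. Y p = chart_vector M (V, c) p (yc (c p))"
    and g: "smooth_fun M W g" "x \<in> W"
  shows "vderiv (X x) (\<lambda>p. vderiv (Y p) g) =
    dir_deriv (xc (c x)) (dir_deriv (yc (c x)) (\<lambda>z. g (inv_into V c z))) (c x)
    + deriv_at (mdim M) (\<lambda>z. g (inv_into V c z)) (c x) (deriv_at (mdim M) yc (c x) (xc (c x)))"
proof -
  interpret mfd_chart M V c by fact
  have o: "openin (mtop M) (U \<inter> W)" by (intro openin_Int vector_fieldD(1)[OF X] smooth_fun_openin[OF g(1)])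
  have gUW: "smooth_fun M (U \<inter> W) g" by (rule smooth_fun_subset[OF g(1) o]) blast
  have oc: "open_RR m (c ` (V \<inter> (U \<inter> W)))" by (rule open_image_Int[OF o])
  have cx: "c x \<in> c ` (V \<inter> (U \<inter> W))" using x g(2) by blast
  have a: "xc (c x) \<in> RR m" using xc(2) x by blast
  have xUW: "x \<in> U \<inter> W" using x g by blast
  have "vderiv (X x) (\<lambda>p. vderiv (Y p) g) = deriv_at m (\<lambda>z. vderiv (Y (ci z)) g) (c x) (xc (c x))"
    unfolding xc(3)[rule_format, OF IntI[OF x(2,1)]]
    by (rule vderiv_chart_vector[OF smooth_fun_vderiv[OF Y gUW] xUW x(2) a]) blast
  also have "\<dots> = deriv_at m (\<lambda>z. deriv_at m (\<lambda>z. g (ci z)) z (yc z)) (c x) (xc (c x))"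
  proof (rule deriv_at_cong_open[OF oc cx])
    fix z assume "z \<in> c ` (V \<inter> (U \<inter> W))"
    then obtain p where p: "p \<in> V" "p \<in> U" "p \<in> W" "z = c p" by blast
    then have "yc (c p) \<in> RR m" using yc(2) by blast
    then show "vderiv (Y (ci z)) g = deriv_at m (\<lambda>z. g (ci z)) z (yc z)"
      using p yc(3)[rule_format, OF IntI[OF p(1,2)]] vderiv_chart_vector[OF g(1) p(3,1)] by simp
  qed
  also have "\<dots> = dir_deriv (xc (c x)) (dir_deriv (yc (c x)) (\<lambda>z. g (ci z))) (c x)
     + deriv_at m (\<lambda>z. g (ci z)) (c x) (deriv_at m yc (c x) (xc (c x)))"
  proof (rule deriv_at_deriv_at[OF smooth_fun_chart[OF gUW] oc cx _ _ a])
    show "smooth_on m (c ` (V \<inter> (U \<inter> W))) yc" by (rule smooth_on_subset[OF yc(1)]) blast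
    show "yc ` c ` (V \<inter> (U \<inter> W)) \<subseteq> RR m" using yc(2) by blast
  qed
  finally show ?thesis .
qed

text \<open>Second derivatives are symmetric and cancel, so the commutator is of first order, with
  component vector \<open>w\<close>.\<close>

lemma commutator_chart:
  fixes g :: "'a \<Rightarrow> 'v::euclidean_space"
  assumes Vc: "mfd_chart M V c" and X: "vector_field M U X" and Y: "vector_field M U Y" and x: "x \<in> U" "x \<in> V"
    and xc: "smooth_on (mdim M) (c ` (V \<inter> U)) xc" "xc ` c ` (V \<inter> U) \<subseteq> RR (mdim M)"
      "\<forall>p\<in>V \<inter> U. X p = chart_vector M (V, c) p (xc (c p))"
    and yc: "smooth_on (mdim M) (c ` (V \<inter> U)) yc" "yc ` c ` (V \<inter> U) \<subseteq> RR (mdim M)"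
      "\<forall>p\<in>V \<inter> U. Y p = chart_vector M (V, c) p (yc (c p))"
    and w: "w = deriv_at (mdim M) yc (c x) (xc (c x)) - deriv_at (mdim M) xc (c x) (yc (c x))"
  shows "w \<in> RR (mdim M)"
    and "smooth_fun M W g \<Longrightarrow> x \<in> W \<Longrightarrow>
      vderiv (X x) (\<lambda>p. vderiv (Y p) g) - vderiv (Y x) (\<lambda>p. vderiv (X p) g) = vderiv (chart_vector M (V, c) x w) g"
proof -
  interpret mfd_chart M V c by fact
  have oc: "open_RR m (c ` (V \<inter> U))" by (rule open_image_Int[OF vector_fieldD(1)[OF X]])
  have cx: "c x \<in> c ` (V \<inter> U)" using x by blast
  have R: "xc (c x) \<in> RR m" "yc (c x) \<in> RR m" using xc(2) yc(2) cx by blast+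
  show wR: "w \<in> RR m" unfolding w
    by (intro RR_diff deriv_at_in_RR[OF yc(1) oc cx yc(2) R(1)] deriv_at_in_RR[OF xc(1) oc cx xc(2) R(2)])
  assume g: "smooth_fun M W g" "x \<in> W"
  have cxW: "c x \<in> c ` (V \<inter> W)" using g(2) x by blast
  interpret d: bounded_linear "deriv_at m (\<lambda>z. g (ci z)) (c x)" by (rule bounded_linear_deriv_at)
  show "vderiv (X x) (\<lambda>p. vderiv (Y p) g) - vderiv (Y x) (\<lambda>p. vderiv (X p) g) = vderiv (chart_vector M (V, c) x w) g"
    using vector_field_deriv_chart[OF Vc X Y x xc yc g] vector_field_deriv_chart[OF Vc Y X x yc xc g]
      vderiv_chart_vector[OF g x(2) wR]
      dir_deriv_commute[OF smooth_fun_chart[OF g(1)] open_image_Int[OF smooth_fun_openin[OF g(1)]] cxW R]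
      d.diff[of "deriv_at m yc (c x) (xc (c x))" "deriv_at m xc (c x) (yc (c x))"]
    unfolding w[symmetric] by simp
qed

text \<open>The bracket is defined as a second-order expression; in a chart it is the tangent vector
  with the commutator components, and it therefore differentiates vector-valued maps as
  well.\<close>

lemma bracket_tangent:
  fixes g :: "'a \<Rightarrow> 'v::euclidean_space"
  assumes X: "vector_field M U X" and Y: "vector_field M U Y" and x: "x \<in> U"
  shows "bracket M X Y x \<in> tangent_space M x"
    and "smooth_fun M W g \<Longrightarrow> x \<in> W \<Longrightarrow>
      vderiv (bracket M X Y x) g = vderiv (X x) (\<lambda>p. vderiv (Y p) g) - vderiv (Y x) (\<lambda>p. vderiv (X p) g)"
proof -
  have xM: "x \<in> points M" using x vector_fieldD(1)[OF X] openin_subset by blast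
  obtain V c where Vc: "mfd_chart M V c" "x \<in> V" using ex_chart[OF xM] .
  then interpret mfd_chart M V c by blast
  obtain xc where xc: "smooth_on m (c ` (V \<inter> U)) xc" "xc ` c ` (V \<inter> U) \<subseteq> RR m"
      "\<forall>p\<in>V \<inter> U. X p = chart_vector M (V, c) p (xc (c p))"
    using vector_field_components[OF X] by auto
  obtain yc where yc: "smooth_on m (c ` (V \<inter> U)) yc" "yc ` c ` (V \<inter> U) \<subseteq> RR m"
      "\<forall>p\<in>V \<inter> U. Y p = chart_vector M (V, c) p (yc (c p))"
    using vector_field_components[OF Y] by auto
  define w where "w = deriv_at m yc (c x) (xc (c x)) - deriv_at m xc (c x) (yc (c x))"
  note comm = commutator_chart[OF Vc(1) X Y x Vc(2) xc yc w_def]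
  have br: "bracket M X Y x = chart_vector M (V, c) x w"
  proof
    fix g
    show "bracket M X Y x g = chart_vector M (V, c) x w g"
    proof (cases "smooth_at M x g")
      case True
      then obtain W where W: "x \<in> W" "smooth_fun M W g" unfolding smooth_at_def by blast
      have T: "X x \<in> tangent_space M x" "Y x \<in> tangent_space M x" "chart_vector M (V, c) x w \<in> tangent_space M x"
        using vector_fieldD(2)[OF X x] vector_fieldD(2)[OF Y x] chart_vector_in[OF Vc(2) comm(1)] by auto
      have o: "openin (mtop M) (U \<inter> W)" by (intro openin_Int vector_fieldD(1)[OF X] smooth_fun_openin[OF W(2)])
      have "vderiv (X x) (\<lambda>p. vderiv (Y p) g) = X x (\<lambda>p. Y p g)"
        unfolding vderiv_real[OF T(1)]
        by (rule tangent_cong[OF T(1) o]) (use x W in \<open>auto intro: vderiv_real vector_fieldD(2)[OF Y]\<close>)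
      moreover have "vderiv (Y x) (\<lambda>p. vderiv (X p) g) = Y x (\<lambda>p. X p g)"
        unfolding vderiv_real[OF T(2)]
        by (rule tangent_cong[OF T(2) o]) (use x W in \<open>auto intro: vderiv_real vector_fieldD(2)[OF X]\<close>)
      ultimately show ?thesis
        using comm(2)[OF W(2,1)] True vderiv_real[OF T(3), of g] by (simp add: bracket_def)
    qed (simp add: bracket_def chart_vector_def)
  qed
  show "bracket M X Y x \<in> tangent_space M x"
    unfolding br by (rule chart_vector_in[OF Vc(2) comm(1)])
  assume "smooth_fun M W g" "x \<in> W"
  then show "vderiv (bracket M X Y x) g = vderiv (X x) (\<lambda>p. vderiv (Y p) g) - vderiv (Y x) (\<lambda>p. vderiv (X p) g)"
    unfolding br using commutator_chart(2)[OF Vc(1) X Y x Vc(2) xc yc w_def] by metis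
qed

text \<open>Hence the tangential part of the derivative of \<open>f\<^sub>*Y\<close> depends only on the induced metric.\<close>

lemma koszul:
  fixes f :: "'a \<Rightarrow> 'v::euclidean_space"
  assumes f: "isometric_immersion M G f" and X: "vector_field M U X" and Y: "vector_field M U Y" and Z: "vector_field M U Z"
    and x: "x \<in> U"
  shows "2 * (vderiv (X x) (\<lambda>y. vderiv (Y y) f) \<bullet> vderiv (Z x) f) =
     X x (\<lambda>y. G y (Y y) (Z y)) + Y x (\<lambda>y. G y (X y) (Z y)) - Z x (\<lambda>y. G y (X y) (Y y))
          + G x (bracket M X Y x) (Z x) - G x (bracket M X Z x) (Y x)
          - G x (bracket M Y Z x) (X x)"
proof -
  have oU: "openin (mtop M) U" by (rule vector_fieldD(1)[OF X])
  have UM: "y \<in> points M" if "y \<in> U" for y using that oU openin_subset by blast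
  have fU: "smooth_fun M U f"
    using f unfolding isometric_immersion_def by (metis smooth_fun_subset oU openin_subset)
  have G: "G y S T = vderiv S f \<bullet> vderiv T f" if "y \<in> U" "S \<in> tangent_space M y" "T \<in> tangent_space M y" for y S T
    using f UM[OF that(1)] that(2,3) unfolding isometric_immersion_def by metis
  have deriv: "A x (\<lambda>y. G y (B y) (C y)) = vderiv (B x) f \<bullet> vderiv (A x) (\<lambda>y. vderiv (C y) f) + vderiv (A x) (\<lambda>y. vderiv (B y) f) \<bullet> vderiv (C x) f"
    if A: "vector_field M U A" and B: "vector_field M U B" and C: "vector_field M U C" for A B C
  proof -
    have "A x (\<lambda>y. G y (B y) (C y)) = A x (\<lambda>y. vderiv (B y) f \<bullet> vderiv (C y) f)"
      by (rule tangent_cong[OF vector_fieldD(2)[OF A x] oU x]) (use G vector_fieldD(2)[OF B] vector_fieldD(2)[OF C] in auto)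
    also have "\<dots> = vderiv (B x) f \<bullet> vderiv (A x) (\<lambda>y. vderiv (C y) f) + vderiv (A x) (\<lambda>y. vderiv (B y) f) \<bullet> vderiv (C x) f"
      by (rule vderiv_inner[OF vector_fieldD(2)[OF A x] x smooth_fun_vderiv[OF B fU] smooth_fun_vderiv[OF C fU]]) auto
    finally show ?thesis .
  qed
  have br: "G x (bracket M A B x) (C x) = (vderiv (A x) (\<lambda>p. vderiv (B p) f) - vderiv (B x) (\<lambda>p. vderiv (A p) f)) \<bullet> vderiv (C x) f"
    if A: "vector_field M U A" and B: "vector_field M U B" and C: "vector_field M U C" for A B C
    unfolding G[OF x bracket_tangent(1)[OF A B x] vector_fieldD(2)[OF C x]] bracket_tangent(2)[OF A B x fU x] ..
  \<comment> \<open>All terms are now products of a derivative \<open>D\<^sub>A(f\<^sub>*B)\<close>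
    with some \<open>f\<^sub>*C\<close>; they cancel in pairs except
    \<open>D\<^sub>X(f\<^sub>*Y) \<bullet> f\<^sub>*Z\<close>, which occurs twice.\<close>
  show ?thesis
    unfolding deriv[OF X Y Z] deriv[OF Y X Z] deriv[OF Z X Y] br[OF X Y Z] br[OF X Z Y] br[OF Y Z X]
    by (simp add: inner_diff_left inner_commute algebra_simps)
qed

end

subsection \<open>Open submanifolds\<close>

lemma inv_into_subset:
  assumes "inj_on c V" "U \<subseteq> V" "z \<in> c ` U"
  shows "inv_into U c z = inv_into V c z"
  using assms by (metis f_inv_into_f inj_on_subset inv_into_f_f inv_into_into subsetD)

context smooth_mfd
begin

lemma points_open_submfd: "openin (mtop M) U \<Longrightarrow> points (open_submfd M U) = U"
  using openin_subset[of "mtop M" U] by (simp add: open_submfd_def Int_absorb1)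

lemma openin_open_submfd: "openin (mtop M) U \<Longrightarrow> openin (mtop (open_submfd M U)) W \<longleftrightarrow> openin (mtop M) W \<and> W \<subseteq> U"
  by (simp add: open_submfd_def openin_open_subtopology)

text \<open>\<open>inv_into\<close> depends on the domain, so the restricted chart has a formally
  different inverse; the two agree on the image of the smaller domain, which is all that matters
  there.\<close>

lemma smooth_on_open_submfd_chart:
  assumes Vc: "mfd_chart M V c" and U: "openin (mtop M) U" and W: "openin (mtop M) W"
  shows "smooth_on (mdim M) (c ` (V \<inter> U \<inter> W)) (g \<circ> inv_into (V \<inter> U) c) \<longleftrightarrow>
     smooth_on (mdim M) (c ` (V \<inter> (U \<inter> W))) (\<lambda>z. g (inv_into V c z))"
proof -
  interpret mfd_chart M V c by fact
  have eq: "V \<inter> U \<inter> W = V \<inter> (U \<inter> W)" by blast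
  have o: "open_RR m (c ` (V \<inter> (U \<inter> W)))" by (intro open_image_Int openin_Int U W)
  have *: "(g \<circ> inv_into (V \<inter> U) c) z = g (inv_into V c z)" if "z \<in> c ` (V \<inter> (U \<inter> W))" for z
  proof -
    have "z \<in> c ` (V \<inter> U)" using that by blast
    then show ?thesis using inv_into_subset[OF inj_c Int_lower1] by simp
  qed
  show ?thesis
    unfolding eq by (rule smooth_on_cong[OF o *])
qed

lemma smooth_fun_open_submfd:
  assumes U: "openin (mtop M) U"
  shows "smooth_fun (open_submfd M U) W g \<longleftrightarrow> smooth_fun M W g \<and> W \<subseteq> U"
proof (cases "openin (mtop M) W \<and> W \<subseteq> U")
  case True
  then have W: "openin (mtop M) W" and WU: "U \<inter> W = W" by auto
  have ch: "mcharts (open_submfd M U) = (\<lambda>(V, c). (V \<inter> U, c)) ` mcharts M" "mdim (open_submfd M U) = mdim M"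
    by (simp_all add: open_submfd_def)
  have "smooth_fun (open_submfd M U) W g \<longleftrightarrow>
     (\<forall>(V, c)\<in>mcharts M. smooth_on (mdim M) (c ` (V \<inter> U \<inter> W)) (g \<circ> inv_into (V \<inter> U) c))"
    unfolding smooth_fun_def ch openin_open_submfd[OF U] using True by (simp add: case_prod_beta)
  also have "\<dots> \<longleftrightarrow> (\<forall>(V, c)\<in>mcharts M. smooth_on (mdim M) (c ` (V \<inter> W)) (\<lambda>z. g (inv_into V c z)))"
  proof (rule ball_cong[OF refl], clarify)
    fix V c assume "(V, c) \<in> mcharts M"
    from smooth_on_open_submfd_chart[OF mfd_chartI[OF this] U W]
    show "smooth_on (mdim M) (c ` (V \<inter> U \<inter> W)) (g \<circ> inv_into (V \<inter> U) c) \<longleftrightarrow>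
      smooth_on (mdim M) (c ` (V \<inter> W)) (\<lambda>z. g (inv_into V c z))" unfolding WU .
  qed
  finally show ?thesis using True by (simp add: smooth_fun_def comp_def)
next
  case False
  then show ?thesis
    by (auto simp: smooth_fun_def openin_open_submfd[OF U])
qed

lemma smooth_manifold_open_submfd:
  assumes U: "openin (mtop M) U"
  shows "smooth_manifold (open_submfd M U)"
proof -
  note base = smooth[unfolded smooth_manifold_def, THEN conjunct1]
      smooth[unfolded smooth_manifold_def, THEN conjunct2, THEN conjunct1]
      smooth[unfolded smooth_manifold_def, THEN conjunct2, THEN conjunct2, THEN conjunct1]
  have 3: "(\<Union>(V, c)\<in>mcharts (open_submfd M U). V) = points (open_submfd M U)"
  proof -
    have "(\<Union>(V, c)\<in>mcharts (open_submfd M U). V) = (\<Union>(V, c)\<in>mcharts M. V) \<inter> U"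
      by (auto simp: open_submfd_def)
    then show ?thesis unfolding base(3) using points_open_submfd[OF U] openin_subset[OF U] by blast
  qed
  have 4: "openin (mtop (open_submfd M U)) (V \<inter> U) \<and> openin (top_of_set (RR (mdim M))) (c ` (V \<inter> U)) \<and>
        homeomorphic_map (subtopology (mtop (open_submfd M U)) (V \<inter> U)) (top_of_set (c ` (V \<inter> U))) c"
    if Vc: "(V, c) \<in> mcharts M" for V c
  proof -
    interpret mfd_chart M V c by (rule mfd_chartI[OF Vc])
    have "homeomorphic_map (subtopology (subtopology (mtop M) V) U) (subtopology (top_of_set (c ` V)) (c ` (V \<inter> U))) c"
      by (rule homeomorphic_map_subtopologies[OF chart_props(3)]) (use V_subset in auto)
    moreover have "subtopology (subtopology (mtop M) V) U = subtopology (mtop (open_submfd M U)) (V \<inter> U)"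
      by (simp add: open_submfd_def subtopology_subtopology Int_ac)
    moreover have "subtopology (top_of_set (c ` V)) (c ` (V \<inter> U)) = top_of_set (c ` (V \<inter> U))"
      by (simp add: subtopology_subtopology inf_absorb2 image_mono)
    ultimately show ?thesis
      using open_image_Int[OF U] openin_Int[OF chart_props(1) U] openin_open_submfd[OF U] by simp
  qed
  have 5: "smooth_on (mdim M) (c ` ((V \<inter> U) \<inter> (W \<inter> U))) (d \<circ> inv_into (V \<inter> U) c)"
    if Vc: "(V, c) \<in> mcharts M" and Wd: "(W, d) \<in> mcharts M" for V c W d
  proof -
    interpret V: mfd_chart M V c by (rule mfd_chartI[OF Vc])
    interpret W: mfd_chart M W d by (rule mfd_chartI[OF Wd])
    have "smooth_on (mdim M) (c ` (V \<inter> (U \<inter> (W \<inter> U)))) (\<lambda>z. d (inv_into V c z))"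
      by (rule smooth_on_subset[OF V.transition[OF Wd]]) blast
    then show ?thesis
      using smooth_on_open_submfd_chart[OF V.mfd_chart_axioms U openin_Int[OF W.chart_props(1) U], of d] by blast
  qed
  show ?thesis
    unfolding smooth_manifold_def
  proof (intro conjI 3)
    show "Hausdorff_space (mtop (open_submfd M U))" "second_countable (mtop (open_submfd M U))"
      using Hausdorff_space_subtopology[OF base(1)] second_countable_subtopology[OF base(2)] by (simp_all add: open_submfd_def)
    show "\<forall>(V, c)\<in>mcharts (open_submfd M U). openin (mtop (open_submfd M U)) V \<and> openin (top_of_set (RR (mdim (open_submfd M U)))) (c ` V) \<and>
        homeomorphic_map (subtopology (mtop (open_submfd M U)) V) (top_of_set (c ` V)) c"
      using 4 by (auto simp: open_submfd_def)
    show "\<forall>(V, c)\<in>mcharts (open_submfd M U). \<forall>(W, d)\<in>mcharts (open_submfd M U).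
        smooth_on (mdim (open_submfd M U)) (c ` (V \<inter> W)) (d \<circ> inv_into V c)"
      using 5 by (auto simp: open_submfd_def)
  qed
qed

lemma mfd_chart_open_submfd:
  assumes U: "openin (mtop M) U" and Vc: "mfd_chart M V c"
  shows "mfd_chart (open_submfd M U) (V \<inter> U) c"
proof (unfold_locales)
  show "smooth_manifold (open_submfd M U)" by (rule smooth_manifold_open_submfd[OF U])
  show "(V \<inter> U, c) \<in> mcharts (open_submfd M U)"
    using mfd_chart.chart[OF Vc] by (auto simp: open_submfd_def)
qed

lemma smooth_at_open_submfd:
  assumes U: "openin (mtop M) U" and x: "x \<in> U"
  shows "smooth_at (open_submfd M U) x g \<longleftrightarrow> smooth_at M x g"
proof
  assume "smooth_at M x g"
  then obtain W where W: "x \<in> W" "smooth_fun M W g" unfolding smooth_at_def by blast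
  have "smooth_fun M (W \<inter> U) g" by (rule smooth_fun_subset[OF W(2)]) (auto intro: openin_Int U smooth_fun_openin[OF W(2)])
  then show "smooth_at (open_submfd M U) x g"
    unfolding smooth_at_def smooth_fun_open_submfd[OF U] using W(1) x by blast
qed (auto simp: smooth_at_def smooth_fun_open_submfd[OF U])

lemma chart_vector_open_submfd:
  assumes U: "openin (mtop M) U" and x: "x \<in> U" "x \<in> V" and Vc: "mfd_chart M V c" and a: "a \<in> RR (mdim M)"
  shows "chart_vector (open_submfd M U) (V \<inter> U, c) x a = chart_vector M (V, c) x a"
proof
  fix g :: "'a \<Rightarrow> real"
  interpret mfd_chart M V c by fact
  have "dir_deriv a (\<lambda>z. g (inv_into (V \<inter> U) c z)) (c x) = dir_deriv a (\<lambda>z. g (inv_into V c z)) (c x)"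
    by (rule dir_deriv_cong_open(1)[OF open_image_Int[OF U] _ a])
       (use x inv_into_subset[OF inj_c Int_lower1] in auto)
  then show "chart_vector (open_submfd M U) (V \<inter> U, c) x a g = chart_vector M (V, c) x a g"
    by (simp add: chart_vector_def smooth_at_open_submfd[OF U x(1)] comp_def)
qed

text \<open>Smoothness near \<open>x\<close> is the same in \<open>M\<close> and in an open piece
  containing \<open>x\<close>, so the two tangent spaces are equal as sets of functionals and
  vectors pass between them without conversion.\<close>

lemma tangent_space_open_submfd:
  assumes U: "openin (mtop M) U" and x: "x \<in> U"
  shows "tangent_space (open_submfd M U) x = tangent_space M x"
proof -
  have "x \<in> points M" using assms openin_subset by blast
  then obtain V c where Vc: "mfd_chart M V c" "x \<in> V" using ex_chart by metis
  interpret V: mfd_chart M V c by fact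
  interpret W: mfd_chart "open_submfd M U" "V \<inter> U" c by (rule mfd_chart_open_submfd[OF U Vc(1)])
  have "mdim (open_submfd M U) = mdim M" by (simp add: open_submfd_def)
  then show ?thesis
    using V.tangent_space_eq[OF Vc(2)] W.tangent_space_eq[of x] Vc(2) x chart_vector_open_submfd[OF U x Vc(2,1)]
    by (auto simp: image_iff)
qed

lemma vector_field_open_submfd:
  assumes U: "openin (mtop M) U"
  shows "vector_field (open_submfd M U) W Y \<longleftrightarrow> vector_field M W Y \<and> W \<subseteq> U"
proof (cases "W \<subseteq> U")
  case True
  have T: "tangent_space (open_submfd M U) y = tangent_space M y" if "y \<in> W" for y
    by (rule tangent_space_open_submfd[OF U]) (use that True in blast)
  have S: "W' \<subseteq> W \<and> smooth_fun M W' g \<and> W' \<subseteq> U \<longleftrightarrow> W' \<subseteq> W \<and> smooth_fun M W' g" for W' g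
    using True by blast
  have S': "smooth_fun M W' h \<and> W' \<subseteq> U \<longleftrightarrow> smooth_fun M W' h" if "W' \<subseteq> W" for W' h
    using True that by blast
  show ?thesis
    unfolding vector_field_def smooth_fun_open_submfd[OF U] openin_open_submfd[OF U] S
    using True by (simp add: T S' cong: conj_cong ball_cong imp_cong)
qed (auto simp: vector_field_def openin_open_submfd[OF U])

lemma isometric_immersion_open_submfd:
  assumes U: "openin (mtop M) U" and f: "isometric_immersion M G f"
  shows "isometric_immersion (open_submfd M U) G f"
proof -
  have UM: "U \<subseteq> points M" by (rule openin_subset[OF U])
  have "smooth_fun M U f"
    using f unfolding isometric_immersion_def by (metis smooth_fun_subset U UM)
  moreover have "immersion_at (open_submfd M U) f x \<and>
        (\<forall>X\<in>tangent_space (open_submfd M U) x. \<forall>Y\<in>tangent_space (open_submfd M U) x. vderiv X f \<bullet> vderiv Y f = G x X Y)"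
    if "x \<in> U" for x
  proof -
    have "x \<in> points M" using that UM by blast
    then show ?thesis
      using f unfolding isometric_immersion_def immersion_at_def tangent_space_open_submfd[OF U that] by simp
  qed
  ultimately show ?thesis
    unfolding isometric_immersion_def smooth_fun_open_submfd[OF U] points_open_submfd[OF U] by simp
qed

end

subsection \<open>Open subsets of coordinate space\<close>

definition open_RR_mfd :: "nat \<Rightarrow> seqs set \<Rightarrow> seqs mfd" where
  "open_RR_mfd k N = \<lparr>mtop = top_of_set N, mdim = k, mcharts = {(N, id)}\<rparr>"

lemma inv_into_id: "x \<in> N \<Longrightarrow> inv_into N id x = x"
  using inv_into_f_f[of id N x] by simp

lemma mfd_chart_open_RR:
  assumes N: "open_RR k N"
  shows "mfd_chart (open_RR_mfd k N) N id"
proof (unfold_locales)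
  have "smooth_on k N (\<lambda>x. x)" by (rule smooth_on_linear[OF N bounded_linear_ident])
  then have "smooth_on k N (id \<circ> inv_into N id)"
    using smooth_on_cong[OF N, of "\<lambda>x. x" "id \<circ> inv_into N id"] inv_into_id by simp
  then show "smooth_manifold (open_RR_mfd k N)"
    using N second_countable_RR[OF openin_imp_subset[OF N]]
    by (simp add: smooth_manifold_def open_RR_mfd_def Hausdorff_space_subtopology subtopology_subtopology)
  show "(N, id) \<in> mcharts (open_RR_mfd k N)" by (simp add: open_RR_mfd_def)
qed

lemma smooth_fun_open_RR:
  assumes N: "open_RR k N" and g: "smooth_on k N g"
  shows "smooth_fun (open_RR_mfd k N) N g"
proof -
  have "smooth_on k N (g \<circ> inv_into N id)"
    using smooth_on_cong[OF N, of g "g \<circ> inv_into N id"] inv_into_id g by simp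
  then show ?thesis by (simp add: smooth_fun_def open_RR_mfd_def)
qed

lemma tangent_open_RR:
  fixes g :: "seqs \<Rightarrow> 'v::euclidean_space"
  assumes N: "open_RR k N" and y: "y \<in> N"
  shows "tangent_space (open_RR_mfd k N) y = chart_vector (open_RR_mfd k N) (N, id) y ` RR k"
    and "smooth_on k N g \<Longrightarrow> a \<in> RR k \<Longrightarrow>
      vderiv (chart_vector (open_RR_mfd k N) (N, id) y a) g = deriv_at k g y a"
proof -
  interpret N: mfd_chart "open_RR_mfd k N" N id by (rule mfd_chart_open_RR[OF N])
  have dim: "mdim (open_RR_mfd k N) = k" by (simp add: open_RR_mfd_def)
  show "tangent_space (open_RR_mfd k N) y = chart_vector (open_RR_mfd k N) (N, id) y ` RR k"
    using N.tangent_space_eq[OF y] dim by simp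
  assume g: "smooth_on k N g" and a: "a \<in> RR k"
  have "vderiv (chart_vector (open_RR_mfd k N) (N, id) y a) g = deriv_at k (\<lambda>z. g (inv_into N id z)) y a"
    using N.vderiv_chart_vector[OF smooth_fun_open_RR[OF N g] y y] a dim by simp
  also have "\<dots> = deriv_at k g y a"
    by (rule deriv_at_cong_open[OF N y]) (simp add: inv_into_id)
  finally show "vderiv (chart_vector (open_RR_mfd k N) (N, id) y a) g = deriv_at k g y a" .
qed

subsection \<open>A singular extension along one section\<close>

text \<open>The projection of a cylinder to its base: in \<open>RR (Suc n)\<close> the coordinates
  below \<open>n\<close> describe the base point, and the coordinate with index \<open>n\<close> is
  the parameter \<open>t\<close>.\<close>

definition drop_coord :: "nat \<Rightarrow> seqs \<Rightarrow> seqs" where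
  "drop_coord n y = y - apply_bcontfun y n *\<^sub>R unit_seq n"

lemma bounded_linear_drop_coord: "bounded_linear (drop_coord n)"
  unfolding drop_coord_def[abs_def]
  by (intro bounded_linear_sub bounded_linear_ident bounded_linear_scaleR_const bounded_linear_coord)

lemma drop_coord_RR: "y \<in> RR (Suc n) \<Longrightarrow> drop_coord n y \<in> RR n"
  by (auto simp: RR_def drop_coord_def)

lemma drop_coord_id: "y \<in> RR n \<Longrightarrow> drop_coord n y = y"
  by (simp add: drop_coord_def RR_def)

lemma cylinder_map:
  fixes g h :: "seqs \<Rightarrow> 'v::euclidean_space"
  assumes Q: "open_RR n Q" and g: "smooth_on n Q g" and h: "smooth_on n Q h" and N: "open_RR (Suc n) N"
    and sub: "drop_coord n ` N \<subseteq> Q"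
  shows "smooth_on (Suc n) N (\<lambda>y. g (drop_coord n y) + apply_bcontfun y n *\<^sub>R h (drop_coord n y))"
    and "y \<in> N \<Longrightarrow> a \<in> RR (Suc n) \<Longrightarrow>
       deriv_at (Suc n) (\<lambda>y. g (drop_coord n y) + apply_bcontfun y n *\<^sub>R h (drop_coord n y)) y a =
       deriv_at n g (drop_coord n y) (drop_coord n a) + apply_bcontfun y n *\<^sub>R deriv_at n h (drop_coord n y) (drop_coord n a)
       + apply_bcontfun a n *\<^sub>R h (drop_coord n y)"
proof -
  have dr: "smooth_on (Suc n) N (drop_coord n)" by (rule smooth_on_linear[OF N bounded_linear_drop_coord])
  show "smooth_on (Suc n) N (\<lambda>y. g (drop_coord n y) + apply_bcontfun y n *\<^sub>R h (drop_coord n y))"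
    by (rule smooth_on_add[OF N smooth_on_compose[OF N Q sub dr g]
        smooth_on_bilinear[OF N bounded_bilinear_scaleR smooth_on_linear[OF N bounded_linear_coord] smooth_on_compose[OF N Q sub dr h]]])
  assume y: "y \<in> N" and a: "a \<in> RR (Suc n)"
  have yQ: "drop_coord n y \<in> Q" using sub y by blast
  have yR: "y \<in> RR (Suc n)" by (rule open_RR_subset[OF N y])
  have subR: "drop_coord n ` N \<subseteq> RR n" using sub openin_imp_subset[OF Q] by blast
  have d: "((\<lambda>y. k (drop_coord n y)) has_derivative (\<lambda>a. deriv_at n k (drop_coord n y) (drop_coord n a))) (at y within RR (Suc n))"
    if "smooth_on n Q k" for k :: "seqs \<Rightarrow> 'v"
    by (rule has_derivative_RR_compose[OF bounded_linear_imp_has_derivative[OF bounded_linear_drop_coord]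
          smooth_on_has_derivative[OF that Q yQ] N y subR])
  have "((\<lambda>y. g (drop_coord n y) + apply_bcontfun y n *\<^sub>R h (drop_coord n y)) has_derivative
    (\<lambda>a. deriv_at n g (drop_coord n y) (drop_coord n a) + (apply_bcontfun y n *\<^sub>R deriv_at n h (drop_coord n y) (drop_coord n a)
     + apply_bcontfun a n *\<^sub>R h (drop_coord n y)))) (at y within RR (Suc n))"
    by (intro has_derivative_add d g h has_derivative_scaleR bounded_linear_imp_has_derivative[OF bounded_linear_coord])
  from deriv_at_eq[OF this yR a] show "deriv_at (Suc n) (\<lambda>y. g (drop_coord n y) + apply_bcontfun y n *\<^sub>R h (drop_coord n y)) y a =
     deriv_at n g (drop_coord n y) (drop_coord n a) + apply_bcontfun y n *\<^sub>R deriv_at n h (drop_coord n y) (drop_coord n a)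
     + apply_bcontfun a n *\<^sub>R h (drop_coord n y)" by (simp add: add.assoc)
qed

context mfd_chart
begin

text \<open>One point \<open>(x0, t0)\<close> at which the cylinder over \<open>f\<close> is an
  immersion suffices for a singular extension over some open \<open>U'\<close>. By the polynomial
  argument the cylinder is then an immersion for all small nonzero \<open>t\<close> over a ball, and
  any failure at \<open>t = 0\<close> lies on the embedded piece of \<open>M\<close>, where it is
  permitted.\<close>

lemma singular_extension:
  fixes f v :: "'a \<Rightarrow> 'v::euclidean_space" and fh vh :: "'a \<Rightarrow> 'w::euclidean_space"
  assumes f: "smooth_fun M U f" and fh: "smooth_fun M U fh" and v: "smooth_fun M U v" and vh: "smooth_fun M U vh"
    and UV: "U \<subseteq> V"
    and iso: "\<And>x t X r X' r'. x \<in> U \<Longrightarrow> X \<in> tangent_space M x \<Longrightarrow> X' \<in> tangent_space M x \<Longrightarrow>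
      (vderiv X f + t *\<^sub>R vderiv X v + r *\<^sub>R v x) \<bullet> (vderiv X' f + t *\<^sub>R vderiv X' v + r' *\<^sub>R v x) =
      (vderiv X fh + t *\<^sub>R vderiv X vh + r *\<^sub>R vh x) \<bullet> (vderiv X' fh + t *\<^sub>R vderiv X' vh + r' *\<^sub>R vh x)"
    and x0: "x0 \<in> U"
    and inj: "\<And>X r. X \<in> tangent_space M x0 \<Longrightarrow> vderiv X f + t0 *\<^sub>R vderiv X v + r *\<^sub>R v x0 = 0 \<Longrightarrow> X = (\<lambda>_. 0) \<and> r = 0"
  shows "\<exists>U'. openin (mtop M) U' \<and> U' \<noteq> {} \<and> singularly_extend (open_submfd M U') f fh"
proof -
  have oU: "openin (mtop M) U" by (rule smooth_fun_openin[OF f])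
  have VU: "V \<inter> U = U" using UV by blast
  have oc: "open_RR m (c ` U)" by (rule open_image[OF oU UV])
  define \<phi> where "\<phi> z = f (ci z)" for z
  define \<psi> where "\<psi> z = fh (ci z)" for z
  define u where "u z = v (ci z)" for z
  define w where "w z = vh (ci z)" for z
  have sm: "smooth_on m (c ` U) \<phi>" "smooth_on m (c ` U) \<psi>" "smooth_on m (c ` U) u" "smooth_on m (c ` U) w"
    using smooth_fun_chart[OF f] smooth_fun_chart[OF fh] smooth_fun_chart[OF v] smooth_fun_chart[OF vh]
    unfolding VU \<phi>_def \<psi>_def u_def w_def by auto
  have cid: "chart_vector M (V, c) (ci z) a \<in> tangent_space M (ci z)"
      "vderiv (chart_vector M (V, c) (ci z) a) f = deriv_at m \<phi> z a" "vderiv (chart_vector M (V, c) (ci z) a) v = deriv_at m u z a"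
      "vderiv (chart_vector M (V, c) (ci z) a) fh = deriv_at m \<psi> z a" "vderiv (chart_vector M (V, c) (ci z) a) vh = deriv_at m w z a"
      "ci z \<in> U"
    if zU: "z \<in> c ` U" and aR: "a \<in> RR m" for z a
  proof -
    obtain x where x: "x \<in> U" "z = c x" using zU by blast
    then have xV: "x \<in> V" using UV by blast
    show "chart_vector M (V, c) (ci z) a \<in> tangent_space M (ci z)"
      "vderiv (chart_vector M (V, c) (ci z) a) f = deriv_at m \<phi> z a" "vderiv (chart_vector M (V, c) (ci z) a) v = deriv_at m u z a"
      "vderiv (chart_vector M (V, c) (ci z) a) fh = deriv_at m \<psi> z a" "vderiv (chart_vector M (V, c) (ci z) a) vh = deriv_at m w z a"
      "ci z \<in> U"
      using x xV aR chart_vector_in[OF xV aR] vderiv_chart_vector[OF f x(1) xV aR]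
        vderiv_chart_vector[OF fh x(1) xV aR] vderiv_chart_vector[OF v x(1) xV aR] vderiv_chart_vector[OF vh x(1) xV aR]
      by (simp_all add: \<phi>_def[abs_def] \<psi>_def[abs_def] u_def[abs_def] w_def[abs_def])
  qed
  \<comment> \<open>Columns of the differential of the cylinder at parameter \<open>t\<close> are
    \<open>A j + t *\<^sub>R B j\<close>. The last one, with index \<open>m\<close>, is the
    derivative in \<open>t\<close> and does not change with \<open>t\<close>, whence
    \<open>B m = 0\<close>.\<close>
  define A where "A j z = (if j < m then dir_deriv (unit_seq j) \<phi> z else u z)" for j z
  define B where "B j z = (if j < m then dir_deriv (unit_seq j) u z else 0)" for j z
  have AB_sum: "(\<Sum>j<Suc m. a j *\<^sub>R (A j z + t *\<^sub>R B j z)) =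
     deriv_at m \<phi> z (\<Sum>j<m. a j *\<^sub>R unit_seq j) + t *\<^sub>R deriv_at m u z (\<Sum>j<m. a j *\<^sub>R unit_seq j) + a m *\<^sub>R u z" for a z t
  proof -
    have "(\<Sum>j<m. a j *\<^sub>R (A j z + t *\<^sub>R B j z)) =
       (\<Sum>j<m. a j *\<^sub>R dir_deriv (unit_seq j) \<phi> z + t *\<^sub>R (a j *\<^sub>R dir_deriv (unit_seq j) u z))"
      by (intro sum.cong) (auto simp: A_def B_def scaleR_add_right mult.commute)
    then show ?thesis
      unfolding deriv_at_def coord_sum_unit_seq by (simp add: A_def B_def sum.distrib scaleR_sum_right)
  qed
  have x0V: "x0 \<in> V" using x0 UV by blast
  have "lin_indep (Suc m) (\<lambda>j. A j (c x0) + t0 *\<^sub>R B j (c x0))"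
    unfolding lin_indep_def AB_sum
  proof (intro allI impI)
    fix a i
    let ?a = "\<Sum>j<m. a j *\<^sub>R unit_seq j"
    assume eq: "deriv_at m \<phi> (c x0) ?a + t0 *\<^sub>R deriv_at m u (c x0) ?a + a m *\<^sub>R u (c x0) = 0" and i: "i < Suc m"
    have aR: "?a \<in> RR m" by (intro RR_intros) auto
    have cx0: "c x0 \<in> c ` U" using x0 by blast
    have "chart_vector M (V, c) x0 ?a = (\<lambda>_. 0) \<and> a m = 0"
      using inj[of "chart_vector M (V, c) x0 ?a" "a m"] cid[OF cx0 aR] eq x0V by (simp add: u_def)
    moreover from this have "apply_bcontfun ?a i = 0" if "i < m"
      using chart_vector_coord[OF x0V aR, of i] by simp
    ultimately show "a i = 0" using i unfolding coord_sum_unit_seq by (cases "i < m") (auto simp: less_Suc_eq)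
  qed
  moreover have "continuous_on (c ` U) (A j)" "continuous_on (c ` U) (B j)" if "j < Suc m" for j
    unfolding A_def B_def
    using smooth_on_continuous[OF sm(3)] smooth_on_continuous[OF smooth_on_dir_deriv[OF sm(1) RR_unit_seq]]
      smooth_on_continuous[OF smooth_on_dir_deriv[OF sm(3) RR_unit_seq]]
    by (cases "j < m"; simp)+
  ultimately obtain z1 \<delta> where z1: "z1 \<in> c ` U" "\<delta> > 0"
    "\<And>z t. z \<in> c ` U \<Longrightarrow> dist z z1 < \<delta> \<Longrightarrow> t \<noteq> 0 \<Longrightarrow> \<bar>t\<bar> < \<delta> \<Longrightarrow> lin_indep (Suc m) (\<lambda>j. A j z + t *\<^sub>R B j z)"
    using lin_indep_affine_family[of "Suc m" "c ` U" A B "c x0" t0] x0 by blast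
  define Om where "Om = c ` U \<inter> ball z1 \<delta>"
  have oOm: "open_RR m Om" unfolding Om_def by (rule openin_Int_open[OF oc open_ball])
  have OmU: "Om \<subseteq> c ` U" by (simp add: Om_def)
  define U' where "U' = {x \<in> V. c x \<in> Om}"
  have oU': "openin (mtop M) U'" unfolding U'_def by (rule open_preimage[OF oOm]) (use OmU UV in blast)
  have U'sub: "U' \<subseteq> U"
    using OmU UV inj_onD[OF inj_c] unfolding U'_def by blast
  have cU': "c ` U' = Om" using OmU UV unfolding U'_def by blast
  have U'ne: "U' \<noteq> {}" using z1 cU' unfolding Om_def by auto
  \<comment> \<open>The cylinder over \<open>Om\<close> with parameter in coordinate
    \<open>m\<close>. Its slice at parameter \<open>0\<close> is \<open>Om\<close> itself, because
    \<open>RR m\<close> is contained in \<open>RR (Suc m)\<close>, so the chart \<open>c\<close>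
    serves as the embedding.\<close>
  define N where "N = {y \<in> RR (Suc m). drop_coord m y \<in> Om \<and> \<bar>apply_bcontfun y m\<bar> < \<delta>}"
  have oN: "open_RR (Suc m) N"
  proof -
    obtain T where T: "open T" "Om = RR m \<inter> T" using oOm unfolding openin_open by blast
    have "N = RR (Suc m) \<inter> (drop_coord m -` T \<inter> (\<lambda>y. apply_bcontfun y m) -` {-\<delta><..<\<delta>})"
      unfolding N_def T(2) using drop_coord_RR by (auto simp: abs_less_iff)
    moreover have "open (drop_coord m -` T \<inter> (\<lambda>y::seqs. apply_bcontfun y m) -` {-\<delta><..<\<delta>})"
      by (intro open_Int open_vimage T(1) open_greaterThanLessThan linear_continuous_on bounded_linear_drop_coord bounded_linear_coord)
    ultimately show ?thesis by (simp add: openin_open_Int)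
  qed
  have NR: "N \<subseteq> RR (Suc m)" by (auto simp: N_def)
  have OmR: "Om \<subseteq> RR m" by (rule openin_imp_subset[OF oOm])
  have OmN: "Om \<subseteq> N"
  proof
    fix z assume z: "z \<in> Om"
    then have "z \<in> RR m" using OmR by blast
    then show "z \<in> N" using z z1(2) RR_mono[of m "Suc m"] drop_coord_id by (auto simp: N_def RR_def)
  qed
  let ?N = "open_RR_mfd (Suc m) N" and ?M = "open_submfd M U'"
  define F where "F y = \<phi> (drop_coord m y) + apply_bcontfun y m *\<^sub>R u (drop_coord m y)" for y
  define Fh where "Fh y = \<psi> (drop_coord m y) + apply_bcontfun y m *\<^sub>R w (drop_coord m y)" for y
  have drop_sm: "smooth_on (Suc m) N (drop_coord m)" "drop_coord m ` N \<subseteq> c ` U"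
    using smooth_on_linear[OF oN bounded_linear_drop_coord] OmU by (auto simp: N_def)
  have dropRm: "drop_coord m ` N \<subseteq> RR m" using drop_coord_RR NR by blast
  have dropU: "drop_coord m y \<in> c ` U" if "y \<in> N" for y using drop_sm(2) that by blast
  note Fsm = cylinder_map(1)[OF oc sm(1) sm(3) oN drop_sm(2), folded F_def]
  note Fhsm = cylinder_map(1)[OF oc sm(2) sm(4) oN drop_sm(2), folded Fh_def]
  note Fd = cylinder_map(2)[OF oc sm(1) sm(3) oN drop_sm(2), folded F_def]
  note Fhd = cylinder_map(2)[OF oc sm(2) sm(4) oN drop_sm(2), folded Fh_def]
  have metric: "deriv_at (Suc m) F y a \<bullet> deriv_at (Suc m) F y b = deriv_at (Suc m) Fh y a \<bullet> deriv_at (Suc m) Fh y b"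
    if y: "y \<in> N" and a: "a \<in> RR (Suc m)" and b: "b \<in> RR (Suc m)" for y a b
    using iso[OF cid(6)[OF dropU[OF y] drop_coord_RR[OF a]] cid(1)[OF dropU[OF y] drop_coord_RR[OF a]]
        cid(1)[OF dropU[OF y] drop_coord_RR[OF b]], of "apply_bcontfun y m" "apply_bcontfun a m" "apply_bcontfun b m"]
    unfolding Fd[OF y a] Fd[OF y b] Fhd[OF y a] Fhd[OF y b]
      cid(2-5)[OF dropU[OF y] drop_coord_RR[OF a]] cid(2-5)[OF dropU[OF y] drop_coord_RR[OF b]]
    by (simp add: u_def w_def)
  have Finj: "a = 0" if y: "y \<in> N" "apply_bcontfun y m \<noteq> 0" and a: "a \<in> RR (Suc m)" and 0: "deriv_at (Suc m) F y a = 0" for y a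
  proof -
    have "drop_coord m y \<in> Om" "\<bar>apply_bcontfun y m\<bar> < \<delta>" using y(1) by (auto simp: N_def)
    then have li: "lin_indep (Suc m) (\<lambda>j. A j (drop_coord m y) + apply_bcontfun y m *\<^sub>R B j (drop_coord m y))"
      using z1(3)[of "drop_coord m y" "apply_bcontfun y m"] y(2) by (auto simp: Om_def dist_commute)
    have "(\<Sum>j<m. apply_bcontfun a j *\<^sub>R unit_seq j) = (\<Sum>j<m. apply_bcontfun (drop_coord m a) j *\<^sub>R unit_seq j)"
      by (intro sum.cong) (auto simp: drop_coord_def)
    also have "\<dots> = drop_coord m a" by (rule RR_expand[OF drop_coord_RR[OF a]])
    finally have s: "(\<Sum>j<m. apply_bcontfun a j *\<^sub>R unit_seq j) = drop_coord m a" .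
    have "(\<Sum>j<Suc m. apply_bcontfun a j *\<^sub>R (A j (drop_coord m y) + apply_bcontfun y m *\<^sub>R B j (drop_coord m y))) = 0"
      unfolding AB_sum s using 0 unfolding Fd[OF y(1) a] .
    then have "apply_bcontfun a i = 0" if "i < Suc m" for i
      using li that unfolding lin_indep_def by blast
    then show "a = 0" by (intro RR_eqI[OF a RR_0]) auto
  qed
  have TN: "tangent_space ?N y = chart_vector ?N (N, id) y ` RR (Suc m)" if "y \<in> N" for y
    by (rule tangent_open_RR(1)[OF oN that])
  note dF = tangent_open_RR(2)[OF oN _ Fsm] and dFh = tangent_open_RR(2)[OF oN _ Fhsm]
  have ptsN: "points ?N = N" by (simp add: open_RR_mfd_def)
  have ptsM: "points ?M = U'" by (rule points_open_submfd[OF oU'])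
  have dims: "mdim ?N = Suc m" "mdim ?M = m" by (simp_all add: open_RR_mfd_def open_submfd_def)
  have VU': "V \<inter> U' = U'" unfolding U'_def by blast
  interpret M': mfd_chart ?M U' c using mfd_chart_open_submfd[OF oU' mfd_chart_axioms] unfolding VU' .
  interpret N': mfd_chart ?N N id by (rule mfd_chart_open_RR[OF oN])
  \<comment> \<open>\<open>F\<close> and \<open>Fh\<close> induce the same metric, so a vector
    killed by one differential is killed by the other; injectivity for \<open>F\<close> covers
    both.\<close>
  have imm: "immersion_at ?N F y \<and> immersion_at ?N Fh y" if y: "y \<in> N" "apply_bcontfun y m \<noteq> 0" for y
  proof -
    have *: "a = b" if ab: "a \<in> RR (Suc m)" "b \<in> RR (Suc m)" and
      eq: "deriv_at (Suc m) F y a = deriv_at (Suc m) F y b \<or> deriv_at (Suc m) Fh y a = deriv_at (Suc m) Fh y b" for a b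
    proof -
      interpret dF: bounded_linear "deriv_at (Suc m) F y" by (rule bounded_linear_deriv_at)
      interpret dFh: bounded_linear "deriv_at (Suc m) Fh y" by (rule bounded_linear_deriv_at)
      have R: "a - b \<in> RR (Suc m)" using ab by (rule RR_diff)
      have "deriv_at (Suc m) F y (a - b) = 0 \<or> deriv_at (Suc m) Fh y (a - b) = 0"
        using eq by (simp add: dF.diff dFh.diff)
      then have "deriv_at (Suc m) F y (a - b) = 0"
        using metric[OF y(1) R R] by (metis inner_eq_zero_iff)
      then show "a = b" using Finj[OF y R] by simp
    qed
    show ?thesis
      unfolding immersion_at_def TN[OF y(1)]
      by (intro conjI inj_onI; clarify) (use * dF[OF y(1)] dFh[OF y(1)] in metis)+
  qed
  have "singularly_extend ?M f fh"
    unfolding singularly_extend_def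
  proof (intro exI conjI)
    show "(1::nat) > 0" by simp
    show "smooth_manifold ?N" by (rule N'.smooth)
    show "mdim ?N = mdim ?M + 1" using dims by simp
    show "smooth_fun ?N (points ?N) F" "smooth_fun ?N (points ?N) Fh"
      unfolding ptsN by (rule smooth_fun_open_RR[OF oN Fsm], rule smooth_fun_open_RR[OF oN Fhsm])
    show "\<forall>y\<in>points ?N. \<forall>X\<in>tangent_space ?N y. \<forall>Y\<in>tangent_space ?N y. vderiv X F \<bullet> vderiv Y F = vderiv X Fh \<bullet> vderiv Y Fh"
    proof (intro ballI)
      fix y X Y assume "y \<in> points ?N" and XY: "X \<in> tangent_space ?N y" "Y \<in> tangent_space ?N y"
      then have y: "y \<in> N" using ptsN by simp
      obtain a b where "a \<in> RR (Suc m)" "X = chart_vector ?N (N, id) y a" "b \<in> RR (Suc m)" "Y = chart_vector ?N (N, id) y b"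
        using XY TN[OF y] by blast
      then show "vderiv X F \<bullet> vderiv Y F = vderiv X Fh \<bullet> vderiv Y Fh"
        using metric[OF y] dF[OF y] dFh[OF y] by simp
    qed
    show "\<forall>x\<in>points ?M. f x = F (c x) \<and> fh x = Fh (c x)"
    proof
      fix x assume "x \<in> points ?M"
      then have x: "x \<in> V" "c x \<in> Om" using ptsM U'_def by auto
      then have cx: "c x \<in> RR m" using OmR by blast
      then show "f x = F (c x) \<and> fh x = Fh (c x)"
        using x(1) by (simp add: F_def Fh_def drop_coord_id \<phi>_def \<psi>_def) (simp add: RR_def)
    qed
    show "{y \<in> points ?N. \<not> immersion_at ?N F y \<or> \<not> immersion_at ?N Fh y} \<subseteq> c ` points ?M"
    proof clarify
      fix y assume "y \<in> points ?N" and ni: "\<not> immersion_at ?N F y \<or> \<not> immersion_at ?N Fh y"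
      then have y: "y \<in> N" using ptsN by simp
      \<comment> \<open>Singular points have parameter \<open>0\<close>, and such points are exactly
        the image of the embedding.\<close>
      have "apply_bcontfun y m = 0" using imm[OF y] ni by blast
      then have "drop_coord m y = y" by (simp add: drop_coord_def)
      then show "y \<in> c ` points ?M" using y cU' ptsM by (auto simp: N_def)
    qed
    show "smooth_embedding ?M ?N c"
      unfolding smooth_embedding_def
    proof (intro conjI ballI)
      have hom: "homeomorphic_map (mtop ?M) (subtopology (top_of_set N) Om) c"
      proof -
        have "subtopology (mtop ?M) U' = mtop ?M" using ptsM by (metis subtopology_topspace)
        moreover have "subtopology (top_of_set N) Om = top_of_set Om"
          using OmN by (simp add: subtopology_subtopology inf_absorb2)
        ultimately show ?thesis using M'.chart_props(3) cU' by simp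
      qed
      then show "embedding_map (mtop ?M) (mtop ?N) c"
        unfolding embedding_map_def ptsM cU' by (simp add: open_RR_mfd_def)
      show "smooth_map ?M ?N c"
        unfolding smooth_map_def
      proof (intro conjI ballI, safe)
        show "continuous_map (mtop ?M) (mtop ?N) c"
          using homeomorphic_imp_continuous_map[OF hom] by (simp add: continuous_map_in_subtopology open_RR_mfd_def)
        fix W d W' d' assume Wd: "(W, d) \<in> mcharts ?M" and "(W', d') \<in> mcharts ?N"
        then have N: "W' = N" "d' = id" by (simp_all add: open_RR_mfd_def)
        interpret W: mfd_chart ?M W d by (rule M'.mfd_chartI[OF Wd])
        have WU: "W \<subseteq> U'" using W.V_subset ptsM by simp
        have "smooth_on m (d ` (W \<inter> U')) (\<lambda>z. c (inv_into W d z))"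
          using W.smooth_fun_chart[OF M'.smooth_fun_c] dims by simp
        moreover have "{x \<in> W. c x \<in> W'} = W \<inter> U'" using WU OmN cU' N by blast
        ultimately show "smooth_on (mdim ?M) (d ` {x \<in> W. c x \<in> W'}) (d' \<circ> c \<circ> inv_into W d)"
          using dims N by (simp add: comp_def)
      qed
      fix x assume "x \<in> points ?M"
      then have x: "x \<in> U'" using ptsM by simp
      have cx: "c x \<in> N" using x cU' OmN by blast
      show "inj_on (pushforward ?N c x) (tangent_space ?M x)"
      proof (rule inj_onI)
        fix X Y assume XY: "X \<in> tangent_space ?M x" "Y \<in> tangent_space ?M x" and eq: "pushforward ?N c x X = pushforward ?N c x Y"
        obtain a b where ab: "a \<in> RR m" "X = chart_vector ?M (U', c) x a" "b \<in> RR m" "Y = chart_vector ?M (U', c) x b"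
          using XY M'.tangent_space_eq[OF x] dims by auto
        have "X (\<lambda>x. apply_bcontfun (c x) i) = Y (\<lambda>x. apply_bcontfun (c x) i)" for i
        proof -
          have "smooth_at ?N (c x) (\<lambda>y. apply_bcontfun y i)"
            unfolding smooth_at_def using cx smooth_fun_open_RR[OF oN smooth_on_linear[OF oN bounded_linear_coord]] by blast
          then show ?thesis using fun_cong[OF eq, of "\<lambda>y. apply_bcontfun y i"] by (simp add: pushforward_def comp_def)
        qed
        then have "a = b" using M'.chart_vector_inj[OF x, of a b] ab dims by simp
        then show "X = Y" using ab by simp
      qed
    qed
  qed
  then show ?thesis using oU' U'ne by blast
qed

end

subsection \<open>Orthogonal projections\<close>

lemma orth_proj_eq:
  assumes "subspace E" "u \<in> E" "\<And>z. z \<in> E \<Longrightarrow> (w - u) \<bullet> z = 0"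
  shows "orth_proj E w = u"
  unfolding orth_proj_def
proof (rule the_equality)
  show "u \<in> E \<and> (\<forall>z\<in>E. orthogonal (w - u) z)" using assms by (simp add: orthogonal_def)
  fix u' assume u': "u' \<in> E \<and> (\<forall>z\<in>E. orthogonal (w - u') z)"
  then have "u' - u \<in> E" using assms(1,2) subspace_diff by blast
  then have "(w - u) \<bullet> (u' - u) = 0" "(w - u') \<bullet> (u' - u) = 0" using u' assms(3) by (auto simp: orthogonal_def)
  then have "(u' - u) \<bullet> (u' - u) = 0" by (simp add: inner_diff_left)
  then show "u' = u" by simp
qed

lemma orth_proj_in:
  fixes E :: "'v::euclidean_space set"
  assumes "subspace E"
  shows "orth_proj E w \<in> E" and "z \<in> E \<Longrightarrow> orth_proj E w \<bullet> z = w \<bullet> z"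
proof -
  obtain y z where yz: "y \<in> span E" "\<And>w. w \<in> span E \<Longrightarrow> orthogonal z w" "w = y + z"
    using orthogonal_subspace_decomp_exists[of E w] by metis
  have E: "span E = E" using assms by (simp add: span_eq_iff)
  have p: "orth_proj E w = y"
    by (rule orth_proj_eq[OF assms]) (use yz E in \<open>auto simp: orthogonal_def\<close>)
  show "orth_proj E w \<in> E" using p yz E by simp
  show "z' \<in> E \<Longrightarrow> orth_proj E w \<bullet> z' = w \<bullet> z'" for z'
    unfolding p using yz(2)[of z'] E by (simp add: yz(3) orthogonal_def inner_add_left)
qed

text \<open>The splitting of the ambient space into tangent space, the fibre of \<open>L\<close>,
  and its complement in the normal space. The last summand is where \<open>phi\<close> takes its
  values.\<close>

lemma orth_proj_split:
  fixes T L :: "'v::euclidean_space set"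
  assumes T: "subspace T" and L: "subspace L" "L \<subseteq> T\<^sup>\<bottom>"
  shows "w = orth_proj T w + orth_proj L w + orth_proj (T\<^sup>\<bottom> \<inter> L\<^sup>\<bottom>) w"
proof -
  let ?r = "w - orth_proj T w - orth_proj L w"
  have TL: "a \<bullet> b = 0" if "a \<in> T" "b \<in> L" for a b
    using L(2) that by (auto simp: orthogonal_comp_def orthogonal_def)
  have E: "subspace (T\<^sup>\<bottom> \<inter> L\<^sup>\<bottom>)" by (intro subspace_inter subspace_orthogonal_comp)
  have "a \<bullet> ?r = 0" if "a \<in> T" for a
    using orth_proj_in(2)[OF T that, of w] TL[OF that orth_proj_in(1)[OF L(1), of w]]
    by (simp add: inner_diff_right inner_commute)
  moreover have "b \<bullet> ?r = 0" if "b \<in> L" for b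
    using orth_proj_in(2)[OF L(1) that, of w] TL[OF orth_proj_in(1)[OF T, of w] that]
    by (simp add: inner_diff_right inner_commute)
  ultimately have "?r \<in> T\<^sup>\<bottom> \<inter> L\<^sup>\<bottom>" by (simp add: orthogonal_comp_def orthogonal_def)
  then have "orth_proj (T\<^sup>\<bottom> \<inter> L\<^sup>\<bottom>) w = ?r"
  proof (rule orth_proj_eq[OF E])
    fix z assume "z \<in> T\<^sup>\<bottom> \<inter> L\<^sup>\<bottom>"
    then have "orth_proj T w \<bullet> z = 0" "orth_proj L w \<bullet> z = 0"
      using orth_proj_in(1)[OF T] orth_proj_in(1)[OF L(1)] by (auto simp: orthogonal_comp_def orthogonal_def)
    then show "(w - ?r) \<bullet> z = 0" by (simp add: inner_add_left)
  qed
  then show ?thesis by simp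
qed

lemma inner_orth_proj_split:
  fixes T L :: "'v::euclidean_space set"
  assumes T: "subspace T" and L: "subspace L" "L \<subseteq> T\<^sup>\<bottom>"
  shows "w \<bullet> w' = orth_proj T w \<bullet> orth_proj T w' + orth_proj L w \<bullet> orth_proj L w'
    + orth_proj (T\<^sup>\<bottom> \<inter> L\<^sup>\<bottom>) w \<bullet> orth_proj (T\<^sup>\<bottom> \<inter> L\<^sup>\<bottom>) w'"
proof -
  have E: "subspace (T\<^sup>\<bottom> \<inter> L\<^sup>\<bottom>)" by (intro subspace_inter subspace_orthogonal_comp)
  have "w \<bullet> w' = w \<bullet> (orth_proj T w' + orth_proj L w' + orth_proj (T\<^sup>\<bottom> \<inter> L\<^sup>\<bottom>) w')"
    using orth_proj_split[OF assms, of w'] by simp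
  then show ?thesis
    using orth_proj_in(2)[OF T orth_proj_in(1)[OF T]] orth_proj_in(2)[OF L(1) orth_proj_in(1)[OF L(1)]]
      orth_proj_in(2)[OF E orth_proj_in(1)[OF E]] by (simp add: inner_add_right)
qed

section \<open>Isometric cylinders over sections of \<open>D\<close>\<close>

locale deformation = smooth_mfd M for M :: "'a mfd" +
  fixes G :: "'a metric"
    and f :: "'a \<Rightarrow> 'v::euclidean_space" and fh :: "'a \<Rightarrow> 'w::euclidean_space"
    and L :: "'a \<Rightarrow> 'v set" and Lh :: "'a \<Rightarrow> 'w set" and \<tau> :: "'a \<Rightarrow> 'v \<Rightarrow> 'w"
    and D :: "'a \<Rightarrow> ('a tvec \<times> 'v) set" and l d :: nat
  assumes f: "isometric_immersion M G f" and fh: "isometric_immersion M G fh"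
    and genuine: "strongly_genuine M f fh"
    and L: "normal_subbundle M f l L" and Lh: "normal_subbundle M fh l Lh"
    and \<tau>: "bundle_isometry M L Lh \<tau>"
    and \<tau>_sff: "preserves_sff M f fh L Lh \<tau>" and \<tau>_parallel: "parallel_isometry M f fh L Lh \<tau>"
    and D: "subbundle_TM_plus M L d D"
    and null: "\<forall>x\<in>points M. null_subset (phi_image M f fh L Lh \<tau> D x)"

context smooth_mfd
begin

lemma subspace_tangent_image:
  assumes "x \<in> points M"
  shows "subspace ((\<lambda>X. vderiv X h) ` tangent_space M x)"
  unfolding subspace_def
proof (intro conjI ballI allI)
  have z: "vderiv (\<lambda>_. 0) h = 0" by (simp add: vderiv_def)
  show "0 \<in> (\<lambda>X. vderiv X h) ` tangent_space M x"
    using tangent_zero[OF assms] z by (metis image_eqI)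
  fix u assume "u \<in> (\<lambda>X. vderiv X h) ` tangent_space M x"
  then obtain X where X: "X \<in> tangent_space M x" "u = vderiv X h" by blast
  {
    fix w assume "w \<in> (\<lambda>X. vderiv X h) ` tangent_space M x"
    then obtain Y where Y: "Y \<in> tangent_space M x" "w = vderiv Y h" by blast
    show "u + w \<in> (\<lambda>X. vderiv X h) ` tangent_space M x"
      using tangent_linear[OF assms X(1) Y(1), of 1 1] vderiv_linear_left[of 1 X 1 Y h] X(2) Y(2)
      by (intro image_eqI) auto
  }
  fix r :: real
  show "r *\<^sub>R u \<in> (\<lambda>X. vderiv X h) ` tangent_space M x"
    using tangent_linear[OF assms X(1) X(1), of r 0] vderiv_linear_left[of r X 0 X h] X(2)
    by (intro image_eqI) auto
qed

lemma immersion_kernel: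
  assumes f: "isometric_immersion M G f" and x: "x \<in> points M" and X: "X \<in> tangent_space M x" and 0: "vderiv X f = 0"
  shows "X = (\<lambda>_. 0)"
proof -
  have "vderiv (\<lambda>_. 0) f = 0" by (simp add: vderiv_def)
  moreover have "inj_on (\<lambda>X. vderiv X f) (tangent_space M x)"
    using f x unfolding isometric_immersion_def immersion_at_def by blast
  ultimately show ?thesis using tangent_zero[OF x] X 0 by (metis (mono_tags, lifting) inj_onD)
qed

end

section \<open>Comparison of inner products for the two immersions\<close>

context deformation
begin

lemma fiber_L: "x \<in> points M \<Longrightarrow> subspace (L x) \<and> L x \<subseteq> normal_space M f x"
  using L unfolding normal_subbundle_def by (metis subspace_span)

lemma fiber_Lh: "x \<in> points M \<Longrightarrow> subspace (Lh x) \<and> Lh x \<subseteq> normal_space M fh x"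
  using Lh unfolding normal_subbundle_def by (metis subspace_span)

lemma \<tau>_props:
  assumes "x \<in> points M" "u \<in> L x"
  shows "\<tau> x u \<in> Lh x" "v \<in> L x \<Longrightarrow> \<tau> x u \<bullet> \<tau> x v = u \<bullet> v"
  using \<tau> assms unfolding bundle_isometry_def bij_betw_def by blast+

lemma \<tau>_surj: "x \<in> points M \<Longrightarrow> w \<in> Lh x \<Longrightarrow> \<exists>u\<in>L x. w = \<tau> x u"
  using \<tau> unfolding bundle_isometry_def bij_betw_def by blast

lemma normal_inner:
  assumes "\<eta> \<in> normal_space M h x" "X \<in> tangent_space M x"
  shows "\<eta> \<bullet> vderiv X h = 0" "vderiv X h \<bullet> \<eta> = 0"
  using assms by (auto simp: normal_space_def orthogonal_comp_def orthogonal_def inner_commute)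

lemma f_inner: "x \<in> points M \<Longrightarrow> X \<in> tangent_space M x \<Longrightarrow> Y \<in> tangent_space M x \<Longrightarrow> vderiv X f \<bullet> vderiv Y f = vderiv X fh \<bullet> vderiv Y fh"
  using f fh unfolding isometric_immersion_def by metis

text \<open>In the splitting into tangent, \<open>L\<close> and remaining normal parts, the first
  two inner products agree because both immersions induce \<open>G\<close> and \<open>\<tau>\<close>
  is isometric. Only the third needs a separate hypothesis, which nullity of \<open>phi\<close> will
  supply.\<close>

lemma inner_transfer:
  assumes x: "x \<in> points M"
    and T: "\<And>Z. Z \<in> tangent_space M x \<Longrightarrow> w \<bullet> vderiv Z f = wh \<bullet> vderiv Z fh"
      "\<And>Z. Z \<in> tangent_space M x \<Longrightarrow> w' \<bullet> vderiv Z f = wh' \<bullet> vderiv Z fh"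
    and N: "\<And>\<eta>. \<eta> \<in> L x \<Longrightarrow> w \<bullet> \<eta> = wh \<bullet> \<tau> x \<eta>" "\<And>\<eta>. \<eta> \<in> L x \<Longrightarrow> w' \<bullet> \<eta> = wh' \<bullet> \<tau> x \<eta>"
    and E: "orth_proj (normal_space M f x \<inter> (L x)\<^sup>\<bottom>) w \<bullet> orth_proj (normal_space M f x \<inter> (L x)\<^sup>\<bottom>) w' =
      orth_proj (normal_space M fh x \<inter> (Lh x)\<^sup>\<bottom>) wh \<bullet> orth_proj (normal_space M fh x \<inter> (Lh x)\<^sup>\<bottom>) wh'"
  shows "w \<bullet> w' = wh \<bullet> wh'"
proof -
  let ?T = "(\<lambda>X. vderiv X f) ` tangent_space M x" and ?Th = "(\<lambda>X. vderiv X fh) ` tangent_space M x"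
  have sT: "subspace ?T" "subspace ?Th" by (rule subspace_tangent_image[OF x])+
  have LL: "subspace (L x)" "L x \<subseteq> ?T\<^sup>\<bottom>" "subspace (Lh x)" "Lh x \<subseteq> ?Th\<^sup>\<bottom>"
    using fiber_L[OF x] fiber_Lh[OF x] by (auto simp: normal_space_def)
  \<comment> \<open>Equal products with all tangent images mean that both tangential parts come from
    one and the same tangent vector of \<open>M\<close>.\<close>
  have pT: "\<exists>Z\<in>tangent_space M x. orth_proj ?T u = vderiv Z f \<and> orth_proj ?Th uh = vderiv Z fh"
    if u: "\<And>Z. Z \<in> tangent_space M x \<Longrightarrow> u \<bullet> vderiv Z f = uh \<bullet> vderiv Z fh" for u uh
  proof -
    obtain Z where Z: "Z \<in> tangent_space M x" "orth_proj ?T u = vderiv Z f" using orth_proj_in(1)[OF sT(1), of u] by blast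
    have "orth_proj ?Th uh = vderiv Z fh"
    proof (rule orth_proj_eq[OF sT(2)])
      show "vderiv Z fh \<in> ?Th" using Z(1) by blast
      fix z assume "z \<in> ?Th"
      then obtain S where S: "S \<in> tangent_space M x" "z = vderiv S fh" by blast
      have "orth_proj ?T u \<bullet> vderiv S f = u \<bullet> vderiv S f" using S(1) by (intro orth_proj_in(2)[OF sT(1)]) blast
      then show "(uh - vderiv Z fh) \<bullet> z = 0"
        using u[OF S(1)] f_inner[OF x Z(1) S(1)] Z(2) S(2) by (simp add: inner_diff_left)
    qed
    then show ?thesis using Z by blast
  qed
  have pL: "orth_proj (Lh x) uh = \<tau> x (orth_proj (L x) u)" if u: "\<And>\<eta>. \<eta> \<in> L x \<Longrightarrow> u \<bullet> \<eta> = uh \<bullet> \<tau> x \<eta>" for u uh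
  proof (rule orth_proj_eq[OF LL(3)])
    have p: "orth_proj (L x) u \<in> L x" by (rule orth_proj_in(1)[OF LL(1)])
    show "\<tau> x (orth_proj (L x) u) \<in> Lh x" by (rule \<tau>_props(1)[OF x p])
    fix z assume "z \<in> Lh x"
    then obtain \<eta> where \<eta>: "\<eta> \<in> L x" "z = \<tau> x \<eta>" using \<tau>_surj[OF x] by blast
    show "(uh - \<tau> x (orth_proj (L x) u)) \<bullet> z = 0"
      using u[OF \<eta>(1)] \<tau>_props(2)[OF x p \<eta>(1)] orth_proj_in(2)[OF LL(1) \<eta>(1), of u] \<eta>(2) by (simp add: inner_diff_left)
  qed
  obtain Z where Z: "Z \<in> tangent_space M x" "orth_proj ?T w = vderiv Z f" "orth_proj ?Th wh = vderiv Z fh" using pT[OF T(1)] by blast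
  obtain Z' where Z': "Z' \<in> tangent_space M x" "orth_proj ?T w' = vderiv Z' f" "orth_proj ?Th wh' = vderiv Z' fh" using pT[OF T(2)] by blast
  have "orth_proj (L x) w \<bullet> orth_proj (L x) w' = orth_proj (Lh x) wh \<bullet> orth_proj (Lh x) wh'"
    using pL[OF N(1)] pL[OF N(2)] \<tau>_props(2)[OF x orth_proj_in(1)[OF LL(1)] orth_proj_in(1)[OF LL(1)], of w w'] by simp
  then show ?thesis
    unfolding inner_orth_proj_split[OF sT(1) LL(1,2), of w w'] inner_orth_proj_split[OF sT(2) LL(3,4), of wh wh']
    using Z Z' f_inner[OF x Z(1) Z'(1)] E unfolding normal_space_def by simp
qed

lemma f_smooth:
  assumes "openin (mtop M) U"
  shows "smooth_fun M U f" "smooth_fun M U fh"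
  using f fh smooth_fun_subset[OF _ assms openin_subset[OF assms]] unfolding isometric_immersion_def by blast+

lemma sff_inner:
  fixes h :: "'a \<Rightarrow> 'u::euclidean_space"
  assumes x: "x \<in> points M" and \<eta>: "\<eta> \<in> E" and E: "subspace E" "E \<subseteq> normal_space M h x"
  shows "vderiv X (\<lambda>y. vderiv (Y y) h) \<bullet> \<eta> = orth_proj E (sff M h x X Y) \<bullet> \<eta>"
    and "vderiv X \<xi> \<bullet> \<eta> = orth_proj E (normal_connection M h x X \<xi>) \<bullet> \<eta>"
proof -
  have N: "subspace (normal_space M h x)" unfolding normal_space_def by (rule subspace_orthogonal_comp)
  have \<eta>N: "\<eta> \<in> normal_space M h x" using \<eta> E by blast
  show "vderiv X (\<lambda>y. vderiv (Y y) h) \<bullet> \<eta> = orth_proj E (sff M h x X Y) \<bullet> \<eta>"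
    unfolding orth_proj_in(2)[OF E(1) \<eta>] sff_def orth_proj_in(2)[OF N \<eta>N] ..
  show "vderiv X \<xi> \<bullet> \<eta> = orth_proj E (normal_connection M h x X \<xi>) \<bullet> \<eta>"
    unfolding orth_proj_in(2)[OF E(1) \<eta>] normal_connection_def orth_proj_in(2)[OF N \<eta>N] ..
qed

text \<open>Differentiate the identity \<open>\<xi> \<bullet> h\<^sub>*Z = 0\<close>: the Weingarten
  relation, which turns tangential parts of derivatives of normal sections into second fundamental
  forms.\<close>

lemma normal_section_inner:
  fixes h :: "'a \<Rightarrow> 'u::euclidean_space"
  assumes \<xi>: "smooth_fun M U \<xi>" "\<And>y. y \<in> U \<Longrightarrow> \<xi> y \<in> normal_space M h y" and h: "smooth_fun M U h"
    and Z: "vector_field M U Z" and X: "X \<in> tangent_space M x" and x: "x \<in> U"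
  shows "vderiv X \<xi> \<bullet> vderiv (Z x) h = - (\<xi> x \<bullet> vderiv X (\<lambda>y. vderiv (Z y) h))"
proof -
  have oU: "openin (mtop M) U" by (rule smooth_fun_openin[OF h])
  have "X (\<lambda>y. \<xi> y \<bullet> vderiv (Z y) h) = X (\<lambda>y. 0 \<bullet> (0::'u))"
    by (rule tangent_cong[OF X oU x]) (simp add: normal_inner(1)[OF \<xi>(2) vector_fieldD(2)[OF Z]])
  also have "\<dots> = 0" using vderiv_inner[OF X x smooth_fun_const[OF oU, of "0::'u"] smooth_fun_const[OF oU, of "0::'u"]] by simp
  finally show ?thesis
    using vderiv_inner[OF X x \<xi>(1) smooth_fun_vderiv[OF Z h]] by simp
qed

context
  fixes U Y \<xi> v vh
  assumes Y: "vector_field M U Y" and \<xi>: "normal_section M L U \<xi>"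
  defines "v \<equiv> \<lambda>y. vderiv (Y y) f + \<xi> y" and "vh \<equiv> \<lambda>y. vderiv (Y y) fh + \<tau> y (\<xi> y)"
begin

lemma section_open: "openin (mtop M) U" by (rule vector_fieldD(1)[OF Y])
lemma section_points: "x \<in> U \<Longrightarrow> x \<in> points M" using section_open openin_subset by blast
lemma \<xi>_smooth: "smooth_fun M U \<xi>" "smooth_fun M U (\<lambda>y. \<tau> y (\<xi> y))"
  using \<xi> \<tau> unfolding normal_section_def bundle_isometry_def by blast+
lemma \<xi>_in: "y \<in> U \<Longrightarrow> \<xi> y \<in> L y" using \<xi> unfolding normal_section_def by blast
lemma Yf_smooth: "smooth_fun M U (\<lambda>y. vderiv (Y y) f)" "smooth_fun M U (\<lambda>y. vderiv (Y y) fh)"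
  using smooth_fun_vderiv[OF Y f_smooth(1)[OF section_open]] smooth_fun_vderiv[OF Y f_smooth(2)[OF section_open]] by auto
lemma v_smooth: "smooth_fun M U v" "smooth_fun M U vh"
  unfolding v_def vh_def using smooth_fun_add Yf_smooth \<xi>_smooth by blast+

text \<open>Tangential parts match by the Koszul formula for \<open>Y\<close> and the Weingarten
  relation for \<open>\<xi>\<close>; parts in \<open>L\<close> match because \<open>\<tau>\<close>
  preserves second fundamental forms and is parallel. What remains of the derivative of
  \<open>v\<close> is the value of \<open>phi\<close>.\<close>

lemma derivative_transfer:
  assumes x: "x \<in> U" and X: "X \<in> tangent_space M x"
  shows "Z \<in> tangent_space M x \<Longrightarrow> vderiv X v \<bullet> vderiv Z f = vderiv X vh \<bullet> vderiv Z fh"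
    and "\<eta> \<in> L x \<Longrightarrow> vderiv X v \<bullet> \<eta> = vderiv X vh \<bullet> \<tau> x \<eta>"
proof -
  have xM: "x \<in> points M" by (rule section_points[OF x])
  have dv: "vderiv X v = vderiv X (\<lambda>y. vderiv (Y y) f) + vderiv X \<xi>"
    unfolding v_def by (rule vderiv_add[OF X x Yf_smooth(1) \<xi>_smooth(1)])
  have dvh: "vderiv X vh = vderiv X (\<lambda>y. vderiv (Y y) fh) + vderiv X (\<lambda>y. \<tau> y (\<xi> y))"
    unfolding vh_def by (rule vderiv_add[OF X x Yf_smooth(2) \<xi>_smooth(2)])
  note Lx = fiber_L[OF xM] and Lhx = fiber_Lh[OF xM]
  have \<tau>x: "\<tau> x \<eta> \<in> Lh x" if "\<eta> \<in> L x" for \<eta> by (rule \<tau>_props(1)[OF xM that])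
  have sffL: "\<tau> x (orth_proj (L x) (sff M f x X S)) = orth_proj (Lh x) (sff M fh x X S)" if "vector_field M W S" "x \<in> W" for W S
    using \<tau>_sff that X unfolding preserves_sff_def by blast
  have pL: "orth_proj (L x) a \<in> L x" for a using orth_proj_in(1) Lx by blast
  have sffT: "vderiv X (\<lambda>y. vderiv (S y) f) \<bullet> \<eta> = vderiv X (\<lambda>y. vderiv (S y) fh) \<bullet> \<tau> x \<eta>"
    if "vector_field M W S" "x \<in> W" and \<eta>: "\<eta> \<in> L x" for W S \<eta>
    using sff_inner(1)[OF xM \<eta>, of f X S] sff_inner(1)[OF xM \<tau>x[OF \<eta>], of fh X S] Lx Lhx
      \<tau>_props(2)[OF xM pL \<eta>] sffL[OF that(1,2)] by metis
  show "vderiv X v \<bullet> \<eta> = vderiv X vh \<bullet> \<tau> x \<eta>" if \<eta>: "\<eta> \<in> L x"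
  proof -
    have "\<tau> x (orth_proj (L x) (normal_connection M f x X \<xi>)) = orth_proj (Lh x) (normal_connection M fh x X (\<lambda>y. \<tau> y (\<xi> y)))"
      using \<tau>_parallel \<xi> x X unfolding parallel_isometry_def by blast
    then have "vderiv X \<xi> \<bullet> \<eta> = vderiv X (\<lambda>y. \<tau> y (\<xi> y)) \<bullet> \<tau> x \<eta>"
      using sff_inner(2)[OF xM \<eta>, of f X \<xi>] sff_inner(2)[OF xM \<tau>x[OF \<eta>], of fh X "\<lambda>y. \<tau> y (\<xi> y)"] Lx Lhx
        \<tau>_props(2)[OF xM pL \<eta>] by metis
    then show ?thesis using sffT[OF Y x \<eta>] unfolding dv dvh by (simp add: inner_add_left)
  qed
  show "vderiv X v \<bullet> vderiv Z f = vderiv X vh \<bullet> vderiv Z fh" if Z: "Z \<in> tangent_space M x"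
  proof -
    \<comment> \<open>The Koszul formula speaks of fields on a common domain, so the vectors
      \<open>X\<close> and \<open>Z\<close> are extended and everything is restricted to
      \<open>W\<close>.\<close>
    obtain W1 X' where X': "x \<in> W1" "vector_field M W1 X'" "X' x = X" using tangent_extend[OF xM X] .
    obtain W2 Z' where Z': "x \<in> W2" "vector_field M W2 Z'" "Z' x = Z" using tangent_extend[OF xM Z] .
    define W where "W = U \<inter> (W1 \<inter> W2)"
    have W: "openin (mtop M) W" "x \<in> W" "W \<subseteq> U" "W \<subseteq> W1" "W \<subseteq> W2"
      unfolding W_def using x X' Z' vector_fieldD(1)[OF X'(2)] vector_fieldD(1)[OF Z'(2)] section_open by (auto intro: openin_Int)
    note vf = vector_field_subset[OF X'(2) W(1,4)] vector_field_subset[OF Y W(1,3)] vector_field_subset[OF Z'(2) W(1,5)]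
    have 1: "vderiv X (\<lambda>y. vderiv (Y y) f) \<bullet> vderiv Z f = vderiv X (\<lambda>y. vderiv (Y y) fh) \<bullet> vderiv Z fh"
      using koszul[OF f vf W(2)] koszul[OF fh vf W(2)] X'(3) Z'(3) by simp
    \<comment> \<open>Both sides reduce to second derivatives in the direction of
      \<open>\<xi>\<close> and \<open>\<tau> \<xi>\<close>, which agree since \<open>\<xi>\<close>
      lies in \<open>L\<close>.\<close>
    have "vderiv X \<xi> \<bullet> vderiv (Z' x) f = - (\<xi> x \<bullet> vderiv X (\<lambda>y. vderiv (Z' y) f))"
      by (rule normal_section_inner[OF smooth_fun_subset[OF \<xi>_smooth(1) W(1,3)] _ f_smooth(1)[OF W(1)] vf(3) X W(2)])
         (use \<xi>_in fiber_L section_points W(3) in blast)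
    moreover have "vderiv X (\<lambda>y. \<tau> y (\<xi> y)) \<bullet> vderiv (Z' x) fh = - (\<tau> x (\<xi> x) \<bullet> vderiv X (\<lambda>y. vderiv (Z' y) fh))"
      by (rule normal_section_inner[OF smooth_fun_subset[OF \<xi>_smooth(2) W(1,3)] _ f_smooth(2)[OF W(1)] vf(3) X W(2)])
         (use \<xi>_in \<tau>_props(1) fiber_Lh section_points W(3) in blast)
    moreover have "\<xi> x \<bullet> vderiv X (\<lambda>y. vderiv (Z' y) f) = \<tau> x (\<xi> x) \<bullet> vderiv X (\<lambda>y. vderiv (Z' y) fh)"
      using sffT[OF vf(3) W(2) \<xi>_in[OF x]] by (simp add: inner_commute)
    ultimately show ?thesis
      using 1 Z'(3) unfolding dv dvh by (simp add: inner_add_left)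
  qed
qed

text \<open>Vectors \<open>f\<^sub>*X\<close> and \<open>v\<close> have no component normal to both
  \<open>TM\<close> and \<open>L\<close>. Hence the part of the differential not matched by
  \<open>inner_transfer\<close> is \<open>t\<close> times a value of \<open>phi\<close> on
  \<open>D\<close>, and nullity says precisely that these values have equal products on the two
  sides.\<close>

lemma cylinder_metric:
  assumes x: "x \<in> U" and X: "X \<in> tangent_space M x" "X' \<in> tangent_space M x" and YD: "(Y x, \<xi> x) \<in> D x"
  shows "(vderiv X f + t *\<^sub>R vderiv X v + r *\<^sub>R v x) \<bullet> (vderiv X' f + t *\<^sub>R vderiv X' v + r' *\<^sub>R v x) =
      (vderiv X fh + t *\<^sub>R vderiv X vh + r *\<^sub>R vh x) \<bullet> (vderiv X' fh + t *\<^sub>R vderiv X' vh + r' *\<^sub>R vh x)"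
proof -
  have xM: "x \<in> points M" by (rule section_points[OF x])
  have Yx: "Y x \<in> tangent_space M x" by (rule vector_fieldD(2)[OF Y x])
  have \<xi>N: "\<xi> x \<in> normal_space M f x" "\<tau> x (\<xi> x) \<in> normal_space M fh x"
    using \<xi>_in[OF x] fiber_L[OF xM] fiber_Lh[OF xM] \<tau>_props(1)[OF xM] by blast+
  let ?w = "\<lambda>X r. vderiv X f + t *\<^sub>R vderiv X v + r *\<^sub>R v x" and ?wh = "\<lambda>X r. vderiv X fh + t *\<^sub>R vderiv X vh + r *\<^sub>R vh x"
  let ?E = "normal_space M f x \<inter> (L x)\<^sup>\<bottom>" and ?Eh = "normal_space M fh x \<inter> (Lh x)\<^sup>\<bottom>"
  have T: "?w X r \<bullet> vderiv Z f = ?wh X r \<bullet> vderiv Z fh" if "X \<in> tangent_space M x" "Z \<in> tangent_space M x" for X Z r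
    using f_inner[OF xM that] derivative_transfer(1)[OF x that] f_inner[OF xM Yx that(2)]
      normal_inner(1)[OF \<xi>N(1) that(2)] normal_inner(1)[OF \<xi>N(2) that(2)]
    by (simp add: inner_add_left) (simp add: v_def vh_def inner_add_left)
  have N: "?w X r \<bullet> \<eta> = ?wh X r \<bullet> \<tau> x \<eta>" if X: "X \<in> tangent_space M x" and \<eta>: "\<eta> \<in> L x" for X \<eta> r
  proof -
    have "\<eta> \<in> normal_space M f x" "\<tau> x \<eta> \<in> normal_space M fh x"
      using \<eta> fiber_L[OF xM] fiber_Lh[OF xM] \<tau>_props(1)[OF xM] by blast+
    then show ?thesis
      using derivative_transfer(2)[OF x X \<eta>] \<tau>_props(2)[OF xM \<xi>_in[OF x] \<eta>] X Yx
      by (simp add: inner_add_left normal_inner) (simp add: v_def vh_def inner_add_left normal_inner)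
  qed
  have sE: "subspace ?E" "subspace ?Eh" unfolding normal_space_def by (intro subspace_inter subspace_orthogonal_comp)+
  \<comment> \<open>The terms \<open>vderiv X f\<close> and \<open>r *\<^sub>R v x\<close> are
    orthogonal to \<open>?E\<close>; only the derivative of \<open>v\<close> survives the
    projection.\<close>
  have E: "orth_proj ?E (?w X r) = t *\<^sub>R fst (phi M f fh L Lh \<tau> x X Y \<xi>)" if X: "X \<in> tangent_space M x" for X r
  proof (rule orth_proj_eq[OF sE(1)])
    have p: "fst (phi M f fh L Lh \<tau> x X Y \<xi>) = orth_proj ?E (vderiv X v)" by (simp add: phi_def v_def)
    show "t *\<^sub>R fst (phi M f fh L Lh \<tau> x X Y \<xi>) \<in> ?E"
      unfolding p by (rule subspace_scale[OF sE(1) orth_proj_in(1)[OF sE(1)]])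
    fix z assume z: "z \<in> ?E"
    then have "\<xi> x \<bullet> z = 0" using \<xi>_in[OF x] by (auto simp: orthogonal_comp_def orthogonal_def)
    then show "(?w X r - t *\<^sub>R fst (phi M f fh L Lh \<tau> x X Y \<xi>)) \<bullet> z = 0"
      using orth_proj_in(2)[OF sE(1) z, of "vderiv X v"] normal_inner(2)[OF IntD1[OF z] X] normal_inner(2)[OF IntD1[OF z] Yx]
      unfolding p by (simp add: inner_add_left inner_diff_left v_def)
  qed
  have Eh: "orth_proj ?Eh (?wh X r) = t *\<^sub>R snd (phi M f fh L Lh \<tau> x X Y \<xi>)" if X: "X \<in> tangent_space M x" for X r
  proof (rule orth_proj_eq[OF sE(2)])
    have p: "snd (phi M f fh L Lh \<tau> x X Y \<xi>) = orth_proj ?Eh (vderiv X vh)" by (simp add: phi_def vh_def)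
    show "t *\<^sub>R snd (phi M f fh L Lh \<tau> x X Y \<xi>) \<in> ?Eh"
      unfolding p by (rule subspace_scale[OF sE(2) orth_proj_in(1)[OF sE(2)]])
    fix z assume z: "z \<in> ?Eh"
    then have "\<tau> x (\<xi> x) \<bullet> z = 0" using \<tau>_props(1)[OF xM \<xi>_in[OF x]] by (auto simp: orthogonal_comp_def orthogonal_def)
    then show "(?wh X r - t *\<^sub>R snd (phi M f fh L Lh \<tau> x X Y \<xi>)) \<bullet> z = 0"
      using orth_proj_in(2)[OF sE(2) z, of "vderiv X vh"] normal_inner(2)[OF IntD1[OF z] X] normal_inner(2)[OF IntD1[OF z] Yx]
      unfolding p by (simp add: inner_add_left inner_diff_left vh_def)
  qed
  have "phi M f fh L Lh \<tau> x Z Y \<xi> \<in> phi_image M f fh L Lh \<tau> D x" if "Z \<in> tangent_space M x" for Z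
    unfolding phi_image_def using that x Y \<xi> YD by blast
  then have "fst (phi M f fh L Lh \<tau> x X Y \<xi>) \<bullet> fst (phi M f fh L Lh \<tau> x X' Y \<xi>) =
      snd (phi M f fh L Lh \<tau> x X Y \<xi>) \<bullet> snd (phi M f fh L Lh \<tau> x X' Y \<xi>)"
    using null xM X unfolding null_subset_def by (metis (no_types, lifting) eq_iff_diff_eq_0)
  then show ?thesis
    by (intro inner_transfer[OF xM T[OF X(1)] T[OF X(2)] N[OF X(1)] N[OF X(2)]])
       (simp_all add: E[OF X(1)] E[OF X(2)] Eh[OF X(1)] Eh[OF X(2)])
qed

text \<open>A trivial kernel at a single \<open>(x, t)\<close> would produce a singular extension
  and contradict strong genuineness. That the same \<open>(X, r)\<close> serves both cylinders is
  what later makes the two rulings coincide.\<close>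

lemma degenerate_section:
  assumes YD: "\<And>y. y \<in> U \<Longrightarrow> (Y y, \<xi> y) \<in> D y" and x: "x \<in> U"
  shows "\<exists>X\<in>tangent_space M x. \<exists>r. (X \<noteq> (\<lambda>_. 0) \<or> r \<noteq> 0) \<and>
    vderiv X f + t *\<^sub>R vderiv X v + r *\<^sub>R v x = 0 \<and> vderiv X fh + t *\<^sub>R vderiv X vh + r *\<^sub>R vh x = 0"
proof -
  obtain V c where Vc: "mfd_chart M V c" "x \<in> V" using ex_chart[OF section_points[OF x]] .
  interpret mfd_chart M V c by fact
  have o: "openin (mtop M) (U \<inter> V)" by (intro openin_Int section_open chart_props)
  note sub = smooth_fun_subset[OF _ o Int_lower1]
  have "\<exists>X\<in>tangent_space M x. \<exists>r. (X \<noteq> (\<lambda>_. 0) \<or> r \<noteq> 0) \<and> vderiv X f + t *\<^sub>R vderiv X v + r *\<^sub>R v x = 0"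
  proof (rule ccontr)
    assume no: "\<not> ?thesis"
    have "\<exists>U'. openin (mtop M) U' \<and> U' \<noteq> {} \<and> singularly_extend (open_submfd M U') f fh"
    proof (rule singular_extension[OF f_smooth(1)[OF o] f_smooth(2)[OF o] sub[OF v_smooth(1)] sub[OF v_smooth(2)] Int_lower2])
      show "x \<in> U \<inter> V" using x Vc by blast
      show "X = (\<lambda>_. 0) \<and> r = 0" if "X \<in> tangent_space M x" "vderiv X f + t *\<^sub>R vderiv X v + r *\<^sub>R v x = 0" for X r
        using no that by blast
      fix y s X r X' r' assume y: "y \<in> U \<inter> V" and X: "X \<in> tangent_space M y" "X' \<in> tangent_space M y"
      have yU: "y \<in> U" using y by blast
      show "(vderiv X f + s *\<^sub>R vderiv X v + r *\<^sub>R v y) \<bullet> (vderiv X' f + s *\<^sub>R vderiv X' v + r' *\<^sub>R v y) =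
        (vderiv X fh + s *\<^sub>R vderiv X vh + r *\<^sub>R vh y) \<bullet> (vderiv X' fh + s *\<^sub>R vderiv X' vh + r' *\<^sub>R vh y)"
        by (rule cylinder_metric[OF yU X YD[OF yU]])
    qed
    then show False using genuine unfolding strongly_genuine_def by blast
  qed
  then obtain X r where Xr: "X \<in> tangent_space M x" "X \<noteq> (\<lambda>_. 0) \<or> r \<noteq> 0" "vderiv X f + t *\<^sub>R vderiv X v + r *\<^sub>R v x = 0"
    by blast
  \<comment> \<open>The metrics agree, so the image of \<open>(X, r)\<close> under the second
    differential has length zero as well.\<close>
  have "vderiv X fh + t *\<^sub>R vderiv X vh + r *\<^sub>R vh x = 0"
    using cylinder_metric[OF x Xr(1,1) YD[OF x], of t r r] unfolding Xr(3) by simp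
  then show ?thesis using Xr by blast
qed

end

lemma ex_frame:
  assumes "x \<in> points M"
  shows "\<exists>U Y \<xi>. x \<in> U \<and> openin (mtop M) U \<and>
        (\<forall>i<d. vector_field M U (Y i) \<and> normal_section M L U (\<xi> i)) \<and>
        (\<forall>y\<in>U.
           D y = {(\<lambda>g. \<Sum>i<d. a i * Y i y g, \<Sum>i<d. a i *\<^sub>R \<xi> i y) | a :: nat \<Rightarrow> real. True} \<and>
           (\<forall>a :: nat \<Rightarrow> real.
              (\<forall>g. (\<Sum>i<d. a i * Y i y g) = 0) \<and> (\<Sum>i<d. a i *\<^sub>R \<xi> i y) = 0 \<longrightarrow>
              (\<forall>i<d. a i = 0)))"
  using D assms unfolding subbundle_TM_plus_def by (rule bspec)

lemma normal_section_sum: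
  assumes "openin (mtop M) U" "\<And>i. i < d \<Longrightarrow> normal_section M L U (\<xi> i)"
  shows "normal_section M L U (\<lambda>y. \<Sum>i<d. a i *\<^sub>R \<xi> i y)"
  unfolding normal_section_def
proof (intro conjI ballI)
  show "smooth_fun M U (\<lambda>y. \<Sum>i<d. a i *\<^sub>R \<xi> i y)"
    using assms(2) unfolding normal_section_def
    by (intro smooth_fun_sum[OF assms(1)] smooth_fun_bounded_linear[OF bounded_linear_scaleR_right]) auto
  fix y assume y: "y \<in> U"
  then have "subspace (L y)" using fiber_L openin_subset[OF assms(1)] by blast
  then show "(\<Sum>i<d. a i *\<^sub>R \<xi> i y) \<in> L y"
    using assms(2) y unfolding normal_section_def by (intro subspace_sum subspace_scale) auto
qed

lemma D_tangent:
  assumes x: "x \<in> points M" and X: "(X, \<xi>0) \<in> D x"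
  shows "\<xi>0 = 0"
proof -
  obtain U Y \<xi> where fr: "x \<in> U" "openin (mtop M) U" "\<forall>i<d. vector_field M U (Y i) \<and> normal_section M L U (\<xi> i)"
    "\<forall>y\<in>U. D y = {(\<lambda>g. \<Sum>i<d. a i * Y i y g, \<Sum>i<d. a i *\<^sub>R \<xi> i y) | a :: nat \<Rightarrow> real. True} \<and>
           (\<forall>a :: nat \<Rightarrow> real. (\<forall>g. (\<Sum>i<d. a i * Y i y g) = 0) \<and> (\<Sum>i<d. a i *\<^sub>R \<xi> i y) = 0 \<longrightarrow> (\<forall>i<d. a i = 0))"
    using ex_frame[OF x] by (elim exE conjE) (rule that)
  have U: "x \<in> U" "openin (mtop M) U" "\<And>i. i < d \<Longrightarrow> vector_field M U (Y i)" "\<And>i. i < d \<Longrightarrow> normal_section M L U (\<xi> i)"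
    "\<And>y. y \<in> U \<Longrightarrow> D y = {(\<lambda>g. \<Sum>i<d. a i * Y i y g, \<Sum>i<d. a i *\<^sub>R \<xi> i y) | a :: nat \<Rightarrow> real. True}"
    using fr by simp_all
  obtain a where a: "X = (\<lambda>g. \<Sum>i<d. a i * Y i x g)" "\<xi>0 = (\<Sum>i<d. a i *\<^sub>R \<xi> i x)"
    using X U(5)[OF U(1)] by auto
  \<comment> \<open>Constant coefficients in the frame extend the given element of
    \<open>D x\<close> to a local section of \<open>D\<close>.\<close>
  let ?Y = "\<lambda>y g. \<Sum>i<d. a i * Y i y g" and ?\<xi> = "\<lambda>y. \<Sum>i<d. a i *\<^sub>R \<xi> i y"
  have Y: "vector_field M U ?Y" by (rule vector_field_sum[OF U(2,3)])
  have \<xi>: "normal_section M L U ?\<xi>" by (rule normal_section_sum[OF U(2,4)])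
  have YD: "(?Y y, ?\<xi> y) \<in> D y" if "y \<in> U" for y using U(5)[OF that] by blast
  obtain Z r where Z: "Z \<in> tangent_space M x" "Z \<noteq> (\<lambda>_. 0) \<or> r \<noteq> 0" "vderiv Z f + r *\<^sub>R (vderiv X f + \<xi>0) = 0"
    using degenerate_section[OF Y \<xi> YD U(1), of 0] a by auto
  have XT: "X \<in> tangent_space M x" using vector_fieldD(2)[OF Y U(1)] a by simp
  have "r \<noteq> 0" using Z immersion_kernel[OF f x Z(1)] by auto
  have "\<xi>0 \<in> L x" using \<xi> U(1) a unfolding normal_section_def by simp
  then have N: "\<xi>0 \<in> normal_space M f x" using fiber_L[OF x] by blast
  \<comment> \<open>At \<open>t = 0\<close> the kernel relation has no derivative of the section;
    pairing it with \<open>\<xi>0\<close> removes all tangential terms.\<close>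
  have "(vderiv Z f + r *\<^sub>R (vderiv X f + \<xi>0)) \<bullet> \<xi>0 = r * (\<xi>0 \<bullet> \<xi>0)"
    using normal_inner(2)[OF N Z(1)] normal_inner(2)[OF N XT] by (simp add: inner_add_left)
  then show ?thesis using Z(3) \<open>r \<noteq> 0\<close> by simp
qed

end

section \<open>Affine pieces, pairs of maps and the Levi-Civita connection\<close>

lemma affine_piece:
  fixes w :: "nat \<Rightarrow> 'u::euclidean_space"
  assumes w: "lin_indep d w" and B: "open_RR d B"
  shows "\<exists>A. affine A \<and> aff_dim A = int d \<and> openin (top_of_set A) ((\<lambda>a. p + (\<Sum>i<d. apply_bcontfun a i *\<^sub>R w i)) ` B)"
proof -
  define W where "W a = (\<Sum>i<d. apply_bcontfun a i *\<^sub>R w i)" for a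
  have Wbl: "bounded_linear W"
    unfolding W_def by (intro bounded_linear_sum bounded_linear_scaleR_const bounded_linear_coord)
  obtain \<beta> lam where lam: "bounded_linear lam" "\<And>u. lam u \<in> RR d" "\<And>a. a \<in> RR d \<Longrightarrow> lam (W a) = a"
    using linear_left_inverse_RR[OF w] unfolding W_def by blast
  define A where "A = (+) p ` span (w ` {..<d})"
  have WR: "span (w ` {..<d}) = W ` RR d"
  proof
    show "W ` RR d \<subseteq> span (w ` {..<d})"
      unfolding W_def by (intro image_subsetI span_sum span_scale span_base imageI)
    have "subspace (W ` RR d)" by (rule linear_subspace_image[OF bounded_linear.linear[OF Wbl] subspace_RR])
    moreover have "w i \<in> W ` RR d" if "i < d" for i
    proof
      have "W (unit_seq i) = (\<Sum>j<d. if j = i then w j else 0)" unfolding W_def by (intro sum.cong) auto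
      then show "w i = W (unit_seq i)" using that by simp
      show "unit_seq i \<in> RR d" by (rule RR_unit_seq[OF that])
    qed
    ultimately show "span (w ` {..<d}) \<subseteq> W ` RR d" by (intro span_minimal) auto
  qed
  have "affine A" unfolding A_def using affine_translation subspace_imp_affine[OF subspace_span] by blast
  moreover have "dim (span (w ` {..<d})) = d"
    using dim_eq_card_independent[OF lin_indep_independent(2)[OF w]] card_image[OF lin_indep_independent(1)[OF w]] by (simp add: dim_span)
  then have "aff_dim A = int d" unfolding A_def aff_dim_translation_eq by (simp add: aff_dim_subspace)
  moreover have "(\<lambda>a. p + W a) ` B = A \<inter> (\<lambda>u. lam (u - p)) -` B"
  proof (intro set_eqI iffI)
    fix u assume "u \<in> (\<lambda>a. p + W a) ` B"
    then obtain a where a: "a \<in> B" "u = p + W a" by blast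
    then have aR: "a \<in> RR d" using open_RR_subset[OF B] by blast
    then show "u \<in> A \<inter> (\<lambda>u. lam (u - p)) -` B" using a lam(3)[OF aR] unfolding A_def WR by auto
  next
    fix u assume u: "u \<in> A \<inter> (\<lambda>u. lam (u - p)) -` B"
    then obtain a where a: "a \<in> RR d" "u = p + W a" unfolding A_def WR by auto
    then show "u \<in> (\<lambda>a. p + W a) ` B" using u lam(3)[OF a(1)] by auto
  qed
  moreover have "openin (top_of_set A) (A \<inter> (\<lambda>u. lam (u - p)) -` B)"
  proof (rule continuous_openin_preimage[OF _ _ B])
    show "continuous_on A (\<lambda>u. lam (u - p))"
      by (intro bounded_linear.continuous_on[OF lam(1)] continuous_intros)
    show "(\<lambda>u. lam (u - p)) \<in> A \<rightarrow> RR d" using lam(2) by blast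
  qed
  ultimately show ?thesis unfolding W_def by metis
qed

lemma bounded_linear_Pair_left: "bounded_linear (\<lambda>x. (x, 0))"
  and bounded_linear_Pair_right: "bounded_linear (\<lambda>x. (0, x))"
  by (intro bounded_linear_Pair bounded_linear_ident bounded_linear_zero)+

lemma smooth_on_Pair:
  assumes "open_RR n U" "smooth_on n U g" "smooth_on n U h"
  shows "smooth_on n U (\<lambda>x. (g x, h x))"
  using smooth_on_add[OF assms(1) smooth_on_bounded_linear[OF assms(1) bounded_linear_Pair_left assms(2)]
      smooth_on_bounded_linear[OF assms(1) bounded_linear_Pair_right assms(3)]] by simp

lemma deriv_at_Pair:
  fixes g :: "seqs \<Rightarrow> 'v::euclidean_space" and h :: "seqs \<Rightarrow> 'w::euclidean_space"
  assumes "open_RR n U" "smooth_on n U g" "smooth_on n U h" "x \<in> U" "a \<in> RR n"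
  shows "deriv_at n (\<lambda>x. (g x, h x)) x a = (deriv_at n g x a, deriv_at n h x a)"
  by (rule deriv_at_eq[OF has_derivative_Pair[OF smooth_on_has_derivative[OF assms(2,1,4)]
        smooth_on_has_derivative[OF assms(3,1,4)]] open_RR_subset[OF assms(1,4)] assms(5)])

lemma deriv_at_lincomb:
  fixes g :: "nat \<Rightarrow> seqs \<Rightarrow> 'v::euclidean_space"
  assumes "open_RR n U" "\<forall>i<d. smooth_on n U (g i)" "x \<in> U" "a \<in> RR n"
  shows "deriv_at n (\<lambda>x. \<Sum>i<d. r i *\<^sub>R g i x) x a = (\<Sum>i<d. r i *\<^sub>R deriv_at n (g i) x a)"
proof -
  have "((\<lambda>x. \<Sum>i<d. r i *\<^sub>R g i x) has_derivative (\<lambda>a. \<Sum>i<d. r i *\<^sub>R deriv_at n (g i) x a)) (at x within RR n)"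
    using assms(2) by (intro has_derivative_sum has_derivative_scaleR_right smooth_on_has_derivative[OF _ assms(1,3)]) auto
  then show ?thesis by (rule deriv_at_eq[OF _ open_RR_subset[OF assms(1,3)] assms(4)])
qed

context smooth_mfd
begin

text \<open>For an isometric immersion the Koszul expression is twice the product of
  \<open>D\<^sub>X(f\<^sub>*Y)\<close> with \<open>f\<^sub>*Z\<close>. So if that derivative is
  already tangent, it represents the Levi-Civita derivative.\<close>

lemma levi_civita_eq:
  assumes f: "isometric_immersion M G f" and X: "vector_field M U X" and Y: "vector_field M U Y" and x: "x \<in> U"
    and V: "V \<in> tangent_space M x" "vderiv V f = vderiv (X x) (\<lambda>y. vderiv (Y y) f)"
  shows "levi_civita M G X Y x = V"
proof -
  have xM: "x \<in> points M" using x vector_fieldD(1)[OF X] openin_subset by blast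
  have G: "G x S T = vderiv S f \<bullet> vderiv T f" if "S \<in> tangent_space M x" "T \<in> tangent_space M x" for S T
    using f xM that unfolding isometric_immersion_def by metis
  let ?K = "\<lambda>Z. X x (\<lambda>y. G y (Y y) (Z y)) + Y x (\<lambda>y. G y (X y) (Z y)) - Z x (\<lambda>y. G y (X y) (Y y))
          + G x (bracket M X Y x) (Z x) - G x (bracket M X Z x) (Y x) - G x (bracket M Y Z x) (X x)"
  have K: "2 * G x V (Z x) = ?K Z" if "x \<in> W" "vector_field M W Z" for W Z
  proof -
    have o: "openin (mtop M) (U \<inter> W)" by (intro openin_Int vector_fieldD(1)[OF X] vector_fieldD(1)[OF that(2)])
    have Z: "Z x \<in> tangent_space M x" using vector_fieldD(2)[OF that(2,1)] .
    show ?thesis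
      using koszul[OF f vector_field_subset[OF X o Int_lower1] vector_field_subset[OF Y o Int_lower1]
          vector_field_subset[OF that(2) o Int_lower2], of x] x that(1)
      by (simp add: G[OF V(1) Z] V(2))
  qed
  show ?thesis
    unfolding levi_civita_def
  proof (rule the_equality)
    show "V \<in> tangent_space M x \<and> (\<forall>W Z. x \<in> W \<and> vector_field M W Z \<longrightarrow> 2 * G x V (Z x) = ?K Z)"
      using V(1) K by blast
    fix V' assume V': "V' \<in> tangent_space M x \<and> (\<forall>W Z. x \<in> W \<and> vector_field M W Z \<longrightarrow> 2 * G x V' (Z x) = ?K Z)"
    \<comment> \<open>Two candidates are compared by testing the Koszul identity on a field
      extending their difference, whose length is then zero.\<close>
    let ?Z = "\<lambda>g. 1 * V' g + (-1) * V g"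
    have ZT: "?Z \<in> tangent_space M x" using tangent_linear[OF xM] V' V(1) by blast
    obtain W Z where Z: "x \<in> W" "vector_field M W Z" "Z x = ?Z" using tangent_extend[OF xM ZT] .
    have "2 * G x V' (Z x) = ?K Z" using V' Z(1,2) by blast
    then have "G x V' ?Z = G x V ?Z" using K[OF Z(1,2)] unfolding Z(3) by simp
    then have "vderiv ?Z f \<bullet> vderiv ?Z f = 0"
      using G[OF _ ZT] V' V(1) unfolding vderiv_linear_left[of 1 V' "-1" V f]
      by (simp add: inner_diff_left)
    then have "?Z = (\<lambda>_. 0)" using immersion_kernel[OF f xM ZT] by simp
    then show "V' = V" by (auto simp: fun_eq_iff)
  qed
qed

end

section \<open>Submanifolds given by a parametrization\<close>

context mfd_chart
begin

lemma chart_continuous: "continuous_map (subtopology (mtop M) V) (top_of_set (c ` V)) c"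
  by (rule homeomorphic_imp_continuous_map[OF chart_props(3)])

lemma ci_continuous: "continuous_map (top_of_set (c ` V)) (mtop M) ci"
proof -
  obtain g where "homeomorphic_maps (subtopology (mtop M) V) (top_of_set (c ` V)) c g"
    using chart_props(3) unfolding homeomorphic_map_maps by blast
  then have g: "continuous_map (top_of_set (c ` V)) (subtopology (mtop M) V) g" "\<And>z. z \<in> c ` V \<Longrightarrow> c (g z) = z"
    unfolding homeomorphic_maps_def by auto
  have "g z = ci z" if "z \<in> c ` V" for z
  proof -
    have "g z \<in> V" using g(1) that unfolding continuous_map_def by auto
    then show ?thesis using g(2)[OF that] ci_c by metis
  qed
  then have "continuous_map (top_of_set (c ` V)) (subtopology (mtop M) V) ci"
    by (intro continuous_map_eq[OF g(1)]) simp
  then show ?thesis by (rule continuous_map_into_fulltopology)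
qed

text \<open>\<open>k\<close> is meant to be a left inverse of \<open>s\<close>, so that \<open>p \<mapsto> k (c p)\<close> inverts \<open>a \<mapsto> ci (s a)\<close>.\<close>

definition param_mfd :: "nat \<Rightarrow> seqs set \<Rightarrow> (seqs \<Rightarrow> seqs) \<Rightarrow> (seqs \<Rightarrow> seqs) \<Rightarrow> 'a mfd" where
  "param_mfd d B s k = \<lparr>mtop = subtopology (mtop M) ((\<lambda>a. ci (s a)) ` B), mdim = d,
     mcharts = {((\<lambda>a. ci (s a)) ` B, \<lambda>p. k (c p))}\<rparr>"

context
  fixes d :: nat and B :: "seqs set" and s k :: "seqs \<Rightarrow> seqs"
  assumes B: "open_RR d B" and s: "smooth_on d B s" "s ` B \<subseteq> c ` V"
    and k: "continuous_on (s ` B) k" "\<forall>a\<in>B. k (s a) = a"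
begin

abbreviation "\<sigma> \<equiv> \<lambda>a. ci (s a)"
abbreviation "S \<equiv> param_mfd d B s k"
abbreviation "P \<equiv> \<sigma> ` B"
abbreviation "kc \<equiv> \<lambda>p. k (c p)"

lemma \<sigma>_props: "a \<in> B \<Longrightarrow> \<sigma> a \<in> V" "a \<in> B \<Longrightarrow> c (\<sigma> a) = s a" "a \<in> B \<Longrightarrow> kc (\<sigma> a) = a"
proof -
  assume a: "a \<in> B"
  then have sa: "s a \<in> c ` V" using s(2) by blast
  show "\<sigma> a \<in> V" by (rule ci_in[OF sa])
  show "c (\<sigma> a) = s a" by (rule c_ci[OF sa])
  then show "kc (\<sigma> a) = a" using k(2)[rule_format, OF a] by simp
qed

lemma P_sub: "P \<subseteq> V" "P \<subseteq> points M"
  using \<sigma>_props(1) V_subset by blast+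

lemma points_S: "points S = P"
  using P_sub(2) by (simp add: param_mfd_def Int_absorb1)

lemma kc_image: "kc ` P = B"
  using \<sigma>_props(3) by force

lemma inv_kc: "a \<in> B \<Longrightarrow> inv_into P kc a = \<sigma> a"
proof -
  assume a: "a \<in> B"
  have "inj_on kc P" by (rule inj_onI) (use \<sigma>_props(3) in fastforce)
  then have "inv_into P kc (kc (\<sigma> a)) = \<sigma> a" using a by (intro inv_into_f_f) auto
  then show ?thesis using \<sigma>_props(3)[OF a] by simp
qed

lemma \<sigma>_continuous: "continuous_map (top_of_set B) (mtop M) \<sigma>"
proof -
  have "continuous_map (top_of_set B) (top_of_set (c ` V)) s"
    using smooth_on_continuous[OF s(1)] s(2) by auto
  from continuous_map_compose[OF this ci_continuous] show ?thesis by (simp add: comp_def)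
qed

text \<open>Continuity of \<open>k\<close> on the image makes \<open>kc\<close> a continuous inverse
  of the parametrization, so the submanifold carries the subspace topology and its single chart is
  valid.\<close>

lemma S_homeomorphic: "homeomorphic_map (subtopology (mtop M) P) (top_of_set B) kc"
proof -
  have "continuous_map (subtopology (mtop M) P) (top_of_set (c ` V)) c"
    using continuous_map_from_subtopology[OF chart_continuous, of P] P_sub(1)
    by (simp add: subtopology_subtopology inf_absorb2)
  then have "continuous_map (subtopology (mtop M) P) (top_of_set (s ` B)) c"
    using \<sigma>_props(2) by (auto simp: continuous_map_in_subtopology)
  moreover have "continuous_map (top_of_set (s ` B)) (top_of_set B) k" using k by auto
  ultimately have "continuous_map (subtopology (mtop M) P) (top_of_set B) (k \<circ> c)"
    by (rule continuous_map_compose)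
  then have "continuous_map (subtopology (mtop M) P) (top_of_set B) kc"
    by (simp add: comp_def)
  moreover have "continuous_map (top_of_set B) (subtopology (mtop M) P) \<sigma>"
    using \<sigma>_continuous by (simp add: continuous_map_in_subtopology)
  ultimately have "homeomorphic_maps (subtopology (mtop M) P) (top_of_set B) kc \<sigma>"
    unfolding homeomorphic_maps_def using \<sigma>_props(3) by auto
  then show ?thesis unfolding homeomorphic_map_maps by blast
qed

lemma mfd_chart_S: "mfd_chart S P kc"
proof (unfold_locales)
  note base = smooth[unfolded smooth_manifold_def, THEN conjunct1]
      smooth[unfolded smooth_manifold_def, THEN conjunct2, THEN conjunct1]
  have "smooth_on d B (\<lambda>a. a)" by (rule smooth_on_linear[OF B bounded_linear_ident])
  then have "smooth_on d B (kc \<circ> inv_into P kc)"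
    by (rule smooth_on_cong[OF B, THEN iffD1, rotated]) (simp add: inv_kc \<sigma>_props(3))
  then show "smooth_manifold S"
    using Hausdorff_space_subtopology[OF base(1), of P] second_countable_subtopology[OF base(2), of P] S_homeomorphic B
    unfolding smooth_manifold_def param_mfd_def
    using P_sub(2) kc_image by (simp add: subtopology_subtopology Int_absorb1 openin_subtopology_refl)
  show "(P, kc) \<in> mcharts S" by (simp add: param_mfd_def)
qed

lemma smooth_fun_restrict:
  assumes g: "smooth_fun M W g"
  shows "smooth_fun S (P \<inter> W) g" "smooth_on d {a \<in> B. \<sigma> a \<in> W} (\<lambda>a. g (\<sigma> a))" "open_RR d {a \<in> B. \<sigma> a \<in> W}"
proof -
  interpret S: mfd_chart S P kc by (rule mfd_chart_S)
  have oW: "openin (mtop M) W" by (rule smooth_fun_openin[OF g])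
  have oB: "openin (top_of_set B) {a \<in> topspace (top_of_set B). \<sigma> a \<in> W}"
    by (rule openin_continuous_map_preimage[OF \<sigma>_continuous oW])
  then show oR: "open_RR d {a \<in> B. \<sigma> a \<in> W}" using openin_trans[OF _ B] by simp
  have sub: "s ` {a \<in> B. \<sigma> a \<in> W} \<subseteq> c ` (V \<inter> W)"
  proof
    fix z assume "z \<in> s ` {a \<in> B. \<sigma> a \<in> W}"
    then obtain a where a: "a \<in> B" "\<sigma> a \<in> W" "z = s a" by blast
    then show "z \<in> c ` (V \<inter> W)" using \<sigma>_props(1,2)[OF a(1)] by (intro image_eqI[of _ _ "\<sigma> a"]) auto
  qed
  show sm: "smooth_on d {a \<in> B. \<sigma> a \<in> W} (\<lambda>a. g (\<sigma> a))"
    by (rule smooth_on_compose[OF oR open_image_Int[OF oW] sub smooth_on_subset[OF s(1)] smooth_fun_chart[OF g]]) blast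
  have oPW: "openin (mtop S) (P \<inter> W)"
    using oW by (auto simp: param_mfd_def openin_subtopology)
  have im: "kc ` (P \<inter> W) = {a \<in> B. \<sigma> a \<in> W}"
    using \<sigma>_props(3) by force
  show "smooth_fun S (P \<inter> W) g"
  proof (rule S.smooth_fun_chartI[OF oPW Int_lower1])
    have "smooth_on d (kc ` (P \<inter> W)) (\<lambda>z. g (inv_into P kc z))"
      unfolding im using sm by (rule smooth_on_cong[OF oR, THEN iffD1, rotated]) (simp add: inv_kc)
    then show "smooth_on (mdim S) (kc ` (P \<inter> W)) (\<lambda>z. g (inv_into P kc z))" by (simp add: param_mfd_def)
  qed
qed

lemma deriv_in_RR: "a \<in> B \<Longrightarrow> b \<in> RR d \<Longrightarrow> deriv_at d s a b \<in> RR m"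
  using deriv_at_in_RR[OF s(1) B] s(2) openin_imp_subset[OF chart_props(2)] by blast

lemma deriv_\<sigma>:
  fixes g :: "'a \<Rightarrow> 'u::euclidean_space"
  assumes g: "smooth_fun M W g" and a: "a \<in> B" "\<sigma> a \<in> W" and b: "b \<in> RR d"
  shows "deriv_at d (\<lambda>a. g (\<sigma> a)) a b = deriv_at m (\<lambda>z. g (ci z)) (s a) (deriv_at d s a b)"
proof (rule deriv_at_compose[OF smooth_fun_restrict(3)[OF g] open_image_Int[OF smooth_fun_openin[OF g]] _ _ smooth_fun_chart[OF g] _ b])
  show "s ` {a \<in> B. \<sigma> a \<in> W} \<subseteq> c ` (V \<inter> W)"
  proof
    fix z assume "z \<in> s ` {a \<in> B. \<sigma> a \<in> W}"
    then obtain a where a: "a \<in> B" "\<sigma> a \<in> W" "z = s a" by blast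
    then show "z \<in> c ` (V \<inter> W)" using \<sigma>_props(1,2)[OF a(1)] by (intro image_eqI[of _ _ "\<sigma> a"]) auto
  qed
  show "smooth_on d {a \<in> B. \<sigma> a \<in> W} s" by (rule smooth_on_subset[OF s(1)]) blast
  show "a \<in> {a \<in> B. \<sigma> a \<in> W}" using a by blast
qed

text \<open>In the coordinates of \<open>S\<close> and \<open>M\<close> the inclusion is
  \<open>s\<close>, so its differential acts on components as the derivative of
  \<open>s\<close>.\<close>

lemma pushforward_S:
  assumes a: "a \<in> B" and b: "b \<in> RR d"
  shows "pushforward M id (\<sigma> a) (chart_vector S (P, kc) (\<sigma> a) b) = chart_vector M (V, c) (\<sigma> a) (deriv_at d s a b)"
proof
  fix g
  interpret S: mfd_chart S P kc by (rule mfd_chart_S)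
  have dim: "mdim S = d" by (simp add: param_mfd_def)
  show "pushforward M id (\<sigma> a) (chart_vector S (P, kc) (\<sigma> a) b) g = chart_vector M (V, c) (\<sigma> a) (deriv_at d s a b) g"
  proof (cases "smooth_at M (\<sigma> a) g")
    case True
    then obtain W where W: "\<sigma> a \<in> W" "smooth_fun M W g" unfolding smooth_at_def by blast
    note R = smooth_fun_restrict[OF W(2)]
    have "chart_vector S (P, kc) (\<sigma> a) b g = deriv_at d (\<lambda>z. g (inv_into P kc z)) a b"
      using S.chart_vector_apply[OF R(1), of "\<sigma> a" b] W(1) a b \<sigma>_props(3)[OF a] dim by simp
    also have "\<dots> = deriv_at d (\<lambda>a. g (\<sigma> a)) a b"
      by (rule deriv_at_cong_open[OF R(3)]) (use a W(1) in \<open>auto simp: inv_kc\<close>)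
    also have "\<dots> = chart_vector M (V, c) (\<sigma> a) (deriv_at d s a b) g"
      using chart_vector_apply[OF W(2,1) \<sigma>_props(1)[OF a] deriv_in_RR[OF a b]] deriv_\<sigma>[OF W(2) a W(1) b] \<sigma>_props(2)[OF a] by simp
    finally show ?thesis using True by (simp add: pushforward_def comp_def)
  qed (simp add: pushforward_def chart_vector_def)
qed

lemma sub_tangent_S:
  assumes a: "a \<in> B"
  shows "sub_tangent S M (\<sigma> a) = (\<lambda>b. chart_vector M (V, c) (\<sigma> a) (deriv_at d s a b)) ` RR d"
proof -
  interpret S: mfd_chart S P kc by (rule mfd_chart_S)
  have dim: "mdim S = d" by (simp add: param_mfd_def)
  have "tangent_space S (\<sigma> a) = chart_vector S (P, kc) (\<sigma> a) ` RR d"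
    using S.tangent_space_eq[of "\<sigma> a"] a dim by simp
  then show ?thesis
    unfolding sub_tangent_def by (simp add: image_image pushforward_S[OF a] cong: image_cong)
qed

lemma submanifold_S:
  assumes inj: "\<And>a b. a \<in> B \<Longrightarrow> b \<in> RR d \<Longrightarrow> deriv_at d s a b = 0 \<Longrightarrow> b = 0"
  shows "submanifold S M"
  unfolding submanifold_def smooth_embedding_def
proof (intro conjI ballI)
  interpret S: mfd_chart S P kc by (rule mfd_chart_S)
  have dim: "mdim S = d" by (simp add: param_mfd_def)
  show "smooth_manifold S" by (rule S.smooth)
  show "embedding_map (mtop S) (mtop M) id"
    unfolding embedding_map_def using points_S by (simp add: param_mfd_def)
  show "smooth_map S M id"
    unfolding smooth_map_def
  proof (intro conjI ballI, safe)
    show "continuous_map (mtop S) (mtop M) id"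
      by (simp add: param_mfd_def continuous_map_from_subtopology)
    fix P' k' W e assume "(P', k') \<in> mcharts S" and We: "(W, e) \<in> mcharts M"
    then have P': "P' = P" "k' = kc" by (simp_all add: param_mfd_def)
    interpret W: mfd_chart M W e by (rule mfd_chartI[OF We])
    have "smooth_on (mdim S) (kc ` (P \<inter> (P \<inter> W))) (\<lambda>z. e (inv_into P kc z))"
      by (rule S.smooth_fun_chart[OF smooth_fun_restrict(1)[OF W.smooth_fun_c]])
    moreover have "{x \<in> P. id x \<in> W} = P \<inter> (P \<inter> W)" by auto
    ultimately show "smooth_on (mdim S) (k' ` {x \<in> P'. id x \<in> W}) (e \<circ> id \<circ> inv_into P' k')"
      unfolding P' by (simp add: comp_def)
  qed
  fix x assume "x \<in> points S"
  then obtain a where a: "a \<in> B" "x = \<sigma> a" using points_S by blast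
  show "inj_on (pushforward M id x) (tangent_space S x)"
  proof (rule inj_onI)
    fix X Y assume XY: "X \<in> tangent_space S x" "Y \<in> tangent_space S x" "pushforward M id x X = pushforward M id x Y"
    have "x \<in> P" using a by blast
    then obtain b b' where b: "b \<in> RR d" "X = chart_vector S (P, kc) x b" "b' \<in> RR d" "Y = chart_vector S (P, kc) x b'"
      using XY(1,2) S.tangent_space_eq[of x] dim by auto
    have "chart_vector M (V, c) x (deriv_at d s a b) = chart_vector M (V, c) x (deriv_at d s a b')"
      using XY(3) pushforward_S[OF a(1) b(1)] pushforward_S[OF a(1) b(3)] b(2,4) a(2) by simp
    then have "deriv_at d s a b = deriv_at d s a b'"
      using chart_vector_inj[OF \<sigma>_props(1)[OF a(1)] deriv_in_RR[OF a(1) b(1)] deriv_in_RR[OF a(1) b(3)]] a(2) by metis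
    moreover have "linear (deriv_at d s a)" by (rule bounded_linear.linear[OF bounded_linear_deriv_at])
    ultimately have "deriv_at d s a (b - b') = 0" by (simp add: linear_diff)
    then have "b = b'" using inj[OF a(1) RR_diff[OF b(1,3)]] by simp
    then show "X = Y" using b by simp
  qed
qed

end

end

section \<open>Rulings\<close>

context mfd_chart
begin

text \<open>Along the parametrization \<open>h\<close> is affine, so a vector is tangent to the
  submanifold exactly when \<open>h\<close> sends it into the fixed span of the \<open>w i\<close>.
  The image of a tangent field stays in that span, hence so does its derivative along the
  submanifold, and total geodesy follows from \<open>levi_civita_eq\<close>.\<close>

lemma ruling_param_mfd:
  fixes h :: "'a \<Rightarrow> 'u::euclidean_space"
  assumes B: "open_RR d B" and s: "smooth_on d B s" "s ` B \<subseteq> c ` V"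
    and k: "continuous_on (s ` B) k" "\<forall>a\<in>B. k (s a) = a"
    and h: "isometric_immersion M G h" and w: "lin_indep d w" and B0: "0 \<in> B"
    and hs: "\<forall>a\<in>B. h (ci (s a)) = p + (\<Sum>i<d. apply_bcontfun a i *\<^sub>R w i)"
    and x0: "x0 = ci (s 0)"
    and \<Delta>: "\<Delta> x0 = {X \<in> tangent_space M x0. \<exists>b\<in>RR d. vderiv X h = (\<Sum>i<d. apply_bcontfun b i *\<^sub>R w i)}"
  shows "ruling M G h d \<Delta> x0 (param_mfd d B s k)"
proof -
  note ctx = B s k
  let ?S = "param_mfd d B s k" and ?\<sigma> = "\<lambda>a. ci (s a)"
  define W where "W a = (\<Sum>i<d. apply_bcontfun a i *\<^sub>R w i)" for a
  have Wbl: "bounded_linear W"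
    unfolding W_def by (intro bounded_linear_sum bounded_linear_scaleR_const bounded_linear_coord)
  have W0: "b = 0" if "b \<in> RR d" "W b = 0" for b
    using w that by (intro RR_eqI[OF that(1) RR_0]) (auto simp: lin_indep_def W_def)
  note \<sigma>V = \<sigma>_props(1)[OF ctx] and c\<sigma> = \<sigma>_props(2)[OF ctx]
  have \<sigma>M: "?\<sigma> a \<in> points M" if "a \<in> B" for a using \<sigma>V[OF that] V_subset by blast
  have hM: "smooth_fun M (points M) h" using h unfolding isometric_immersion_def by blast
  have dW: "deriv_at d (\<lambda>a. h (?\<sigma> a)) a b = W b" if a: "a \<in> B" and b: "b \<in> RR d" for a b
  proof -
    have "deriv_at d (\<lambda>a. h (?\<sigma> a)) a b = deriv_at d (\<lambda>a. p + W a) a b"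
      by (rule deriv_at_cong_open[OF B a]) (simp add: hs W_def)
    also have "\<dots> = W b"
      by (rule deriv_at_eq[OF has_derivative_add[OF has_derivative_const bounded_linear_imp_has_derivative[OF Wbl], simplified]
            open_RR_subset[OF B a] b])
    finally show ?thesis .
  qed
  have vW: "vderiv (chart_vector M (V, c) (?\<sigma> a) (deriv_at d s a b)) h = W b" if a: "a \<in> B" and b: "b \<in> RR d" for a b
    using vderiv_chart_vector[OF hM \<sigma>M[OF a] \<sigma>V[OF a] deriv_in_RR[OF ctx a b]] deriv_\<sigma>[OF ctx hM a \<sigma>M[OF a] b]
      dW[OF a b] c\<sigma>[OF a] by simp
  have cvT: "chart_vector M (V, c) (?\<sigma> a) (deriv_at d s a b) \<in> tangent_space M (?\<sigma> a)" if "a \<in> B" "b \<in> RR d" for a b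
    by (rule chart_vector_in[OF \<sigma>V[OF that(1)] deriv_in_RR[OF ctx that]])
  have ST: "X \<in> sub_tangent ?S M (?\<sigma> a) \<longleftrightarrow> X \<in> tangent_space M (?\<sigma> a) \<and> (\<exists>b\<in>RR d. vderiv X h = W b)" if a: "a \<in> B" for X a
  proof
    assume "X \<in> sub_tangent ?S M (?\<sigma> a)"
    then obtain b where "b \<in> RR d" "X = chart_vector M (V, c) (?\<sigma> a) (deriv_at d s a b)"
      unfolding sub_tangent_S[OF ctx a] by blast
    then show "X \<in> tangent_space M (?\<sigma> a) \<and> (\<exists>b\<in>RR d. vderiv X h = W b)"
      using cvT[OF a] vW[OF a] by blast
  next
    assume "X \<in> tangent_space M (?\<sigma> a) \<and> (\<exists>b\<in>RR d. vderiv X h = W b)"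
    then obtain b where b: "X \<in> tangent_space M (?\<sigma> a)" "b \<in> RR d" "vderiv X h = W b" by blast
    have "inj_on (\<lambda>X. vderiv X h) (tangent_space M (?\<sigma> a))"
      using h \<sigma>M[OF a] unfolding isometric_immersion_def immersion_at_def by blast
    then have "X = chart_vector M (V, c) (?\<sigma> a) (deriv_at d s a b)"
      using b vW[OF a b(2)] cvT[OF a b(2)] by (intro inj_onD[of "\<lambda>X. vderiv X h"]) auto
    then show "X \<in> sub_tangent ?S M (?\<sigma> a)" unfolding sub_tangent_S[OF ctx a] using b(2) by blast
  qed
  have pts: "points ?S = ?\<sigma> ` B" by (rule points_S[OF ctx])
  have tg: "totally_geodesic ?S M G"
    unfolding totally_geodesic_def
  proof (intro allI impI ballI)
    fix U X Y z
    assume as: "vector_field M U X \<and> vector_field M U Y \<and>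
        (\<forall>z\<in>U \<inter> points ?S. X z \<in> sub_tangent ?S M z \<and> Y z \<in> sub_tangent ?S M z)" and "z \<in> U \<inter> points ?S"
    then have X: "vector_field M U X" and Y: "vector_field M U Y" and zU: "z \<in> U" and zS: "z \<in> points ?S" by auto
    obtain a where a: "a \<in> B" "z = ?\<sigma> a" using zS pts by blast
    have oU: "openin (mtop M) U" by (rule vector_fieldD(1)[OF X])
    have hU: "smooth_fun M U h" by (rule smooth_fun_subset[OF hM oU openin_subset[OF oU]])
    define Yh where "Yh y = vderiv (Y y) h" for y
    have Yh: "smooth_fun M U Yh" unfolding Yh_def[abs_def] by (rule smooth_fun_vderiv[OF Y hU subset_refl])
    obtain b where b: "b \<in> RR d" "X z = chart_vector M (V, c) (?\<sigma> a) (deriv_at d s a b)"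
      using as zU zS unfolding a(2) using sub_tangent_S[OF ctx a(1)] by blast
    note R = smooth_fun_restrict[OF ctx Yh]
    have aU: "?\<sigma> a \<in> U" using zU a by simp
    have eq: "vderiv (X z) Yh = deriv_at d (\<lambda>a. Yh (?\<sigma> a)) a b"
      using vderiv_chart_vector[OF Yh aU \<sigma>V[OF a(1)] deriv_in_RR[OF ctx a(1) b(1)]] deriv_\<sigma>[OF ctx Yh a(1) aU b(1)]
        c\<sigma>[OF a(1)] b(2) by simp
    have sE: "subspace (W ` RR d)" by (rule linear_subspace_image[OF bounded_linear.linear[OF Wbl] subspace_RR])
    \<comment> \<open>A subspace is its own double orthogonal complement, so membership is tested by
      pairing with a fixed normal vector, against which the whole curve has product zero.\<close>
    have "deriv_at d (\<lambda>a. Yh (?\<sigma> a)) a b \<in> (W ` RR d)\<^sup>\<bottom>\<^sup>\<bottom>"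
      unfolding orthogonal_comp_def[of "(W ` RR d)\<^sup>\<bottom>"]
    proof clarify
      fix u assume u: "u \<in> (W ` RR d)\<^sup>\<bottom>"
      have aB: "a \<in> {a \<in> B. ?\<sigma> a \<in> U}" using a aU by blast
      have "deriv_at d (\<lambda>a. Yh (?\<sigma> a)) a b \<bullet> u = deriv_at d (\<lambda>a. Yh (?\<sigma> a) \<bullet> u) a b"
        by (rule deriv_at_bounded_linear[OF R(2,3) aB b(1) bounded_linear_inner_left, symmetric])
      also have "\<dots> = deriv_at d (\<lambda>a. 0) a b"
      proof (rule deriv_at_cong_open[OF R(3) aB])
        fix a' assume "a' \<in> {a \<in> B. ?\<sigma> a \<in> U}"
        then have a': "a' \<in> B" "?\<sigma> a' \<in> U" by auto
        then have "Y (?\<sigma> a') \<in> sub_tangent ?S M (?\<sigma> a')" using as pts by blast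
        then have "Yh (?\<sigma> a') \<in> W ` RR d" unfolding Yh_def using ST[OF a'(1)] by blast
        then show "Yh (?\<sigma> a') \<bullet> u = 0" using u by (auto simp: orthogonal_comp_def orthogonal_def)
      qed
      also have "\<dots> = 0"
        by (rule deriv_at_eq[OF has_derivative_const open_RR_subset[OF B a(1)] b(1)])
      finally show "orthogonal u (deriv_at d (\<lambda>a. Yh (?\<sigma> a)) a b)" by (simp add: orthogonal_def inner_commute)
    qed
    then obtain b1 where b1: "b1 \<in> RR d" "vderiv (X z) Yh = W b1"
      unfolding orthogonal_comp_self[OF sE] eq by blast
    \<comment> \<open>The derivative has no normal part here: it is the image of this vector tangent
      to the submanifold.\<close>
    let ?Z = "chart_vector M (V, c) (?\<sigma> a) (deriv_at d s a b1)"
    have "levi_civita M G X Y z = ?Z"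
      using cvT[OF a(1) b1(1)] vW[OF a(1) b1(1)] b1(2)
      by (intro levi_civita_eq[OF h X Y zU]) (simp_all add: a(2) Yh_def[abs_def])
    then show "levi_civita M G X Y z \<in> sub_tangent ?S M z"
      using b1(1) unfolding a(2) sub_tangent_S[OF ctx a(1)] by blast
  qed
  have sub: "submanifold ?S M"
  proof (rule submanifold_S[OF ctx])
    fix a b assume ab: "a \<in> B" "b \<in> RR d" "deriv_at d s a b = 0"
    have "chart_vector M (V, c) (?\<sigma> a) 0 = (\<lambda>_. 0)"
      using chart_vector_linear[OF \<sigma>V[OF ab(1)] RR_0 RR_0, of 0 0] by simp
    then have "W b = vderiv (\<lambda>_. 0) h" using vW[OF ab(1,2)] ab(3) by simp
    then show "b = 0" using W0[OF ab(2)] by (simp add: vderiv_def)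
  qed
  have im: "h ` points ?S = (\<lambda>a. p + (\<Sum>i<d. apply_bcontfun a i *\<^sub>R w i)) ` B"
    unfolding pts image_image using hs by (intro image_cong) auto
  have tan: "sub_tangent ?S M x0 = \<Delta> x0"
    unfolding \<Delta> using ST[OF B0] unfolding x0 W_def by blast
  have "x0 \<in> points ?S" "mdim ?S = d" using B0 x0 pts by (auto simp: param_mfd_def)
  then show ?thesis
    unfolding ruling_def im using sub tg tan affine_piece[OF w B, of p] by blast
qed

end

context smooth_mfd
begin

text \<open>Rewrites the fibre of \<open>D\<close> in the form in which
  \<open>ruling_param_mfd\<close> takes it, and equally for \<open>f\<close> and \<open>fh\<close>,
  since either differential is injective.\<close>

lemma span_eq_vderiv:
  fixes h :: "'a \<Rightarrow> 'z::euclidean_space"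
  assumes x: "x \<in> points M" and Y: "\<forall>i<(d::nat). Y i \<in> tangent_space M x" and inj: "inj_on (\<lambda>X. vderiv X h) (tangent_space M x)"
  shows "{\<lambda>g. \<Sum>i<d. a i * Y i g | a :: nat \<Rightarrow> real. True} =
    {X \<in> tangent_space M x. \<exists>b\<in>RR d. vderiv X h = (\<Sum>i<d. apply_bcontfun b i *\<^sub>R vderiv (Y i) h)}"
proof (intro set_eqI iffI)
  note T = tangent_sum[OF x Y[rule_format]]
  fix X assume "X \<in> {\<lambda>g. \<Sum>i<d. a i * Y i g | a :: nat \<Rightarrow> real. True}"
  then obtain a where a: "X = (\<lambda>g. \<Sum>i<d. a i * Y i g)" by blast
  let ?b = "\<Sum>i<d. a i *\<^sub>R unit_seq i"
  have "vderiv X h = (\<Sum>i<d. apply_bcontfun ?b i *\<^sub>R vderiv (Y i) h)"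
    unfolding a vderiv_sum_left coord_sum_unit_seq by simp
  moreover have "?b \<in> RR d" by (intro RR_intros) auto
  moreover have "X \<in> tangent_space M x" unfolding a by (rule T)
  ultimately show "X \<in> {X \<in> tangent_space M x. \<exists>b\<in>RR d. vderiv X h = (\<Sum>i<d. apply_bcontfun b i *\<^sub>R vderiv (Y i) h)}"
    by blast
next
  note T = tangent_sum[OF x Y[rule_format]]
  fix X assume "X \<in> {X \<in> tangent_space M x. \<exists>b\<in>RR d. vderiv X h = (\<Sum>i<d. apply_bcontfun b i *\<^sub>R vderiv (Y i) h)}"
  then obtain b where b: "X \<in> tangent_space M x" "vderiv X h = (\<Sum>i<d. apply_bcontfun b i *\<^sub>R vderiv (Y i) h)" by blast
  have "X = (\<lambda>g. \<Sum>i<d. apply_bcontfun b i * Y i g)"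
    by (rule inj_onD[OF inj _ b(1) T]) (simp_all add: b(2) vderiv_sum_left)
  then show "X \<in> {\<lambda>g. \<Sum>i<d. a i * Y i g | a :: nat \<Rightarrow> real. True}" by blast
qed

text \<open>\<open>lines_in_image\<close> is applied to the pair of immersions. The common kernel
  vector makes the cylinder over the pair degenerate, and the resulting single map \<open>s\<close>
  of base points parametrizes the rulings of both immersions.\<close>

lemma ruling_exists:
  fixes f :: "'a \<Rightarrow> 'v::euclidean_space" and fh :: "'a \<Rightarrow> 'w::euclidean_space"
  assumes f: "isometric_immersion M G f" and fh: "isometric_immersion M G fh"
    and x0: "x0 \<in> U" and oU: "openin (mtop M) U" and Y: "\<And>i. i < d \<Longrightarrow> vector_field M U (Y i)"
    and ind: "lin_indep d (\<lambda>i. vderiv (Y i x0) f)"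
    and degenerate: "\<And>x a. x \<in> U \<Longrightarrow> \<exists>X\<in>tangent_space M x. \<exists>r. (X \<noteq> (\<lambda>_. 0) \<or> r \<noteq> 0) \<and>
      vderiv X f + vderiv X (\<lambda>y. \<Sum>i<d. a i *\<^sub>R vderiv (Y i y) f) + r *\<^sub>R (\<Sum>i<d. a i *\<^sub>R vderiv (Y i x) f) = 0 \<and>
      vderiv X fh + vderiv X (\<lambda>y. \<Sum>i<d. a i *\<^sub>R vderiv (Y i y) fh) + r *\<^sub>R (\<Sum>i<d. a i *\<^sub>R vderiv (Y i x) fh) = 0"
    and \<Delta>: "\<Delta> x0 = {\<lambda>g. \<Sum>i<d. a i * Y i x0 g | a :: nat \<Rightarrow> real. True}"
  shows "\<exists>S. ruling M G f d \<Delta> x0 S \<and> ruling M G fh d \<Delta> x0 S"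
proof -
  have UM: "U \<subseteq> points M" by (rule openin_subset[OF oU])
  have x0M: "x0 \<in> points M" using x0 UM by blast
  obtain V c where Vc: "mfd_chart M V c" "x0 \<in> V" using ex_chart[OF x0M] .
  interpret mfd_chart M V c by fact
  have fM: "smooth_fun M (points M) f" "smooth_fun M (points M) fh"
    using f fh unfolding isometric_immersion_def by blast+
  have fU: "smooth_fun M U f" "smooth_fun M U fh"
    by (rule smooth_fun_subset[OF _ oU UM], rule fM)+
  define Q where "Q = c ` (V \<inter> U)"
  have oQ: "open_RR m Q" unfolding Q_def by (rule open_image_Int[OF oU])
  define \<phi> where "\<phi> z = f (ci z)" for z
  define \<psi> where "\<psi> z = fh (ci z)" for z
  define y where "y i z = vderiv (Y i (ci z)) f" for i z
  define yh where "yh i z = vderiv (Y i (ci z)) fh" for i z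
  have Yf: "smooth_fun M U (\<lambda>p. vderiv (Y i p) f)" "smooth_fun M U (\<lambda>p. vderiv (Y i p) fh)" if "i < d" for i
    by (rule smooth_fun_vderiv[OF Y[OF that] fU(1) subset_refl], rule smooth_fun_vderiv[OF Y[OF that] fU(2) subset_refl])
  have sm: "smooth_on m Q \<phi>" "smooth_on m Q \<psi>" "i < d \<Longrightarrow> smooth_on m Q (y i)" "i < d \<Longrightarrow> smooth_on m Q (yh i)" for i
    unfolding Q_def \<phi>_def[abs_def] \<psi>_def[abs_def] y_def[abs_def] yh_def[abs_def]
    by (rule smooth_fun_chart[OF fU(1)], rule smooth_fun_chart[OF fU(2)], erule smooth_fun_chart[OF Yf(1)], erule smooth_fun_chart[OF Yf(2)])
  define z0 where "z0 = c x0"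
  have z0: "z0 \<in> Q" using x0 Vc(2) by (simp add: Q_def z0_def)
  have ciz0: "ci z0 = x0" using Vc(2) by (simp add: z0_def)
  have ciQ: "ci z \<in> U" "ci z \<in> V" "c (ci z) = z" if "z \<in> Q" for z
    using that unfolding Q_def by auto
  have dv: "vderiv (chart_vector M (V, c) (ci z) u) f = deriv_at m \<phi> z u"
      "vderiv (chart_vector M (V, c) (ci z) u) fh = deriv_at m \<psi> z u" if "z \<in> Q" "u \<in> RR m" for z u
    using vderiv_chart_vector[OF fU(1) ciQ(1,2)[OF that(1)] that(2)] vderiv_chart_vector[OF fU(2) ciQ(1,2)[OF that(1)] that(2)] ciQ(3)[OF that(1)]
    by (simp_all add: \<phi>_def[abs_def] \<psi>_def[abs_def])
  have cv0: "chart_vector M (V, c) p 0 = (\<lambda>_. 0)" if "p \<in> V" for p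
    using chart_vector_linear[OF that RR_0 RR_0, of 0 0] by simp
  \<comment> \<open>The pair inherits both independence hypotheses from its first component.\<close>
  define \<Phi> where "\<Phi> z = (\<phi> z, \<psi> z)" for z
  define \<Upsilon> where "\<Upsilon> i z = (y i z, yh i z)" for i z
  have \<Phi>sm: "smooth_on m Q \<Phi>" unfolding \<Phi>_def[abs_def] by (rule smooth_on_Pair[OF oQ sm(1,2)])
  have \<Upsilon>sm: "smooth_on m Q (\<Upsilon> i)" if "i < d" for i
    unfolding \<Upsilon>_def[abs_def] by (rule smooth_on_Pair[OF oQ sm(3,4)[OF that]])
  have d\<Phi>: "deriv_at m \<Phi> z u = (deriv_at m \<phi> z u, deriv_at m \<psi> z u)" if "z \<in> Q" "u \<in> RR m" for z u
    unfolding \<Phi>_def[abs_def] by (rule deriv_at_Pair[OF oQ sm(1,2) that])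
  have d\<Upsilon>: "deriv_at m (\<Upsilon> i) z u = (deriv_at m (y i) z u, deriv_at m (yh i) z u)" if "i < d" "z \<in> Q" "u \<in> RR m" for i z u
    unfolding \<Upsilon>_def[abs_def] by (rule deriv_at_Pair[OF oQ sm(3,4)[OF that(1)] that(2,3)])
  have ind\<Phi>: "lin_indep m (\<lambda>j. dir_deriv (unit_seq j) \<Phi> z0)"
    unfolding lin_indep_def
  proof (intro allI impI)
    fix a i assume eq: "(\<Sum>j<m. a j *\<^sub>R dir_deriv (unit_seq j) \<Phi> z0) = 0" and i: "i < m"
    let ?u = "\<Sum>j<m. a j *\<^sub>R unit_seq j"
    have uR: "?u \<in> RR m" by (intro RR_intros) auto
    have "deriv_at m \<Phi> z0 ?u = 0" using eq unfolding deriv_at_def coord_sum_unit_seq by simp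
    then have "vderiv (chart_vector M (V, c) x0 ?u) f = 0"
      using dv(1)[OF z0 uR] d\<Phi>[OF z0 uR] ciz0 by (simp add: zero_prod_def)
    then have "chart_vector M (V, c) x0 ?u = (\<lambda>_. 0)"
      by (rule immersion_kernel[OF f x0M chart_vector_in[OF Vc(2) uR]])
    then have "apply_bcontfun ?u i = 0" using chart_vector_coord[OF Vc(2) uR, of i] by simp
    then show "a i = 0" using i unfolding coord_sum_unit_seq by simp
  qed
  have ind\<Upsilon>: "lin_indep d (\<lambda>i. \<Upsilon> i z0)"
    using ind unfolding lin_indep_def \<Upsilon>_def y_def ciz0 by (auto simp: sum_prod prod_eq_iff fst_sum)
  have deg: "\<exists>u\<in>RR m. \<exists>r. (u \<noteq> 0 \<or> r \<noteq> 0) \<and>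
       deriv_at m \<Phi> z u + (\<Sum>i<d. a i *\<^sub>R deriv_at m (\<Upsilon> i) z u) + r *\<^sub>R (\<Sum>i<d. a i *\<^sub>R \<Upsilon> i z) = 0"
    if z: "z \<in> Q" for z and a :: "nat \<Rightarrow> real"
  proof -
    obtain X r where X: "X \<in> tangent_space M (ci z)" "X \<noteq> (\<lambda>_. 0) \<or> r \<noteq> 0"
      "vderiv X f + vderiv X (\<lambda>y. \<Sum>i<d. a i *\<^sub>R vderiv (Y i y) f) + r *\<^sub>R (\<Sum>i<d. a i *\<^sub>R vderiv (Y i (ci z)) f) = 0"
      "vderiv X fh + vderiv X (\<lambda>y. \<Sum>i<d. a i *\<^sub>R vderiv (Y i y) fh) + r *\<^sub>R (\<Sum>i<d. a i *\<^sub>R vderiv (Y i (ci z)) fh) = 0"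
      using degenerate[OF ciQ(1)[OF z]] by blast
    obtain u where u: "u \<in> RR m" "X = chart_vector M (V, c) (ci z) u" using X(1) tangent_space_eq[OF ciQ(2)[OF z]] by blast
    have "u \<noteq> 0 \<or> r \<noteq> 0" using X(2) u(2) cv0[OF ciQ(2)[OF z]] by auto
    have "smooth_fun M U (\<lambda>p. \<Sum>i<d. a i *\<^sub>R vderiv (Y i p) f)" "smooth_fun M U (\<lambda>p. \<Sum>i<d. a i *\<^sub>R vderiv (Y i p) fh)"
      using Yf by (intro smooth_fun_sum oU smooth_fun_bounded_linear[OF bounded_linear_scaleR_right]; simp)+
    from vderiv_chart_vector[OF this(1) ciQ(1,2)[OF z] u(1)] vderiv_chart_vector[OF this(2) ciQ(1,2)[OF z] u(1)]
    have "vderiv X (\<lambda>p. \<Sum>i<d. a i *\<^sub>R vderiv (Y i p) f) = deriv_at m (\<lambda>z. \<Sum>i<d. a i *\<^sub>R y i z) z u"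
      "vderiv X (\<lambda>p. \<Sum>i<d. a i *\<^sub>R vderiv (Y i p) fh) = deriv_at m (\<lambda>z. \<Sum>i<d. a i *\<^sub>R yh i z) z u"
      by (simp_all add: u(2) ciQ(3)[OF z] y_def yh_def)
    then have dX: "vderiv X (\<lambda>p. \<Sum>i<d. a i *\<^sub>R vderiv (Y i p) f) = (\<Sum>i<d. a i *\<^sub>R deriv_at m (y i) z u)"
      "vderiv X (\<lambda>p. \<Sum>i<d. a i *\<^sub>R vderiv (Y i p) fh) = (\<Sum>i<d. a i *\<^sub>R deriv_at m (yh i) z u)"
      using deriv_at_lincomb[OF oQ _ z u(1), of d y a] deriv_at_lincomb[OF oQ _ z u(1), of d yh a] sm(3,4) by simp_all
    have "(\<Sum>i<d. a i *\<^sub>R deriv_at m (\<Upsilon> i) z u) = (\<Sum>i<d. a i *\<^sub>R (deriv_at m (y i) z u, deriv_at m (yh i) z u))"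
      using d\<Upsilon>[OF _ z u(1)] by (intro sum.cong) auto
    then have "deriv_at m \<Phi> z u + (\<Sum>i<d. a i *\<^sub>R deriv_at m (\<Upsilon> i) z u) + r *\<^sub>R (\<Sum>i<d. a i *\<^sub>R \<Upsilon> i z) =
      (vderiv X f + vderiv X (\<lambda>y. \<Sum>i<d. a i *\<^sub>R vderiv (Y i y) f) + r *\<^sub>R (\<Sum>i<d. a i *\<^sub>R vderiv (Y i (ci z)) f),
       vderiv X fh + vderiv X (\<lambda>y. \<Sum>i<d. a i *\<^sub>R vderiv (Y i y) fh) + r *\<^sub>R (\<Sum>i<d. a i *\<^sub>R vderiv (Y i (ci z)) fh))"
      unfolding dX dv[OF z u(1), folded u(2)] d\<Phi>[OF z u(1)] by (simp add: sum_prod \<Upsilon>_def y_def yh_def)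
    then show ?thesis using X(3,4) u(1) \<open>u \<noteq> 0 \<or> r \<noteq> 0\<close> by (auto simp: zero_prod_def)
  qed
  obtain B s where B: "open_RR d B" "0 \<in> B" "smooth_on d B s" "s ` B \<subseteq> Q" "s 0 = z0"
    "\<forall>a\<in>B. \<Phi> (s a) = \<Phi> z0 + (\<Sum>i<d. apply_bcontfun a i *\<^sub>R \<Upsilon> i z0)"
    using lines_in_image[OF oQ z0 \<Phi>sm \<Upsilon>sm ind\<Phi> ind\<Upsilon> deg] by auto
  have fs: "f (ci (s a)) = f x0 + (\<Sum>i<d. apply_bcontfun a i *\<^sub>R vderiv (Y i x0) f)"
    "fh (ci (s a)) = fh x0 + (\<Sum>i<d. apply_bcontfun a i *\<^sub>R vderiv (Y i x0) fh)" if "a \<in> B" for a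
    using B(6)[rule_format, OF that] by (simp_all add: \<Phi>_def \<Upsilon>_def sum_prod \<phi>_def \<psi>_def y_def yh_def ciz0)
  obtain lam where lam: "bounded_linear lam" "\<And>a. a \<in> RR d \<Longrightarrow> lam (\<Sum>i<d. apply_bcontfun a i *\<^sub>R vderiv (Y i x0) f) = a"
    using linear_left_inverse_RR[OF ind] by blast
  \<comment> \<open>The parameter of a point of the ruling is read off from its image under
    \<open>f\<close>, where the ruling is affine.\<close>
  define k where "k z = lam (\<phi> z - f x0)" for z
  have kc: "continuous_on (s ` B) k"
    unfolding k_def
    by (intro bounded_linear.continuous_on[OF lam(1)] continuous_on_diff continuous_on_const
        continuous_on_subset[OF smooth_on_continuous[OF sm(1)] B(4)])
  have ks: "\<forall>a\<in>B. k (s a) = a"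
    using fs(1) lam(2)[OF open_RR_subset[OF B(1)]] by (simp add: k_def \<phi>_def)
  have sV: "s ` B \<subseteq> c ` V" using B(4) unfolding Q_def by blast
  have YT: "Y i x0 \<in> tangent_space M x0" if "i < d" for i by (rule vector_fieldD(2)[OF Y[OF that] x0])
  have sumT: "(\<lambda>g. \<Sum>i<d. a i * Y i x0 g) \<in> tangent_space M x0" for a
    by (rule tangent_sum[OF x0M]) (rule YT)
  \<comment> \<open>Equal induced metrics carry the independence of the frame from \<open>f\<close>
    over to \<open>fh\<close>.\<close>
  have T: "(\<Sum>i<d. a i *\<^sub>R vderiv (Y i x0) f) \<bullet> (\<Sum>i<d. a i *\<^sub>R vderiv (Y i x0) f) =
     (\<Sum>i<d. a i *\<^sub>R vderiv (Y i x0) fh) \<bullet> (\<Sum>i<d. a i *\<^sub>R vderiv (Y i x0) fh)" for a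
  proof -
    have "vderiv X f \<bullet> vderiv X f = vderiv X fh \<bullet> vderiv X fh" if "X \<in> tangent_space M x0" for X
      using f fh x0M that unfolding isometric_immersion_def by simp
    from this[OF sumT[of a]] show ?thesis unfolding vderiv_sum_left .
  qed
  have indh: "lin_indep d (\<lambda>i. vderiv (Y i x0) fh)"
    unfolding lin_indep_def
  proof (intro allI impI)
    fix a i assume "(\<Sum>i<d. a i *\<^sub>R vderiv (Y i x0) fh) = 0" and i: "i < d"
    then have "(\<Sum>i<d. a i *\<^sub>R vderiv (Y i x0) f) = 0" using T[of a] by simp
    then show "a i = 0" using ind i unfolding lin_indep_def by blast
  qed
  have inj: "inj_on (\<lambda>X. vderiv X f) (tangent_space M x0)" "inj_on (\<lambda>X. vderiv X fh) (tangent_space M x0)"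
    using f fh x0M unfolding isometric_immersion_def immersion_at_def by blast+
  have YT': "\<forall>i<d. Y i x0 \<in> tangent_space M x0" using YT by blast
  have s0: "x0 = ci (s 0)" using B(5) ciz0 by simp
  have "ruling M G f d \<Delta> x0 (param_mfd d B s k)"
    by (rule ruling_param_mfd[where h=f and w="\<lambda>i. vderiv (Y i x0) f" and p="f x0" and \<Delta>=\<Delta>, OF B(1,3) sV kc ks f ind B(2)])
       (use fs(1) s0 span_eq_vderiv[OF x0M YT' inj(1), folded \<Delta>] in simp_all)
  moreover have "ruling M G fh d \<Delta> x0 (param_mfd d B s k)"
    by (rule ruling_param_mfd[where h=fh and w="\<lambda>i. vderiv (Y i x0) fh" and p="fh x0" and \<Delta>=\<Delta>, OF B(1,3) sV kc ks fh indh B(2)])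
       (use fs(2) s0 span_eq_vderiv[OF x0M YT' inj(2), folded \<Delta>] in simp_all)
  ultimately show ?thesis by blast
qed

end

section \<open>Rulings of the deformation over open pieces\<close>

context deformation
begin

lemma \<tau>_zero:
  assumes "x \<in> points M"
  shows "\<tau> x 0 = 0"
proof -
  have "0 \<in> L x" using fiber_L[OF assms] subspace_0 by blast
  then have "\<tau> x (0 *\<^sub>R 0 + 0 *\<^sub>R 0) = 0 *\<^sub>R \<tau> x 0 + 0 *\<^sub>R \<tau> x 0"
    using \<tau> assms unfolding bundle_isometry_def by blast
  then show ?thesis by simp
qed

lemma mutual_rulings:
  assumes C: "openin (mtop M) C" and x0: "x0 \<in> C"
  shows "\<exists>S. ruling (open_submfd M C) G f d (\<lambda>x. {X. (X, 0) \<in> D x}) x0 S \<and>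
    ruling (open_submfd M C) G fh d (\<lambda>x. {X. (X, 0) \<in> D x}) x0 S"
proof -
  have x0M: "x0 \<in> points M" using x0 openin_subset[OF C] by blast
  obtain U Y \<xi> where fr: "x0 \<in> U" "openin (mtop M) U" "\<forall>i<d. vector_field M U (Y i) \<and> normal_section M L U (\<xi> i)"
    "\<forall>y\<in>U. D y = {(\<lambda>g. \<Sum>i<d. a i * Y i y g, \<Sum>i<d. a i *\<^sub>R \<xi> i y) | a :: nat \<Rightarrow> real. True} \<and>
           (\<forall>a :: nat \<Rightarrow> real. (\<forall>g. (\<Sum>i<d. a i * Y i y g) = 0) \<and> (\<Sum>i<d. a i *\<^sub>R \<xi> i y) = 0 \<longrightarrow> (\<forall>i<d. a i = 0))"
    using ex_frame[OF x0M] by (elim exE conjE) (rule that)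
  have Y: "vector_field M U (Y i)" if "i < d" for i using fr(3) that by blast
  have UM: "y \<in> points M" if "y \<in> U" for y using that openin_subset[OF fr(2)] by blast
  have inD: "(\<lambda>g. \<Sum>i<d. a i * Y i y g, \<Sum>i<d. a i *\<^sub>R \<xi> i y) \<in> D y" if "y \<in> U" for a y
    using fr(4) that by blast
  have \<xi>0: "(\<Sum>i<d. a i *\<^sub>R \<xi> i y) = 0" if "y \<in> U" for a y
    using D_tangent[OF UM[OF that] inD[OF that]] .
  have Deq: "{X. (X, 0) \<in> D x0} = {\<lambda>g. \<Sum>i<d. a i * Y i x0 g | a :: nat \<Rightarrow> real. True}"
    using fr(4) fr(1) \<xi>0[OF fr(1)] by auto
  have ind: "lin_indep d (\<lambda>i. vderiv (Y i x0) f)"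
    unfolding lin_indep_def
  proof (intro allI impI)
    fix a i assume eq: "(\<Sum>i<d. a i *\<^sub>R vderiv (Y i x0) f) = 0" and i: "i < d"
    have T: "(\<lambda>g. \<Sum>i<d. a i * Y i x0 g) \<in> tangent_space M x0"
      by (rule tangent_sum[OF x0M]) (rule vector_fieldD(2)[OF Y fr(1)])
    have "(\<lambda>g. \<Sum>i<d. a i * Y i x0 g) = (\<lambda>_. 0)"
      by (rule immersion_kernel[OF f x0M T]) (simp add: vderiv_sum_left eq)
    then have "\<forall>g. (\<Sum>i<d. a i * Y i x0 g) = 0" by (simp add: fun_eq_iff)
    then show "a i = 0" using fr(1,4) \<xi>0[OF fr(1)] i by blast
  qed
  have sec0: "normal_section M L U (\<lambda>_. 0)"
    unfolding normal_section_def using smooth_fun_const[OF fr(2)] fiber_L[OF UM] subspace_0 by blast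
  have deg: "\<exists>X\<in>tangent_space M x. \<exists>r. (X \<noteq> (\<lambda>_. 0) \<or> r \<noteq> 0) \<and>
      vderiv X f + vderiv X (\<lambda>y. \<Sum>i<d. a i *\<^sub>R vderiv (Y i y) f) + r *\<^sub>R (\<Sum>i<d. a i *\<^sub>R vderiv (Y i x) f) = 0 \<and>
      vderiv X fh + vderiv X (\<lambda>y. \<Sum>i<d. a i *\<^sub>R vderiv (Y i y) fh) + r *\<^sub>R (\<Sum>i<d. a i *\<^sub>R vderiv (Y i x) fh) = 0"
    if x: "x \<in> U" for x a
  proof -
    let ?Y = "\<lambda>y g. \<Sum>i<d. a i * Y i y g"
    have vf: "vector_field M U ?Y" by (rule vector_field_sum[OF fr(2) Y])
    have YD: "(?Y y, 0) \<in> D y" if "y \<in> U" for y using inD[OF that, of a] \<xi>0[OF that, of a] by simp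
    \<comment> \<open>The coefficients \<open>a\<close> are arbitrary, so the value
      \<open>t = 1\<close> already contains all others.\<close>
    obtain X r where X: "X \<in> tangent_space M x" "X \<noteq> (\<lambda>_. 0) \<or> r \<noteq> 0"
      "vderiv X f + 1 *\<^sub>R vderiv X (\<lambda>y. vderiv (?Y y) f + 0) + r *\<^sub>R (vderiv (?Y x) f + 0) = 0"
      "vderiv X fh + 1 *\<^sub>R vderiv X (\<lambda>y. vderiv (?Y y) fh + \<tau> y 0) + r *\<^sub>R (vderiv (?Y x) fh + \<tau> x 0) = 0"
      using degenerate_section[OF vf sec0 YD x, of 1] by blast
    have "vderiv X (\<lambda>y. vderiv (?Y y) fh + \<tau> y 0) = vderiv X (\<lambda>y. vderiv (?Y y) fh)"
      by (rule vderiv_cong[OF X(1) fr(2) x]) (simp add: \<tau>_zero UM)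
    then show ?thesis
      using X \<tau>_zero[OF UM[OF x]] unfolding vderiv_sum_left by auto
  qed
  interpret M': smooth_mfd "open_submfd M C" by (unfold_locales) (rule smooth_manifold_open_submfd[OF C])
  have o: "openin (mtop M) (U \<inter> C)" by (intro openin_Int fr(2) C)
  show ?thesis
  \<comment> \<open>The construction is run inside \<open>open_submfd M C\<close>, so that the
    ruling is a submanifold of the open piece itself.\<close>
  proof (rule M'.ruling_exists[OF isometric_immersion_open_submfd[OF C f] isometric_immersion_open_submfd[OF C fh], where U = "U \<inter> C" and Y = Y])
    show "x0 \<in> U \<inter> C" using fr(1) x0 by blast
    show "openin (mtop (open_submfd M C)) (U \<inter> C)" using o openin_open_submfd[OF C] by blast
    show "vector_field (open_submfd M C) (U \<inter> C) (Y i)" if "i < d" for i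
      unfolding vector_field_open_submfd[OF C] using vector_field_subset[OF Y[OF that] o] by blast
    show "{X. (X, 0) \<in> D x0} = {\<lambda>g. \<Sum>i<d. a i * Y i x0 g | a :: nat \<Rightarrow> real. True}" by (rule Deq)
    fix x and a :: "nat \<Rightarrow> real" assume "x \<in> U \<inter> C"
    then have x: "x \<in> U" "x \<in> C" by auto
    show "\<exists>X\<in>tangent_space (open_submfd M C) x. \<exists>r. (X \<noteq> (\<lambda>_. 0) \<or> r \<noteq> 0) \<and>
      vderiv X f + vderiv X (\<lambda>y. \<Sum>i<d. a i *\<^sub>R vderiv (Y i y) f) + r *\<^sub>R (\<Sum>i<d. a i *\<^sub>R vderiv (Y i x) f) = 0 \<and>
      vderiv X fh + vderiv X (\<lambda>y. \<Sum>i<d. a i *\<^sub>R vderiv (Y i y) fh) + r *\<^sub>R (\<Sum>i<d. a i *\<^sub>R vderiv (Y i x) fh) = 0"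
      unfolding tangent_space_open_submfd[OF C x(2)] by (rule deg[OF x(1)])
  qed (rule ind)
qed

end

text \<open>Charts contain images of convex balls, so every point has a connected open
  neighbourhood, which lies in the component of that point.\<close>

lemma (in smooth_mfd) openin_component:
  assumes C: "C \<in> connected_components_of (mtop M)"
  shows "openin (mtop M) C"
proof (subst openin_subopen, intro ballI)
  fix x assume x: "x \<in> C"
  then have "x \<in> points M" using connected_components_of_subset[OF C] by blast
  then obtain V c where Vc: "mfd_chart M V c" "x \<in> V" using ex_chart by metis
  interpret mfd_chart M V c by fact
  have cx: "c x \<in> c ` V" using Vc(2) by blast
  obtain e where e: "e > 0" "\<And>y. y \<in> RR m \<Longrightarrow> dist y (c x) < e \<Longrightarrow> y \<in> c ` V"
    using open_RR_ball[OF chart_props(2) cx] by metis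
  define Z where "Z = RR m \<inter> ball (c x) e"
  have Z: "open_RR m Z" "Z \<subseteq> c ` V" "c x \<in> Z"
    using e open_RR_subset[OF chart_props(2) cx] by (auto simp: Z_def dist_commute intro: openin_open_Int)
  have "convex Z" unfolding Z_def by (intro convex_Int subspace_imp_convex subspace_RR convex_ball)
  then have "connectedin (top_of_set (c ` V)) Z"
    using convex_connected Z(2) by (simp add: connectedin_subtopology)
  then have conn: "connectedin (mtop M) (ci ` Z)"
    by (rule connectedin_continuous_map_image[OF ci_continuous])
  have im: "ci ` Z = {p \<in> V. c p \<in> Z}"
  proof
    show "ci ` Z \<subseteq> {p \<in> V. c p \<in> Z}" using Z(2) ci_in c_ci by fastforce
    show "{p \<in> V. c p \<in> Z} \<subseteq> ci ` Z"
    proof clarify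
      fix p assume "p \<in> V" "c p \<in> Z"
      then show "p \<in> ci ` Z" by (intro image_eqI[of _ _ "c p"]) simp_all
    qed
  qed
  have xZ: "x \<in> ci ` Z" unfolding im using Vc(2) Z(3) by blast
  then have "ci ` Z \<subseteq> C"
    using connected_components_of_maximal[OF C conn] x by (auto simp: disjnt_iff)
  moreover have "openin (mtop M) (ci ` Z)" unfolding im by (rule open_preimage[OF Z(1,2)])
  ultimately show "\<exists>T. openin (mtop M) T \<and> x \<in> T \<and> T \<subseteq> C" using xZ by blast
qed

theorem theorem4:
  fixes M :: "'a mfd" and G :: "'a metric"
    and f :: "'a \<Rightarrow> 'v::euclidean_space" and fh :: "'a \<Rightarrow> 'w::euclidean_space"
    and L :: "'a \<Rightarrow> 'v set" and Lh :: "'a \<Rightarrow> 'w set" and \<tau> :: "'a \<Rightarrow> 'v \<Rightarrow> 'w"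
    and D :: "'a \<Rightarrow> ('a tvec \<times> 'v) set"
    and n p q l d :: nat
  assumes "smooth_manifold M" and "mdim M = n" and "riemannian_metric M G"
    and "DIM('v) = n + p" and "DIM('w) = n + q"
    and "isometric_immersion M G f" and "isometric_immersion M G fh"
    and "strongly_genuine M f fh"
    and "normal_subbundle M f l L" and "normal_subbundle M fh l Lh"
    and "bundle_isometry M L Lh \<tau>"
    and "preserves_sff M f fh L Lh \<tau>" and "parallel_isometry M f fh L Lh \<tau>"
    and "subbundle_TM_plus M L d D"
    and "\<forall>x\<in>points M. null_subset (phi_image M f fh L Lh \<tau> D x)"
  shows "(\<forall>x\<in>points M. \<forall>(X, \<xi>)\<in>D x. \<xi> = 0) \<and>
    (\<exists>W. openin (mtop M) W \<and> mtop M closure_of W = points M \<and>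
      (\<forall>C\<in>connected_components_of (subtopology (mtop M) W).
         mutually_ruled (open_submfd M C) G f fh d (\<lambda>x. {X. (X, 0) \<in> D x})))"
proof -
  interpret deformation M G f fh L Lh \<tau> D l d
    using assms by unfold_locales
  have "mutually_ruled (open_submfd M C) G f fh d (\<lambda>x. {X. (X, 0) \<in> D x})"
    if "C \<in> connected_components_of (mtop M)" for C
  proof -
    have oC: "openin (mtop M) C" by (rule openin_component[OF that])
    show ?thesis
      unfolding mutually_ruled_def ruled_def points_open_submfd[OF oC]
      using mutual_rulings[OF oC] by metis
  qed
  moreover have "openin (mtop M) (points M)" "mtop M closure_of points M = points M" by simp_all
  ultimately have "\<exists>W. openin (mtop M) W \<and> mtop M closure_of W = points M \<and>
      (\<forall>C\<in>connected_components_of (subtopology (mtop M) W).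
         mutually_ruled (open_submfd M C) G f fh d (\<lambda>x. {X. (X, 0) \<in> D x}))"
    by (intro exI[of _ "points M"]) simp
  moreover have "\<forall>x\<in>points M. \<forall>(X, \<xi>)\<in>D x. \<xi> = 0"
    using D_tangent by blast
  ultimately show ?thesis by blast
qed

end
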